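(* Let $Z\subseteq\mathbb{P}(V)=\mathrm{Proj}(\mathbb{K}[X_0,\ldots,X_n])$ be a finite set of points, and let $\mathcal{A}_Z\subseteq\mathbb{P}(W)$ denote the dual hyperplane arrangement. Then for $\lambda\in S\otimes_{\mathbb{K}}W$ the following are equivalent: (i) $\theta_\lambda\in D(\mathcal{A}_Z)$; (ii) $F_\lambda\in I(Z)\cdot\mathbb{K}[\mathbf{A}]$. Moreover, $F_\lambda=0$ if and only if there exists $g\in S$ with $\theta_\lambda=g\theta_e$, where $\theta_e=\sum_{i=0}^nY_i\frac{\partial}{\partial Y_i}$ is the Euler derivation. In other words, there is an isomorphism of graded modules $\eta:\mathrm{PL}(n)\otimes_SD_0(\mathcal{A}_Z)(-1)\to I^{\gg}(Z)$ given by $$\eta\left(\sum_{i=0}^nf_i(Y_0,\ldots,Y_n)\frac{\partial}{\partial Y_i}\right)=\sum_{i=0}^nf_i(M_0,\ldots,M_n)X_i.$$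
   Context: $\mathbb{K}$ is an algebraically closed field of arbitrary characteristic. $V$ and $W$ are dual $\mathbb{K}$-vector spaces of dimension $n+1$. $X_0,\ldots,X_n$ is a basis of $V^*$ and $Y_0,\ldots,Y_n$ is the dual basis of $W^*$ (under $W^*\cong V$), so that the point $v=(c_0,\ldots,c_n)\in V$ corresponds to the linear form $\ell_v=\sum c_iY_i\in W^*$. $R=\mathrm{Sym}(V^* )=\mathbb{K}[X_0,\ldots,X_n]$ and $S=\mathrm{Sym}(W^* )=\mathbb{K}[Y_0,\ldots,Y_n]$. The dual arrangement $\mathcal{A}_Z$ consists of the hyperplanes $\{\ell_v=0\}\subseteq\mathbb{P}(W)$ for $[v]\in Z$. Derivations: for a hyperplane arrangement $\mathcal{A}$, $D(\mathcal{A})$ is the $S$-module of $\mathbb{K}$-linear derivations $\theta:S\to S$ with $\theta(I(H))\subseteq I(H)$ for all $H\in\mathcal{A}$, graded so that $\deg\theta=\deg\theta(\ell)$ for linear forms $\ell$, and $D_0(\mathcal{A})=D(\mathcal{A})/S\theta_e$. The map $\eta$ in the claim is evaluated on representatives in $D(\mathcal{A}_Z)$. Let $W_0,\ldots,W_n$ be the basis of $W$ dual to $Y_0,\ldots,Y_n$. For $\lambda=\sum_if_i\otimes W_i\in S\otimes_{\mathbb{K}}W$, put $\theta_\lambda=\sum_if_i\,\partial/\partial Y_i$. The ring $\mathbb{K}[\mathbf{A}]$: this is $\mathbb{K}[X_0,\ldots,X_n][A_{i,j}:1\leq i\leq n-1,\ 0\leq j\leq n]$, a polynomial ring. For $0\leq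 i\leq n$, $M_i\in\mathbb{K}[\mathbf{A}]$ is the determinant of the $(n+1)\times(n+1)$ matrix whose first row is the $i$-th standard basis vector $(0,\ldots,1,\ldots,0)$ (entries indexed from $0$), whose second row is $(X_0,\ldots,X_n)$, and whose remaining rows are $(A_{k,0},\ldots,A_{k,n})$ for $k=1,\ldots,n-1$. $\mathrm{PL}(n)$ is the $\mathbb{K}$-subalgebra of $\mathbb{K}[\mathbf{A}]$ generated by $M_0,\ldots,M_n$; it is a polynomial ring in the $M_i$ and is identified with $S$ via $\tau(Y_i)=M_i$. For $\lambda=\sum_if_i\otimes W_i$ put $F_\lambda=\sum_{i=0}^nX_i\,f_i(M_0,\ldots,M_n)\in\mathbb{K}[\mathbf{A}]$. The module $I^{\gg}(Z)$: let $\mathfrak{m}^{\gg}$ be the $\mathrm{PL}(n)$-submodule of $\mathbb{K}[\mathbf{A}]$ generated by $X_0,\ldots,X_n$, graded so that $\deg M_i=\deg X_i=1$ (so degree $d$ elements are $\mathbb{K}$-combinations of products $X_iM_0^{e_0}\cdots M_n^{e_n}$ with $\sum e_j=d-1$). For a homogeneous ideal $J\subseteq R$, $J^{\gg}=(J\,\mathbb{K}[\mathbf{A}])\cap\mathfrak{m}^{\gg}$; and $I^{\gg}(Z)=I(Z)^{\gg}$. *)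

theory Defs
  imports
    "HOL-Algebra.Algebra"
    "HOL-Library.Poly_Mapping"
    "Jordan_Normal_Form.Determinant"
begin

hide_const (open) Polynomial.smult

section \<open>Multivariate polynomials\<close>

text \<open>
  A polynomial is a finitely supported map from monomials to coefficients, where a monomial is a
  finitely supported exponent vector; the multiplication of \<^theory>\<open>HOL-Library.Poly_Mapping\<close>
  is the polynomial multiplication.
\<close>

type_synonym ('v, 'k) mp = "('v \<Rightarrow>\<^sub>0 nat) \<Rightarrow>\<^sub>0 'k"

definition mp_const :: "'k::comm_ring_1 \<Rightarrow> ('v, 'k) mp" where
  "mp_const c = Poly_Mapping.single 0 c"

definition mp_var :: "'v \<Rightarrow> ('v, 'k::comm_ring_1) mp" where
  "mp_var v = Poly_Mapping.single (Poly_Mapping.single v 1) 1"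

text \<open>Evaluation of \<open>p\<close> at \<open>\<rho>\<close>, with coefficients mapped along \<open>h\<close>.\<close>

definition mp_eval :: "('k::zero \<Rightarrow> 'b::comm_ring_1) \<Rightarrow> ('v \<Rightarrow> 'b) \<Rightarrow> ('v, 'k) mp \<Rightarrow> 'b" where
  "mp_eval h \<rho> p =
     (\<Sum>m\<in>Poly_Mapping.keys p. h (Poly_Mapping.lookup p m) *
        (\<Prod>v\<in>Poly_Mapping.keys m. \<rho> v ^ Poly_Mapping.lookup m v))"

definition mp_pderiv :: "'v \<Rightarrow> ('v, 'k::comm_ring_1) mp \<Rightarrow> ('v, 'k) mp" where
  "mp_pderiv v p =
     (\<Sum>m\<in>Poly_Mapping.keys p.
        Poly_Mapping.single (m - Poly_Mapping.single v 1)
          (of_nat (Poly_Mapping.lookup m v) * Poly_Mapping.lookup p m))"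

text \<open>The zero polynomial is homogeneous of every degree, and is the only one of negative degree.\<close>

definition homogeneous :: "int \<Rightarrow> ('v, 'k::zero) mp \<Rightarrow> bool" where
  "homogeneous d p \<longleftrightarrow>
     (\<forall>m\<in>Poly_Mapping.keys p. int (\<Sum>v\<in>Poly_Mapping.keys m. Poly_Mapping.lookup m v) = d)"

definition mpoly_ring :: "'v set \<Rightarrow> ('v, 'k::comm_ring_1) mp ring" where
  "mpoly_ring V =
     \<lparr>carrier = {p. \<forall>m\<in>Poly_Mapping.keys p. Poly_Mapping.keys m \<subseteq> V},
      monoid.mult = (*), one = 1, ring.zero = 0, ring.add = (+)\<rparr>"

definition k_span :: "('v, 'k::comm_ring_1) mp set \<Rightarrow> ('v, 'k) mp set" where
  "k_span B = {\<Sum>b\<in>F. mp_const (c b) * b | F c. finite F \<and> F \<subseteq> B}"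


section \<open>Graded modules, quotients and base change\<close>

text \<open>
  As for the other module records below, \<open>mult\<close> and \<open>one\<close> are irrelevant fields inherited from
  \<^typ>\<open>'a ring\<close>.
\<close>

definition quot_module :: "('a, 'b) module \<Rightarrow> 'b set \<Rightarrow> ('a, 'b set) module" where
  "quot_module M N =
     \<lparr>carrier = a_rcosets\<^bsub>M\<^esub> N, monoid.mult = undefined, one = undefined,
      ring.zero = N, ring.add = set_add M,
      module.smult = (\<lambda>a C. \<Union>x\<in>C. N +>\<^bsub>M\<^esub> (a \<odot>\<^bsub>M\<^esub> x))\<rparr>"

text \<open>
  \<open>P \<otimes>\<^sub>S N\<close> for a ring homomorphism \<open>\<tau> : S \<rightarrow> P\<close> and an \<open>S\<close>-module \<open>N\<close>: the free abelian group
  on pairs modulo the bilinearity relations, as a \<open>P\<close>-module.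
\<close>

definition tensor_rels ::
  "'s ring \<Rightarrow> ('s \<Rightarrow> 'p) \<Rightarrow> 'p ring \<Rightarrow> ('s, 'b) module \<Rightarrow> ('p \<times> 'b \<Rightarrow>\<^sub>0 int) set" where
  "tensor_rels S \<tau> P N =
     {frag_of (p \<oplus>\<^bsub>P\<^esub> q, x) - frag_of (p, x) - frag_of (q, x) | p q x.
        p \<in> carrier P \<and> q \<in> carrier P \<and> x \<in> carrier N} \<union>
     {frag_of (p, x \<oplus>\<^bsub>N\<^esub> y) - frag_of (p, x) - frag_of (p, y) | p x y.
        p \<in> carrier P \<and> x \<in> carrier N \<and> y \<in> carrier N} \<union>
     {frag_of (\<tau> s \<otimes>\<^bsub>P\<^esub> p, x) - frag_of (p, s \<odot>\<^bsub>N\<^esub> x) | s p x.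
        s \<in> carrier S \<and> p \<in> carrier P \<and> x \<in> carrier N}"

definition tensor_group ::
  "'p ring \<Rightarrow> ('s, 'b) module \<Rightarrow> ('p \<times> 'b \<Rightarrow>\<^sub>0 int) monoid" where
  "tensor_group P N = free_Abelian_group (carrier P \<times> carrier N)"

definition tensor_null ::
  "'s ring \<Rightarrow> ('s \<Rightarrow> 'p) \<Rightarrow> 'p ring \<Rightarrow> ('s, 'b) module \<Rightarrow> ('p \<times> 'b \<Rightarrow>\<^sub>0 int) set" where
  "tensor_null S \<tau> P N = generate (tensor_group P N) (tensor_rels S \<tau> P N)"

definition base_change ::
  "'s ring \<Rightarrow> ('s \<Rightarrow> 'p) \<Rightarrow> 'p ring \<Rightarrow> ('s, 'b) module \<Rightarrow>
     ('p, ('p \<times> 'b \<Rightarrow>\<^sub>0 int) set) module" where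
  "base_change S \<tau> P N =
     \<lparr>carrier = rcosets\<^bsub>tensor_group P N\<^esub> (tensor_null S \<tau> P N),
      monoid.mult = undefined, one = undefined,
      ring.zero = tensor_null S \<tau> P N, ring.add = set_mult (tensor_group P N),
      module.smult = (\<lambda>p C. \<Union>f\<in>C. tensor_null S \<tau> P N #>\<^bsub>tensor_group P N\<^esub>
                 frag_extend (\<lambda>(q, x). frag_of (p \<otimes>\<^bsub>P\<^esub> q, x)) f)\<rparr>"

definition pure_tensor ::
  "'s ring \<Rightarrow> ('s \<Rightarrow> 'p) \<Rightarrow> 'p ring \<Rightarrow> ('s, 'b) module \<Rightarrow> 'p \<Rightarrow> 'b \<Rightarrow>
     ('p \<times> 'b \<Rightarrow>\<^sub>0 int) set" where
  "pure_tensor S \<tau> P N p x = tensor_null S \<tau> P N #>\<^bsub>tensor_group P N\<^esub> frag_of (p, x)"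

text \<open>A grading is given by its family of homogeneous components.\<close>

definition twist :: "(int \<Rightarrow> 'b set) \<Rightarrow> int \<Rightarrow> (int \<Rightarrow> 'b set)" where
  "twist gM k = (\<lambda>d. gM (k + d))"

definition quot_grading :: "('a, 'b) module \<Rightarrow> 'b set \<Rightarrow> (int \<Rightarrow> 'b set) \<Rightarrow> (int \<Rightarrow> 'b set set)" where
  "quot_grading M N gM = (\<lambda>d. {N +>\<^bsub>M\<^esub> x | x. x \<in> gM d})"

definition base_change_grading ::
  "'s ring \<Rightarrow> ('s \<Rightarrow> 'p) \<Rightarrow> 'p ring \<Rightarrow> (int \<Rightarrow> 'p set) \<Rightarrow> ('s, 'b) module \<Rightarrow> (int \<Rightarrow> 'b set) \<Rightarrow>
     (int \<Rightarrow> ('p \<times> 'b \<Rightarrow>\<^sub>0 int) set set)" where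
  "base_change_grading S \<tau> P gP N gN = (\<lambda>d.
     generate (add_monoid (base_change S \<tau> P N))
       {pure_tensor S \<tau> P N p x | p x. \<exists>a b. a + b = d \<and> p \<in> gP a \<and> x \<in> gN b})"

definition graded_module ::
  "'p ring \<Rightarrow> (int \<Rightarrow> 'p set) \<Rightarrow> ('p, 'b) module \<Rightarrow> (int \<Rightarrow> 'b set) \<Rightarrow> bool" where
  "graded_module P gP M gM \<longleftrightarrow>
     Module.module P M \<and>
     (\<forall>d. subgroup (gM d) (add_monoid M)) \<and>
     (\<forall>a b. \<forall>p\<in>gP a. \<forall>x\<in>gM b. p \<odot>\<^bsub>M\<^esub> x \<in> gM (a + b)) \<and>
     (\<forall>x\<in>carrier M. \<exists>!c. (\<forall>d. c d \<in> gM d) \<and> finite {d. c d \<noteq> \<zero>\<^bsub>M\<^esub>} \<and>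
        x = finsum M c {d. c d \<noteq> \<zero>\<^bsub>M\<^esub>})"

definition graded_module_iso ::
  "'p ring \<Rightarrow> (int \<Rightarrow> 'p set) \<Rightarrow> ('p, 'b) module \<Rightarrow> (int \<Rightarrow> 'b set) \<Rightarrow>
     ('p, 'c) module \<Rightarrow> (int \<Rightarrow> 'c set) \<Rightarrow> ('b \<Rightarrow> 'c) \<Rightarrow> bool" where
  "graded_module_iso P gP M gM N gN h \<longleftrightarrow>
     graded_module P gP M gM \<and> graded_module P gP N gN \<and>
     bij_betw h (carrier M) (carrier N) \<and>
     (\<forall>x\<in>carrier M. \<forall>y\<in>carrier M. h (x \<oplus>\<^bsub>M\<^esub> y) = h x \<oplus>\<^bsub>N\<^esub> h y) \<and>
     (\<forall>p\<in>carrier P. \<forall>x\<in>carrier M. h (p \<odot>\<^bsub>M\<^esub> x) = p \<odot>\<^bsub>N\<^esub> h x) \<and>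
     (\<forall>d. h ` gM d = gN d)"


section \<open>Points and hyperplanes in projective space\<close>

text \<open>
  In the bases dual to \<open>X\<^sub>0, \<dots>, X\<^sub>n\<close> and \<open>Y\<^sub>0, \<dots>, Y\<^sub>n\<close> both \<open>V\<close> and \<open>W\<close> are \<open>K\<^sup>n\<^sup>+\<^sup>1\<close>.
  A point of \<open>\<P>(V)\<close> or \<open>\<P>(W)\<close> is a line through the origin. Likewise \<open>coord_ring n\<close> is both
  \<open>R = K[X\<^sub>0, \<dots>, X\<^sub>n]\<close> and \<open>S = K[Y\<^sub>0, \<dots>, Y\<^sub>n]\<close>.
\<close>

definition line_through :: "'k::field vec \<Rightarrow> 'k vec set" where
  "line_through v = {c \<cdot>\<^sub>v v | c. True}"

definition proj_space :: "nat \<Rightarrow> 'k::field vec set set" where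
  "proj_space n = {line_through v | v. v \<in> carrier_vec (Suc n) \<and> v \<noteq> 0\<^sub>v (Suc n)}"

abbreviation coord_ring :: "nat \<Rightarrow> (nat, 'k::comm_ring_1) mp ring" where
  "coord_ring n \<equiv> mpoly_ring {..n}"

definition eval_vec :: "'k::comm_ring_1 vec \<Rightarrow> (nat, 'k) mp \<Rightarrow> 'k" where
  "eval_vec v p = mp_eval (\<lambda>c. c) (\<lambda>i. v $ i) p"

definition vanishing_ideal :: "nat \<Rightarrow> 'k::field vec set set \<Rightarrow> (nat, 'k) mp set" where
  "vanishing_ideal n Z =
     genideal (coord_ring n)
       {f \<in> carrier (coord_ring n). (\<exists>d. homogeneous d f) \<and> (\<forall>L\<in>Z. \<forall>v\<in>L. eval_vec v f = 0)}"

definition lin_form :: "nat \<Rightarrow> 'k::comm_ring_1 vec \<Rightarrow> (nat, 'k) mp" where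
  "lin_form n v = (\<Sum>i\<le>n. mp_const (v $ i) * mp_var i)"

definition hyperplane :: "nat \<Rightarrow> 'k::field vec \<Rightarrow> 'k vec set set" where
  "hyperplane n v = {L \<in> proj_space n. \<forall>w\<in>L. eval_vec w (lin_form n v) = 0}"

definition dual_arrangement :: "nat \<Rightarrow> 'k::field vec set set \<Rightarrow> 'k vec set set set" where
  "dual_arrangement n Z =
     {hyperplane n v | v. v \<in> carrier_vec (Suc n) \<and> v \<noteq> 0\<^sub>v (Suc n) \<and> line_through v \<in> Z}"


section \<open>Logarithmic derivations\<close>

text \<open>Maps \<open>S \<rightarrow> S\<close> are taken extensional, so that equality of maps is equality on \<open>S\<close>.\<close>

definition derivations :: "nat \<Rightarrow> ((nat, 'k::field) mp \<Rightarrow> (nat, 'k) mp) set" where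
  "derivations n =
     {\<theta> \<in> carrier (coord_ring n) \<rightarrow>\<^sub>E carrier (coord_ring n).
        (\<forall>p\<in>carrier (coord_ring n). \<forall>q\<in>carrier (coord_ring n). \<theta> (p + q) = \<theta> p + \<theta> q) \<and>
        (\<forall>c. \<forall>p\<in>carrier (coord_ring n). \<theta> (mp_const c * p) = mp_const c * \<theta> p) \<and>
        (\<forall>p\<in>carrier (coord_ring n). \<forall>q\<in>carrier (coord_ring n). \<theta> (p * q) = \<theta> p * q + p * \<theta> q)}"

text \<open>\<open>D(\<A>)\<close>, for an arrangement given as a set of hyperplanes of \<open>\<P>(W)\<close>.\<close>

definition log_derivations ::
  "nat \<Rightarrow> 'k::field vec set set set \<Rightarrow>
     ((nat, 'k) mp, (nat, 'k) mp \<Rightarrow> (nat, 'k) mp) module" where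
  "log_derivations n \<A> =
     \<lparr>carrier = {\<theta> \<in> derivations n. \<forall>H\<in>\<A>. \<theta> ` vanishing_ideal n H \<subseteq> vanishing_ideal n H},
      monoid.mult = undefined, one = undefined,
      ring.zero = (\<lambda>p\<in>carrier (coord_ring n). 0),
      ring.add = (\<lambda>\<theta> \<theta>'. \<lambda>p\<in>carrier (coord_ring n). \<theta> p + \<theta>' p),
      module.smult = (\<lambda>g \<theta>. \<lambda>p\<in>carrier (coord_ring n). g * \<theta> p)\<rparr>"

definition log_derivations_grading ::
  "nat \<Rightarrow> 'k::field vec set set set \<Rightarrow> int \<Rightarrow> ((nat, 'k) mp \<Rightarrow> (nat, 'k) mp) set" where
  "log_derivations_grading n \<A> d =
     {\<theta> \<in> carrier (log_derivations n \<A>).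
        \<forall>v\<in>carrier_vec (Suc n). homogeneous d (\<theta> (lin_form n v))}"

text \<open>
  An element \<open>\<lambda> = \<Sum>\<^sub>i f\<^sub>i \<otimes> W\<^sub>i\<close> of \<open>S \<otimes> W\<close> is represented by its coordinate family
  \<open>f \<in> {..n} \<rightarrow>\<^sub>E S\<close>.
\<close>

definition theta :: "nat \<Rightarrow> (nat \<Rightarrow> (nat, 'k::field) mp) \<Rightarrow> (nat, 'k) mp \<Rightarrow> (nat, 'k) mp" where
  "theta n f = (\<lambda>p\<in>carrier (coord_ring n). \<Sum>i\<le>n. f i * mp_pderiv i p)"

definition euler :: "nat \<Rightarrow> (nat, 'k::field) mp \<Rightarrow> (nat, 'k) mp" where
  "euler n = theta n mp_var"

definition euler_submodule ::
  "nat \<Rightarrow> 'k::field vec set set set \<Rightarrow> ((nat, 'k) mp \<Rightarrow> (nat, 'k) mp) set" where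
  "euler_submodule n \<A> =
     {g \<odot>\<^bsub>log_derivations n \<A>\<^esub> euler n | g. g \<in> carrier (coord_ring n)}"

definition D0 ::
  "nat \<Rightarrow> 'k::field vec set set set \<Rightarrow>
     ((nat, 'k) mp, ((nat, 'k) mp \<Rightarrow> (nat, 'k) mp) set) module" where
  "D0 n \<A> = quot_module (log_derivations n \<A>) (euler_submodule n \<A>)"

definition D0_grading ::
  "nat \<Rightarrow> 'k::field vec set set set \<Rightarrow> int \<Rightarrow> ((nat, 'k) mp \<Rightarrow> (nat, 'k) mp) set set" where
  "D0_grading n \<A> =
     quot_grading (log_derivations n \<A>) (euler_submodule n \<A>) (log_derivations_grading n \<A>)"

definition D0_class ::
  "nat \<Rightarrow> 'k::field vec set set set \<Rightarrow> ((nat, 'k) mp \<Rightarrow> (nat, 'k) mp) \<Rightarrow>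
     ((nat, 'k) mp \<Rightarrow> (nat, 'k) mp) set" where
  "D0_class n \<A> \<theta> = euler_submodule n \<A> +>\<^bsub>log_derivations n \<A>\<^esub> \<theta>"


section \<open>The ring \<open>K[A]\<close> and the module \<open>I\<^sup>\<ggreater>(Z)\<close>\<close>

datatype xavar = XV nat | AV nat nat

definition KA :: "nat \<Rightarrow> (xavar, 'k::field) mp ring" where
  "KA n = mpoly_ring (XV ` {..n} \<union> {AV i j | i j. 1 \<le> i \<and> i \<le> n - 1 \<and> j \<le> n})"

definition embR :: "(nat, 'k::field) mp \<Rightarrow> (xavar, 'k) mp" where
  "embR = mp_eval mp_const (\<lambda>i. mp_var (XV i))"

text \<open>Row \<open>r \<ge> 2\<close> (counting from 0) is \<open>(A\<^bsub>r-1,0\<^esub>, \<dots>, A\<^bsub>r-1,n\<^esub>)\<close>; for \<open>n = 1\<close> there is none.\<close>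

definition minor_M :: "nat \<Rightarrow> nat \<Rightarrow> (xavar, 'k::field) mp" where
  "minor_M n i = Determinant.det (Matrix.mat (Suc n) (Suc n) (\<lambda>(r, c).
     if r = 0 then (if c = i then 1 else 0)
     else if r = 1 then mp_var (XV c)
     else mp_var (AV (r - 1) c)))"

definition PL :: "nat \<Rightarrow> (xavar, 'k::field) mp ring" where
  "PL n = (KA n)\<lparr>carrier := generate_ring (KA n) (range mp_const \<union> minor_M n ` {..n})\<rparr>"

definition tau :: "nat \<Rightarrow> (nat, 'k::field) mp \<Rightarrow> (xavar, 'k) mp" where
  "tau n = mp_eval mp_const (minor_M n)"

definition PL_grading :: "nat \<Rightarrow> int \<Rightarrow> (xavar, 'k::field) mp set" where
  "PL_grading n d = k_span {\<Prod>j\<le>n. minor_M n j ^ e j | e. int (\<Sum>j\<le>n. e j) = d}"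

definition F_poly :: "nat \<Rightarrow> (nat \<Rightarrow> (nat, 'k::field) mp) \<Rightarrow> (xavar, 'k) mp" where
  "F_poly n f = (\<Sum>i\<le>n. mp_var (XV i) * tau n (f i))"

definition m_gg :: "nat \<Rightarrow> (xavar, 'k::field) mp set" where
  "m_gg n = {\<Sum>i\<le>n. p i * mp_var (XV i) | p. \<forall>i\<le>n. p i \<in> carrier (PL n)}"

definition m_gg_grading :: "nat \<Rightarrow> int \<Rightarrow> (xavar, 'k::field) mp set" where
  "m_gg_grading n d =
     k_span {mp_var (XV i) * (\<Prod>j\<le>n. minor_M n j ^ e j) | i e. i \<le> n \<and> int (\<Sum>j\<le>n. e j) = d - 1}"

definition ext_ideal :: "nat \<Rightarrow> (nat, 'k::field) mp set \<Rightarrow> (xavar, 'k) mp set" where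
  "ext_ideal n J = genideal (KA n) (embR ` J)"

text \<open>\<open>J\<^sup>\<ggreater>\<close> as a \<open>PL(n)\<close>-submodule of \<open>K[A]\<close>.\<close>

definition gg :: "nat \<Rightarrow> (nat, 'k::field) mp set \<Rightarrow> ((xavar, 'k) mp, (xavar, 'k) mp) module" where
  "gg n J =
     \<lparr>carrier = ext_ideal n J \<inter> m_gg n,
      monoid.mult = undefined, one = undefined,
      ring.zero = 0, ring.add = (+), module.smult = (*)\<rparr>"

definition gg_grading :: "nat \<Rightarrow> (nat, 'k::field) mp set \<Rightarrow> int \<Rightarrow> (xavar, 'k) mp set" where
  "gg_grading n J d = ext_ideal n J \<inter> m_gg_grading n d"

end

theory Submission
  imports Defs "HOL-Library.Infinite_Typeclass"
begin

text \<open>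
  Over an infinite field polynomials are functions, and everything is checked at points. For
  \<open>v \<in> K\<^sup>n\<^sup>+\<^sup>1\<close> the vector of minors \<open>M(v, a)\<close> is orthogonal to \<open>v\<close>, and up to rescaling \<open>v\<close> every nonzero
  \<open>w\<close> orthogonal to \<open>v \<noteq> 0\<close> arises as \<open>M(v, a)\<close>. So \<open>F\<^sub>\<lambda>(v, a) = \<Sum> v\<^sub>i f\<^sub>i(M(v, a))\<close> vanishes for all \<open>a\<close> and
  all \<open>v\<close> over \<open>Z\<close> iff \<open>\<Sum> v\<^sub>i f\<^sub>i\<close> vanishes on the hyperplane dual to each \<open>[v] \<in> Z\<close>, that is, iff
  \<open>\<theta>\<^sub>\<lambda>\<close> is tangent to the dual arrangement. If \<open>F\<^sub>\<lambda> = 0\<close>, then \<open>(f\<^sub>i(w))\<close> is proportional to \<open>w\<close> for all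
  \<open>w\<close>, which forces \<open>f\<^sub>i = g Y\<^sub>i\<close>. Since \<open>\<tau>\<close> maps \<open>S\<close> onto \<open>PL(n)\<close>, every tensor is of the form \<open>1 \<otimes> x\<close>,
  and the isomorphism follows from the exactness of \<open>S \<theta>\<^sub>e \<rightarrow> D(\<A>\<^sub>Z) \<rightarrow> I\<^sup>\<ggreater>(Z) \<rightarrow> 0\<close>.
\<close>

\<comment> \<open>The minors do not reach every orthogonal vector for a fixed \<open>v\<close>. For
  \<open>n = 1\<close> there are no variables \<open>AV i j\<close> and
  \<open>M(v) = (v_1, -v_0)\<close>, so a given multiple of \<open>w\<close> is obtained only by
  rescaling \<open>v\<close>, and \<open>w = 0\<close> is never reached from a nonzero
  \<open>v\<close>. Hence the factor \<open>t\<close> in the surjectivity statement and a separate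
  argument at \<open>w = 0\<close>, where the value is recovered from the other points of a line
  through the origin.

  Tangency, too, is tested on lines. If the direction \<open>(f_i(w))\<close> lies in a hyperplane
  through \<open>w\<close>, a polynomial vanishing on that hyperplane vanishes on the whole line, so
  its formal derivative there is zero. This holds in every characteristic.

  Quotient and tensor product are sets of cosets. In both cases the subgroup divided out is the
  kernel of an additive map into \<open>K[A]\<close>, so cosets are fibres and every question
  becomes one about values of that map. The grading is established on \<open>I^gg(Z)\<close>, where
  it is visible by scaling: the minors are linear in \<open>v\<close>, so replacing \<open>v\<close>
  by \<open>tv\<close> multiplies an element of degree \<open>d\<close> by \<open>t^d\<close>. The
  bijection carries it back to the base change.\<close>
alias keys = Poly_Mapping.keys
alias lookup = Poly_Mapping.lookup

section \<open>Polynomials and evaluation\<close>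

lemma mp_sum_singles: "p = (\<Sum>m\<in>keys p. Poly_Mapping.single m (lookup p m))"
proof (rule poly_mapping_eqI)
  fix k
  show "lookup p k = lookup (\<Sum>m\<in>keys p. Poly_Mapping.single m (lookup p m)) k"
    by (cases "k \<in> keys p")
      (auto simp: lookup_sum lookup_single when_def in_keys_iff)
qed

lemma mp_induct [case_names zero single add]:
  assumes "P 0" "\<And>m c. P (Poly_Mapping.single m c)" "\<And>p q. P p \<Longrightarrow> P q \<Longrightarrow> P (p + q)"
  shows "P (p :: 'a \<Rightarrow>\<^sub>0 'b::comm_monoid_add)"
proof -
  have "P (\<Sum>m\<in>A. Poly_Mapping.single m (lookup p m))" if "finite A" for A
    using that by induction (auto intro: assms)
  from this[of "keys p"] show ?thesis by (simp flip: mp_sum_singles)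
qed

definition monom_val :: "('v \<Rightarrow> 'b::comm_monoid_mult) \<Rightarrow> ('v \<Rightarrow>\<^sub>0 nat) \<Rightarrow> 'b" where
  "monom_val \<rho> m = (\<Prod>v\<in>keys m. \<rho> v ^ lookup m v)"

text \<open>Exponents outside the support are zero, so monomials with different supports can be
  compared factor by factor over a common index set.\<close>

lemma monom_val_superset:
  assumes "finite A" "keys m \<subseteq> A"
  shows "monom_val \<rho> m = (\<Prod>v\<in>A. \<rho> v ^ lookup m v)"
  unfolding monom_val_def using assms
  by (intro prod.mono_neutral_left) (auto simp: in_keys_iff)

lemma monom_val_0 [simp]: "monom_val \<rho> 0 = 1"
  by (simp add: monom_val_def)

lemma monom_val_add: "monom_val \<rho> (m + m') = monom_val \<rho> m * monom_val \<rho> m'"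
proof -
  let ?A = "keys m \<union> keys m'"
  have "keys (m + m') \<subseteq> ?A" by (rule keys_add)
  then show ?thesis
    by (simp add: monom_val_superset[of ?A] lookup_add power_add prod.distrib)
qed

lemma monom_val_single [simp]: "monom_val \<rho> (Poly_Mapping.single v k) = \<rho> v ^ k"
  by (subst monom_val_superset[of "{v}"]) (auto simp: lookup_single)

lemma mp_eval_eq: "mp_eval h \<rho> p = (\<Sum>m\<in>keys p. h (lookup p m) * monom_val \<rho> m)"
  by (simp add: mp_eval_def monom_val_def)

lemma mp_eval_superset:
  assumes "finite A" "keys p \<subseteq> A" "h 0 = 0"
  shows "mp_eval h \<rho> p = (\<Sum>m\<in>A. h (lookup p m) * monom_val \<rho> m)"
  unfolding mp_eval_eq using assms
  by (intro sum.mono_neutral_left) (auto simp: in_keys_iff)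

context comm_ring_hom
begin

lemma mp_eval_single: "mp_eval hom \<rho> (Poly_Mapping.single m c) = hom c * monom_val \<rho> m"
  by (subst mp_eval_superset[of "{m}"]) auto

lemma mp_eval_add: "mp_eval hom \<rho> (p + q) = mp_eval hom \<rho> p + mp_eval hom \<rho> q"
proof -
  let ?A = "keys p \<union> keys q"
  have "keys (p + q) \<subseteq> ?A" by (rule keys_add)
  then show ?thesis
    by (simp add: mp_eval_superset[of ?A] lookup_add hom_add algebra_simps sum.distrib)
qed

lemma mp_eval_0: "mp_eval hom \<rho> 0 = 0"
  by (simp add: mp_eval_eq)

lemma mp_eval_mult: "mp_eval hom \<rho> (p * q) = mp_eval hom \<rho> p * mp_eval hom \<rho> q"
proof (induction p rule: mp_induct)
  case (single m c)
  show ?case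
    by (induction q rule: mp_induct)
      (simp_all add: mp_eval_0 mp_eval_single mult_single monom_val_add hom_mult mp_eval_add
        algebra_simps)
qed (simp_all add: mp_eval_0 mp_eval_add algebra_simps)

lemma mp_eval_const: "mp_eval hom \<rho> (mp_const c) = hom c"
  by (simp add: mp_const_def mp_eval_single)

lemma mp_eval_var: "mp_eval hom \<rho> (mp_var v) = \<rho> v"
  by (simp add: mp_var_def mp_eval_single)

lemma mp_eval_comm_ring_hom: "comm_ring_hom (mp_eval hom \<rho>)"
proof
  show "mp_eval hom \<rho> 1 = 1"
    using mp_eval_single[of \<rho> 0 1] by simp
qed (simp_all add: mp_eval_0 mp_eval_add mp_eval_mult)

end

lemma comm_ring_hom_id: "comm_ring_hom (\<lambda>c. c)"
  by unfold_locales auto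

lemma mp_const_add: "mp_const (a + b) = mp_const a + mp_const b"
  by (simp add: mp_const_def single_add)

lemma mp_const_mult: "mp_const (a * b) = mp_const a * mp_const b"
  by (simp add: mp_const_def mult_single)

lemma mp_const_0 [simp]: "mp_const 0 = 0" by (simp add: mp_const_def)
lemma mp_const_1 [simp]: "mp_const 1 = 1" by (simp add: mp_const_def)

interpretation mp_const: comm_ring_hom mp_const
  by unfold_locales (simp_all add: mp_const_add mp_const_mult)

interpretation ev: comm_ring_hom "mp_eval (\<lambda>c::'a::comm_ring_1. c) \<rho>" for \<rho>
  by (rule comm_ring_hom.mp_eval_comm_ring_hom[OF comm_ring_hom_id])

interpretation subst: comm_ring_hom "mp_eval mp_const \<rho>" for \<rho>
  by (rule mp_const.mp_eval_comm_ring_hom)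

text \<open>The bridge from finitely supported maps to generators: it makes the induction over
  constants and variables possible.\<close>

lemma single_eq_prod_vars:
  fixes c :: "'k::comm_ring_1"
  shows   "Poly_Mapping.single m c = mp_const c * (\<Prod>v\<in>keys m. mp_var v ^ lookup m v)"
proof -
  have pow: "mp_var v ^ k = Poly_Mapping.single (Poly_Mapping.single v k) (1 :: 'k)" for v :: 'a and k
    by (induction k) (auto simp: mp_var_def mult_single simp flip: single_add)
  have "(\<Prod>v\<in>A. mp_var v ^ lookup m v) =
     Poly_Mapping.single (\<Sum>v\<in>A. Poly_Mapping.single v (lookup m v)) (1 :: 'k)" if "finite A" for A
    using that by induction (auto simp: pow mult_single)
  then show ?thesis
    by (simp add: mp_const_def mult_single flip: mp_sum_singles)
qed

section \<open>The ring of polynomials in a prescribed set of variables\<close>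

lemma mpoly_ring_simps [simp]:
  "ring.zero (mpoly_ring V) = 0" "ring.add (mpoly_ring V) = (+)"
  "monoid.mult (mpoly_ring V) = (*)" "monoid.one (mpoly_ring V) = 1"
  by (simp_all add: mpoly_ring_def)

lemma mpoly_carrier_iff:
  "p \<in> carrier (mpoly_ring V) \<longleftrightarrow> (\<forall>m\<in>keys p. keys m \<subseteq> V)"
  by (simp add: mpoly_ring_def)

lemma mpoly_carrier_UNIV: "carrier (mpoly_ring UNIV) = UNIV"
  by (auto simp: mpoly_carrier_iff)

lemma mpoly_carrier_single: "keys m \<subseteq> V \<Longrightarrow> Poly_Mapping.single m c \<in> carrier (mpoly_ring V)"
  by (auto simp: mpoly_carrier_iff)

lemma mpoly_carrier_add [intro]:
  "p \<in> carrier (mpoly_ring V) \<Longrightarrow> q \<in> carrier (mpoly_ring V) \<Longrightarrow> p + q \<in> carrier (mpoly_ring V)"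
  using keys_add[of p q] by (fastforce simp: mpoly_carrier_iff)

lemma mpoly_carrier_uminus [intro]:
  "p \<in> carrier (mpoly_ring V) \<Longrightarrow> - p \<in> carrier (mpoly_ring V)"
  by (auto simp: mpoly_carrier_iff in_keys_iff)

lemma mpoly_carrier_mult [intro]:
  assumes "p \<in> carrier (mpoly_ring V)" "q \<in> carrier (mpoly_ring V)"
  shows "p * q \<in> carrier (mpoly_ring V)"
  unfolding mpoly_carrier_iff
proof
  fix m assume "m \<in> keys (p * q)"
  then obtain a b where "m = a + b" "a \<in> keys p" "b \<in> keys q"
    using keys_mult[of p q] by blast
  then show "keys m \<subseteq> V"
    using keys_add[of a b] assms by (force simp: mpoly_carrier_iff)
qed

lemma mpoly_carrier_0 [intro, simp]: "0 \<in> carrier (mpoly_ring V)"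
  by (auto simp: mpoly_carrier_iff)

lemma mpoly_carrier_const [intro, simp]: "mp_const c \<in> carrier (mpoly_ring V)"
  by (auto simp: mp_const_def intro: mpoly_carrier_single)

lemma mpoly_carrier_1 [intro, simp]: "1 \<in> carrier (mpoly_ring V)"
  using mpoly_carrier_const[of 1] by simp

lemma mpoly_carrier_var [intro]: "v \<in> V \<Longrightarrow> mp_var v \<in> carrier (mpoly_ring V)"
  by (auto simp: mp_var_def intro: mpoly_carrier_single)

lemma mpoly_carrier_sum [intro]:
  "(\<And>i. i \<in> I \<Longrightarrow> f i \<in> carrier (mpoly_ring V)) \<Longrightarrow> sum f I \<in> carrier (mpoly_ring V)"
  by (induction I rule: infinite_finite_induct) auto

lemma mpoly_carrier_prod [intro]:
  "(\<And>i. i \<in> I \<Longrightarrow> f i \<in> carrier (mpoly_ring V)) \<Longrightarrow> prod f I \<in> carrier (mpoly_ring V)"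
  by (induction I rule: infinite_finite_induct) auto

lemma mpoly_carrier_power [intro]:
  "f \<in> carrier (mpoly_ring V) \<Longrightarrow> f ^ k \<in> carrier (mpoly_ring V)"
  by (induction k) auto

lemma cring_mpoly_ring: "cring (mpoly_ring V)"
proof (rule cringI)
  show "abelian_group (mpoly_ring V)"
  proof (rule abelian_groupI)
    fix x assume "x \<in> carrier (mpoly_ring V)"
    then show "\<exists>y\<in>carrier (mpoly_ring V). y \<oplus>\<^bsub>mpoly_ring V\<^esub> x = \<zero>\<^bsub>mpoly_ring V\<^esub>"
      by (intro bexI[of _ "-x"]) auto
  qed (auto simp: algebra_simps)
  show "Group.comm_monoid (mpoly_ring V)"
    by (rule comm_monoidI) (auto simp: algebra_simps)
qed (auto simp: algebra_simps)

lemma a_inv_mpoly_ring: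
  assumes "p \<in> carrier (mpoly_ring V)" shows "\<ominus>\<^bsub>mpoly_ring V\<^esub> p = - p"
proof -
  interpret cring "mpoly_ring V" by (rule cring_mpoly_ring)
  show ?thesis using assms by (intro minus_equality) auto
qed

text \<open>Constants and variables generate the ring, so evaluations and derivations need only be
  compared there. The carrier premises in the last two cases are kept because a derivation obeys its
  rules only on the carrier.\<close>

lemma mpoly_ring_induct [consumes 1, case_names const var add mult]:
  assumes "p \<in> carrier (mpoly_ring V)"
    and const: "\<And>c. P (mp_const c)"
    and var: "\<And>v. v \<in> V \<Longrightarrow> P (mp_var v)"
    and add: "\<And>p q. p \<in> carrier (mpoly_ring V) \<Longrightarrow> q \<in> carrier (mpoly_ring V) \<Longrightarrow> P p \<Longrightarrow> P q \<Longrightarrow> P (p + q)"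
    and mult: "\<And>p q. p \<in> carrier (mpoly_ring V) \<Longrightarrow> q \<in> carrier (mpoly_ring V) \<Longrightarrow> P p \<Longrightarrow> P q \<Longrightarrow> P (p * q)"
  shows "P p"
proof -
  have 1: "P 1" using const[of 1] by simp
  have pow: "P (mp_var v ^ k)" if "v \<in> V" for v k
    by (induction k) (use that in \<open>auto intro: 1 mult var\<close>)
  have pr: "P (\<Prod>v\<in>A. mp_var v ^ lookup m v)" if "finite A" "A \<subseteq> V" for A m
    using that by induction (auto intro!: 1 mult pow)
  have "P (\<Sum>m\<in>A. Poly_Mapping.single m (lookup p m))" if "finite A" "A \<subseteq> keys p" for A
    using that
  proof induction
    case empty
    then show ?case using const[of 0] by simp
  next
    case (insert m A)
    have m: "keys m \<subseteq> V" using assms(1) insert by (auto simp: mpoly_carrier_iff)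
    have "P (Poly_Mapping.single m (lookup p m))"
      unfolding single_eq_prod_vars
      by (intro mult const pr) (use m in auto)
    moreover have "Poly_Mapping.single m' (lookup p m') \<in> carrier (mpoly_ring V)" if "m' \<in> keys p" for m'
      using that assms(1) by (intro mpoly_carrier_single) (auto simp: mpoly_carrier_iff)
    ultimately show ?case using insert
      by (simp, intro add) auto
  qed
  from this[of "keys p"] show ?thesis by (simp flip: mp_sum_singles)
qed

text \<open>Composition of a substitution with an evaluation; it computes the values of
  \<open>embR f\<close> and \<open>tau n s\<close> at points of \<open>K[A]\<close>.\<close>

lemma mp_eval_mp_eval:
  assumes "comm_ring_hom h"
  shows "mp_eval h \<sigma> (mp_eval mp_const \<rho> p) = mp_eval h (\<lambda>v. mp_eval h \<sigma> (\<rho> v)) p"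
proof -
  interpret comm_ring_hom h by fact
  have "p \<in> carrier (mpoly_ring UNIV)" by (simp add: mpoly_carrier_UNIV)
  then show ?thesis
    by (induction rule: mpoly_ring_induct)
     (simp_all add: mp_eval_const mp_eval_var mp_eval_add mp_eval_mult
       mp_const.mp_eval_const mp_const.mp_eval_var subst.hom_add subst.hom_mult)
qed

lemma mp_eval_cong:
  assumes "p \<in> carrier (mpoly_ring V)" "\<And>v. v \<in> V \<Longrightarrow> \<rho> v = \<rho>' v"
  shows "mp_eval h \<rho> p = mp_eval h \<rho>' p"
proof -
  have "\<rho> v = \<rho>' v" if "m \<in> keys p" "v \<in> keys m" for m v
    using that assms by (force simp: mpoly_carrier_iff)
  then show ?thesis
    unfolding mp_eval_def by (intro sum.cong prod.cong arg_cong2[of _ _ _ _ "(*)"]) auto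
qed

lemma mp_eval_carrier:
  assumes "p \<in> carrier (mpoly_ring V)" "\<And>v. v \<in> V \<Longrightarrow> \<rho> v \<in> carrier (mpoly_ring U)"
  shows "mp_eval mp_const \<rho> p \<in> carrier (mpoly_ring U)"
  using assms(1)
  by (induction rule: mpoly_ring_induct)
    (auto simp: mp_const.mp_eval_const mp_const.mp_eval_var subst.hom_add subst.hom_mult assms(2))

subsection \<open>Partial derivatives\<close>

lemma mp_pderiv_superset:
  assumes "finite A" "keys p \<subseteq> A"
  shows "mp_pderiv v p = (\<Sum>m\<in>A. Poly_Mapping.single (m - Poly_Mapping.single v 1)
          (of_nat (lookup m v) * lookup p m))"
  unfolding mp_pderiv_def using assms
  by (intro sum.mono_neutral_left) (auto simp: in_keys_iff)

lemma mp_pderiv_single: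
  "mp_pderiv v (Poly_Mapping.single m c) =
     Poly_Mapping.single (m - Poly_Mapping.single v 1) (of_nat (lookup m v) * c)"
  by (subst mp_pderiv_superset[of "{m}"]) auto

lemma mp_pderiv_add: "mp_pderiv v (p + q) = mp_pderiv v p + mp_pderiv v q"
proof -
  let ?A = "keys p \<union> keys q"
  have "keys (p + q) \<subseteq> ?A" by (rule keys_add)
  then show ?thesis
    by (simp add: mp_pderiv_superset[of ?A] lookup_add algebra_simps sum.distrib single_add)
qed

lemma mp_pderiv_0 [simp]: "mp_pderiv v 0 = 0"
  by (simp add: mp_pderiv_def)

lemma mp_pderiv_mult: "mp_pderiv v (p * q) = mp_pderiv v p * q + p * mp_pderiv v q"
proof (induction p rule: mp_induct)
  case (single m c)
  show ?case
  proof (induction q rule: mp_induct)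
    case (single m' c')
    let ?e = "Poly_Mapping.single v (Suc 0)"
    \<comment> \<open>Subtraction of exponents is truncated, so the shift needs a positive exponent
      of \<open>v\<close>. Where the exponent is zero, the coefficient
      \<open>of_nat (lookup m v)\<close> vanishes instead.\<close>
    have *: "m + m' - ?e = (m - ?e) + m'" if "lookup m v > 0" for m m' :: "'a \<Rightarrow>\<^sub>0 nat"
      using that by (intro poly_mapping_eqI) (auto simp: lookup_add lookup_minus lookup_single when_def)
    have "Poly_Mapping.single (m + m' - ?e) (of_nat (lookup m v) * c * c') =
      Poly_Mapping.single (m - ?e + m') (of_nat (lookup m v) * c * c')"
      by (cases "lookup m v = 0") (auto simp: *)
    moreover have "Poly_Mapping.single (m + m' - ?e) (of_nat (lookup m' v) * c * c') =
      Poly_Mapping.single (m + (m' - ?e)) (of_nat (lookup m' v) * c * c')"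
      by (cases "lookup m' v = 0") (auto simp: * add.commute[of m])
    ultimately show ?case
      by (simp add: mult_single mp_pderiv_single lookup_add algebra_simps single_add)
  qed (simp_all add: mp_pderiv_add algebra_simps)
qed (simp_all add: mp_pderiv_add algebra_simps)

lemma mp_pderiv_const [simp]: "mp_pderiv v (mp_const c) = 0"
  by (simp add: mp_const_def mp_pderiv_single)

lemma mp_pderiv_var: "mp_pderiv v (mp_var w) = (if v = w then 1 else 0)"
  by (auto simp: mp_var_def mp_pderiv_single lookup_single)

lemma mp_pderiv_carrier [intro]:
  assumes "p \<in> carrier (mpoly_ring V)" shows "mp_pderiv v p \<in> carrier (mpoly_ring V)"
  using assms
  by (induction rule: mpoly_ring_induct) (auto simp: mp_pderiv_var mp_pderiv_add mp_pderiv_mult)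

section \<open>Polynomials as functions over an infinite field\<close>

abbreviation mp_at :: "('v \<Rightarrow> 'k::comm_ring_1) \<Rightarrow> ('v, 'k) mp \<Rightarrow> 'k" where
  "mp_at \<rho> p \<equiv> mp_eval (\<lambda>c. c) \<rho> p"

lemmas mp_at_single = comm_ring_hom.mp_eval_single[OF comm_ring_hom_id]
lemmas mp_at_const = comm_ring_hom.mp_eval_const[OF comm_ring_hom_id]
lemmas mp_at_var = comm_ring_hom.mp_eval_var[OF comm_ring_hom_id]

text \<open>One device for three decompositions: into homogeneous components, down to a single
  coefficient, and by the exponents of the variables \<open>AV i j\<close>.\<close>

definition mp_filter :: "(('v \<Rightarrow>\<^sub>0 nat) \<Rightarrow> bool) \<Rightarrow> ('v, 'k::comm_ring_1) mp \<Rightarrow> ('v, 'k) mp" where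
  "mp_filter Q p = (\<Sum>m | m \<in> keys p \<and> Q m. Poly_Mapping.single m (lookup p m))"

lemma lookup_mp_filter: "lookup (mp_filter Q p) m = (if Q m then lookup p m else 0)"
  by (cases "m \<in> keys p")
    (auto simp: mp_filter_def lookup_sum lookup_single when_def in_keys_iff)

lemma keys_mp_filter: "keys (mp_filter Q p) = {m \<in> keys p. Q m}"
  by (auto simp: in_keys_iff lookup_mp_filter split: if_splits)

lemma mp_filter_carrier: "p \<in> carrier (mpoly_ring V) \<Longrightarrow> mp_filter Q p \<in> carrier (mpoly_ring V)"
  by (auto simp: mpoly_carrier_iff keys_mp_filter)

lemma mp_filter_mp_filter: "mp_filter P (mp_filter Q p) = mp_filter (\<lambda>m. P m \<and> Q m) p"
  by (rule poly_mapping_eqI) (auto simp: lookup_mp_filter)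

lemma mp_filter_cong: "(\<And>m. m \<in> keys p \<Longrightarrow> Q m \<longleftrightarrow> Q' m) \<Longrightarrow> mp_filter Q p = mp_filter Q' p"
  by (rule poly_mapping_eqI) (auto simp: lookup_mp_filter in_keys_iff)

lemma mp_filter_True: "mp_filter (\<lambda>_. True) p = p"
  by (rule poly_mapping_eqI) (auto simp: lookup_mp_filter)

lemma sum_mp_filter_fibres:
  assumes "finite B" "f ` keys p \<subseteq> B"
  shows "(\<Sum>c\<in>B. mp_filter (\<lambda>m. f m = c) p) = p"
proof (rule poly_mapping_eqI)
  fix m
  show "lookup (\<Sum>c\<in>B. mp_filter (\<lambda>m. f m = c) p) m = lookup p m"
    using assms by (cases "m \<in> keys p") (auto simp: lookup_sum lookup_mp_filter in_keys_iff)
qed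

text \<open>The power of \<open>t\<close> that a monomial picks up when only the variables in
  \<open>U\<close> are scaled by \<open>t\<close>. \<open>U = UNIV\<close> gives the total degree, a
  singleton the exponent of one variable.\<close>

definition wdeg :: "'v set \<Rightarrow> ('v \<Rightarrow>\<^sub>0 nat) \<Rightarrow> nat" where
  "wdeg U m = (\<Sum>v\<in>keys m \<inter> U. lookup m v)"

definition scale_on :: "'v set \<Rightarrow> 'k::comm_ring_1 \<Rightarrow> ('v \<Rightarrow> 'k) \<Rightarrow> 'v \<Rightarrow> 'k" where
  "scale_on U t \<rho> = (\<lambda>v. if v \<in> U then t * \<rho> v else \<rho> v)"

lemma wdeg_singleton: "wdeg {v} m = lookup m v"
  by (cases "v \<in> keys m") (auto simp: wdeg_def in_keys_iff)

lemma homogeneous_iff: "homogeneous d p \<longleftrightarrow> (\<forall>m\<in>keys p. int (wdeg UNIV m) = d)"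
  by (simp add: homogeneous_def wdeg_def)

lemma monom_val_scale_on: "monom_val (scale_on U t \<rho>) m = t ^ wdeg U m * monom_val \<rho> m"
proof -
  have "monom_val (scale_on U t \<rho>) m = (\<Prod>v\<in>keys m. (if v \<in> U then t ^ lookup m v else 1) * \<rho> v ^ lookup m v)"
    unfolding monom_val_def scale_on_def by (intro prod.cong) (auto simp: power_mult_distrib)
  also have "\<dots> = (\<Prod>v\<in>keys m \<inter> U. t ^ lookup m v) * monom_val \<rho> m"
    by (simp add: prod.distrib monom_val_def prod.inter_restrict)
  finally show ?thesis by (simp add: wdeg_def power_sum)
qed

text \<open>Over a finite field the product of all \<open>X - a\<close>, increased by 1, would be a
  nonconstant polynomial without a root.\<close>

instance alg_closed_field \<subseteq> infinite
proof
  show "infinite (UNIV :: 'a set)"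
  proof
    assume fin: "finite (UNIV :: 'a set)"
    define q where "q = (\<Prod>a\<in>(UNIV :: 'a set). [:- a, 1:])"
    have "degree q = card (UNIV :: 'a set)"
      unfolding q_def by (subst degree_prod_eq_sum_degree) auto
    then have "degree q > 0" using fin by (simp add: card_gt_0_iff)
    then have "degree (q + 1) > 0" by (simp add: degree_add_eq_left)
    then obtain x where "poly (q + 1) x = 0" using alg_closed_imp_poly_has_root by blast
    moreover have "poly q x = 0"
      unfolding q_def poly_prod using fin by (intro prod_zero) auto
    ultimately show False by simp
  qed
qed

lemma poly_all_zero:
  assumes "\<And>t. poly p t = 0"
  shows "p = (0 :: 'k::{field,infinite} poly)"
proof (rule ccontr)
  assume "p \<noteq> 0"
  then have "finite {t. poly p t = 0}" by (rule poly_roots_finite)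
  then show False using assms infinite_UNIV[where 'a = 'k] by simp
qed

text \<open>Under scaling by \<open>t\<close> the value becomes a polynomial in \<open>t\<close>
  whose coefficient at \<open>t^d\<close> is the value of the component of weight \<open>d\<close>;
  a polynomial with infinitely many zeros has only zero coefficients.\<close>

lemma mp_at_wdeg_component_zero:
  fixes p :: "('v, 'k::{field,infinite}) mp"
  assumes "\<And>t. mp_at (scale_on U t \<rho>) p = 0"
  shows "mp_at \<rho> (mp_filter (\<lambda>m. wdeg U m = d) p) = 0"
proof -
  let ?c = "\<lambda>m. lookup p m * monom_val \<rho> m"
  let ?q = "\<Sum>m\<in>keys p. Polynomial.monom (?c m) (wdeg U m)"
  have "poly ?q t = mp_at (scale_on U t \<rho>) p" for t
    by (simp add: poly_sum poly_monom mp_eval_eq monom_val_scale_on algebra_simps)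
  then have "?q = 0" using assms by (intro poly_all_zero) simp
  then have "Polynomial.coeff ?q d = 0" by simp
  moreover have "Polynomial.coeff ?q d = mp_at \<rho> (mp_filter (\<lambda>m. wdeg U m = d) p)"
    by (simp add: coeff_sum mp_eval_eq keys_mp_filter lookup_mp_filter sum.inter_filter)
  ultimately show ?thesis by simp
qed

text \<open>Scaling one variable of \<open>B\<close> at a time isolates its exponent. Only
  coordinates in \<open>A\<close> are moved, so vanishing is needed only on a fibre over the other
  coordinates; later \<open>A\<close> consists of the variables \<open>AV i j\<close> and the
  coordinates of \<open>v\<close> stay fixed.\<close>

lemma mp_at_exponents_zero:
  fixes p :: "('v, 'k::{field,infinite}) mp"
  assumes "finite B" and zero: "\<And>\<rho>'. (\<And>v. v \<notin> A \<Longrightarrow> \<rho>' v = \<rho> v) \<Longrightarrow> mp_at \<rho>' p = 0"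
    and "B \<subseteq> A" and "\<And>v. v \<notin> A \<Longrightarrow> \<rho>' v = \<rho> v"
  shows "mp_at \<rho>' (mp_filter (\<lambda>m. \<forall>v\<in>B. lookup m v = e v) p) = 0"
  using assms(1,3,4)
proof (induction B arbitrary: \<rho>')
  case empty
  then show ?case using zero by (simp add: mp_filter_True)
next
  case (insert w B)
  have "mp_at (scale_on {w} t \<rho>') (mp_filter (\<lambda>m. \<forall>v\<in>B. lookup m v = e v) p) = 0" for t
    using insert by (intro insert.IH) (auto simp: scale_on_def)
  from mp_at_wdeg_component_zero[OF this, of "e w"] show ?case
    by (simp add: mp_filter_mp_filter wdeg_singleton)
qed

lemma mp_eq_zeroI:
  fixes p :: "('v, 'k::{field,infinite}) mp"
  assumes "\<And>\<rho>. mp_at \<rho> p = 0"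
  shows "p = 0"
proof (rule poly_mapping_eqI, rule ccontr)
  fix m0 assume "lookup p m0 \<noteq> lookup 0 m0"
  then have m0: "m0 \<in> keys p" by (simp add: in_keys_iff)
  let ?A = "\<Union>(keys ` keys p)"
  \<comment> \<open>No monomial of \<open>p\<close> involves a variable outside \<open>?A\<close>,
    so agreement on \<open>?A\<close> determines it.\<close>
  have "m = m0" if "m \<in> keys p" "\<forall>v\<in>?A. lookup m v = lookup m0 v" for m
  proof (rule poly_mapping_eqI)
    fix v show "lookup m v = lookup m0 v"
      using that m0 by (cases "v \<in> ?A") (auto simp: in_keys_iff)
  qed
  then have "mp_filter (\<lambda>m. \<forall>v\<in>?A. lookup m v = lookup m0 v) p = mp_filter (\<lambda>m. m = m0) p"
    by (intro mp_filter_cong) auto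
  also have "\<dots> = Poly_Mapping.single m0 (lookup p m0)"
    by (rule poly_mapping_eqI) (auto simp: lookup_mp_filter lookup_single)
  \<comment> \<open>At the point with all coordinates 1 the value of a single term is its
    coefficient.\<close>
  finally have "mp_at (\<lambda>_. 1) (Poly_Mapping.single m0 (lookup p m0)) = 0"
    using mp_at_exponents_zero[of ?A UNIV "\<lambda>_. 1" p "\<lambda>_. 1" "lookup m0"] assms by auto
  then show False using m0 by (simp add: mp_at_single monom_val_def in_keys_iff)
qed

lemma mp_eqI:
  fixes p q :: "('v, 'k::{field,infinite}) mp"
  assumes "\<And>\<rho>. mp_at \<rho> p = mp_at \<rho> q"
  shows "p = q"
  using mp_eq_zeroI[of "p - q"] assms by (simp add: ev.hom_minus)

subsection \<open>Homogeneous components\<close>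

definition hcomp :: "nat \<Rightarrow> ('v, 'k::comm_ring_1) mp \<Rightarrow> ('v, 'k) mp" where
  "hcomp d = mp_filter (\<lambda>m. wdeg UNIV m = d)"

lemma homogeneous_hcomp: "homogeneous (int d) (hcomp d p)"
  by (auto simp: hcomp_def homogeneous_iff keys_mp_filter)

lemma hcomp_carrier: "p \<in> carrier (mpoly_ring V) \<Longrightarrow> hcomp d p \<in> carrier (mpoly_ring V)"
  by (simp add: hcomp_def mp_filter_carrier)

lemma sum_hcomp:
  assumes "finite D" "wdeg UNIV ` keys p \<subseteq> D"
  shows "(\<Sum>d\<in>D. hcomp d p) = p"
  unfolding hcomp_def by (rule sum_mp_filter_fibres) fact+

section \<open>Vanishing ideals\<close>

lemma subgroup_add_mpoly_ring:
  assumes "I \<subseteq> carrier (mpoly_ring V)" "0 \<in> I"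
    "\<And>p q. p \<in> I \<Longrightarrow> q \<in> I \<Longrightarrow> p + q \<in> I" "\<And>p. p \<in> I \<Longrightarrow> - p \<in> I"
  shows "subgroup I (add_monoid (mpoly_ring V))"
proof (rule subgroup.intro)
  fix x assume x: "x \<in> I"
  have "inv\<^bsub>add_monoid (mpoly_ring V)\<^esub> x = \<ominus>\<^bsub>mpoly_ring V\<^esub> x"
    by (simp add: a_inv_def)
  also have "\<dots> = - x" using x assms by (intro a_inv_mpoly_ring) auto
  finally show "inv\<^bsub>add_monoid (mpoly_ring V)\<^esub> x \<in> I" using assms x by simp
qed (use assms in auto)

lemma ideal_common_zeros:
  "ideal {p \<in> carrier (mpoly_ring V). \<forall>\<rho>\<in>T. mp_at \<rho> p = 0} (mpoly_ring V)"
proof -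
  interpret cring "mpoly_ring V" by (rule cring_mpoly_ring)
  show ?thesis
    by (rule idealI[OF ring_axioms], rule subgroup_add_mpoly_ring)
      (auto simp: ev.hom_add ev.hom_mult ev.hom_uminus)
qed

lemma ideal_mpoly_sum:
  assumes "ideal I (mpoly_ring V)" "\<And>i. i \<in> A \<Longrightarrow> f i \<in> I"
  shows "sum f A \<in> I"
proof -
  interpret ideal I "mpoly_ring V" by fact
  have "0 \<in> I" "\<And>x y. x \<in> I \<Longrightarrow> y \<in> I \<Longrightarrow> x + y \<in> I"
    using additive_subgroup.zero_closed[OF is_additive_subgroup]
      additive_subgroup.a_closed[OF is_additive_subgroup] by auto
  then show ?thesis using assms(2) by (induction A rule: infinite_finite_induct) auto
qed

lemma eval_vec_def': "eval_vec v = mp_at (($) v)"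
  by (auto simp: eval_vec_def fun_eq_iff)

lemma proj_space_smult_closed:
  assumes "L \<in> proj_space n" "v \<in> L"
  shows "v \<in> carrier_vec (Suc n)" "t \<cdot>\<^sub>v v \<in> L"
  using assms by (auto simp: proj_space_def line_through_def smult_smult_assoc)

lemma eval_vec_smult:
  assumes "v \<in> carrier_vec (Suc n)" "p \<in> carrier (coord_ring n)"
  shows "eval_vec (t \<cdot>\<^sub>v v) p = mp_at (scale_on UNIV t (($) v)) p"
  unfolding eval_vec_def' using assms
  by (intro mp_eval_cong[OF assms(2)]) (auto simp: scale_on_def)

text \<open>The vectors over a projective point form a set closed under scaling, so with a
  polynomial all its homogeneous components vanish there. The homogeneous generators therefore
  already give every polynomial vanishing on the cone over \<open>Z\<close>.\<close>

lemma vanishing_ideal_eq: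
  fixes Z :: "'k::{field,infinite} vec set set"
  assumes Z: "Z \<subseteq> proj_space n"
  shows "vanishing_ideal n Z = {p \<in> carrier (coord_ring n). \<forall>L\<in>Z. \<forall>v\<in>L. eval_vec v p = 0}"
    (is "_ = ?I")
proof
  interpret cring "coord_ring n" by (rule cring_mpoly_ring)
  let ?G = "{f \<in> carrier (coord_ring n). (\<exists>d. homogeneous d f) \<and> (\<forall>L\<in>Z. \<forall>v\<in>L. eval_vec v f = (0::'k))}"
  have "?I = {p \<in> carrier (coord_ring n). \<forall>\<rho>\<in>(\<Union>L\<in>Z. ($) ` L). mp_at \<rho> p = 0}"
    by (auto simp: eval_vec_def')
  then have "ideal ?I (coord_ring n)"
    by (simp only: ideal_common_zeros)
  then show "vanishing_ideal n Z \<subseteq> ?I"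
    unfolding vanishing_ideal_def by (rule genideal_minimal) auto
  show "?I \<subseteq> vanishing_ideal n Z"
  proof
    fix p assume p: "p \<in> ?I"
    have "hcomp d p \<in> ?G" for d
    proof -
      have "eval_vec v (hcomp d p) = 0" if "L \<in> Z" "v \<in> L" for L v
        unfolding eval_vec_def' hcomp_def
      proof (rule mp_at_wdeg_component_zero)
        fix t
        have L: "L \<in> proj_space n" using that Z by auto
        have "eval_vec (t \<cdot>\<^sub>v v) p = 0"
          using p that proj_space_smult_closed[OF L \<open>v \<in> L\<close>] by blast
        then show "mp_at (scale_on UNIV t (($) v)) p = 0"
          using p proj_space_smult_closed[OF L \<open>v \<in> L\<close>] by (subst (asm) eval_vec_smult) auto
      qed
      then show ?thesis using p by (auto simp: hcomp_carrier intro: homogeneous_hcomp)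
    qed
    moreover have "?G \<subseteq> vanishing_ideal n Z"
      unfolding vanishing_ideal_def by (rule genideal_self) auto
    moreover have "ideal (vanishing_ideal n Z) (coord_ring n)"
      unfolding vanishing_ideal_def by (rule genideal_ideal) auto
    ultimately have "(\<Sum>d\<in>wdeg UNIV ` keys p. hcomp d p) \<in> vanishing_ideal n Z"
      by (intro ideal_mpoly_sum) auto
    then show "p \<in> vanishing_ideal n Z" by (simp add: sum_hcomp)
  qed
qed

section \<open>Extension of ideals from \<open>R\<close> to \<open>K[A]\<close>\<close>

definition KA_vars :: "nat \<Rightarrow> xavar set" where
  "KA_vars n = XV ` {..n} \<union> {AV i j | i j. 1 \<le> i \<and> i \<le> n - 1 \<and> j \<le> n}"

lemma KA_eq: "KA n = mpoly_ring (KA_vars n)"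
  by (simp add: KA_def KA_vars_def)

definition xa_point :: "(nat \<Rightarrow> 'k) \<Rightarrow> (nat \<Rightarrow> nat \<Rightarrow> 'k) \<Rightarrow> xavar \<Rightarrow> 'k" where
  "xa_point v a x = (case x of XV i \<Rightarrow> v i | AV i j \<Rightarrow> a i j)"

lemma xa_point_simps [simp]: "xa_point v a (XV i) = v i" "xa_point v a (AV i j) = a i j"
  by (simp_all add: xa_point_def)

lemma xa_point_cases: obtains v a where "\<rho> = xa_point v a"
proof
  show "\<rho> = xa_point (\<lambda>i. \<rho> (XV i)) (\<lambda>i j. \<rho> (AV i j))"
    by (auto simp: fun_eq_iff xa_point_def split: xavar.splits)
qed

lemma mp_at_embR: "mp_at \<rho> (embR f) = mp_at (\<lambda>i. \<rho> (XV i)) f"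
  unfolding embR_def by (simp add: mp_eval_mp_eval comm_ring_hom_id mp_at_var)

lemma embR_carrier: "f \<in> carrier (coord_ring n) \<Longrightarrow> embR f \<in> carrier (KA n)"
  unfolding embR_def KA_eq by (rule mp_eval_carrier) (auto simp: KA_vars_def)

interpretation embR: comm_ring_hom embR
  unfolding embR_def by (rule subst.comm_ring_hom_axioms)

text \<open>Writing \<open>G = \<Sum>\<^sub>\<alpha> g\<^sub>\<alpha>(X) A\<^sup>\<alpha>\<close>, vanishing of \<open>G\<close> at all \<open>(v, a)\<close> amounts to vanishing of all
  \<open>g\<^sub>\<alpha>\<close> at \<open>v\<close>.\<close>

lemma ext_ideal_vanishing_ideal_eq:
  fixes Z :: "'k::{field,infinite} vec set set"
  assumes Z: "Z \<subseteq> proj_space n"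
  shows "ext_ideal n (vanishing_ideal n Z) =
    {G \<in> carrier (KA n). \<forall>L\<in>Z. \<forall>v\<in>L. \<forall>a. mp_at (xa_point (($) v) a) G = 0}" (is "_ = ?I")
proof
  interpret cring "KA n :: (xavar, 'k) mp ring" unfolding KA_eq by (rule cring_mpoly_ring)
  let ?J = "ext_ideal n (vanishing_ideal n Z)"
  have "?I = {G \<in> carrier (KA n). \<forall>\<rho>\<in>(\<Union>L\<in>Z. \<Union>v\<in>L. range (xa_point (($) v))). mp_at \<rho> G = 0}"
    by auto
  then have "ideal ?I (KA n)"
    by (simp only: ideal_common_zeros KA_eq)
  moreover have "embR ` vanishing_ideal n Z \<subseteq> ?I"
    by (auto simp: vanishing_ideal_eq[OF Z] mp_at_embR eval_vec_def' embR_carrier)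
  ultimately show "?J \<subseteq> ?I"
    unfolding ext_ideal_def by (rule genideal_minimal)
  show "?I \<subseteq> ?J"
  proof
    fix G assume G: "G \<in> ?I"
    define A where "A = {AV i j | i j. 1 \<le> i \<and> i \<le> n - 1 \<and> j \<le> n}"
    have "A = (\<lambda>(i, j). AV i j) ` ({1..n-1} \<times> {..n})" by (auto simp: A_def)
    then have finA: "finite A" by simp
    \<comment> \<open>The A-part of an exponent vector, extended by zero so that equality of
      functions compares the exponents of the variables in \<open>A\<close> and nothing
      else.\<close>
    define k where "k m = (\<lambda>x. if x \<in> A then lookup m x else 0)" for m :: "xavar \<Rightarrow>\<^sub>0 nat"
    define mon where "mon c = (\<Prod>x\<in>A. mp_var x ^ c x :: (xavar, 'k) mp)" for c
    \<comment> \<open>The coefficient, a polynomial in \<open>X\<close>, of the A-monomial with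
      exponents \<open>c\<close>; \<open>map_key XV\<close> forgets the A-exponents and renames
      \<open>XV i\<close> to \<open>i\<close>.\<close>
    define g where "g c = (\<Sum>m | m \<in> keys G \<and> k m = c.
        Poly_Mapping.single (Poly_Mapping.map_key XV m) (lookup G m))" for c
    have injXV: "inj XV" by (auto simp: inj_def)
    have keysG: "keys m \<subseteq> KA_vars n" if "m \<in> keys G" for m
      using G that by (auto simp: KA_eq mpoly_carrier_iff)
    have KA_vars: "KA_vars n = XV ` {..n} \<union> A" by (simp add: KA_vars_def A_def)
    have disj: "XV ` {..n} \<inter> A = {}" by (auto simp: A_def)
    have single: "Poly_Mapping.single m x = embR (Poly_Mapping.single (Poly_Mapping.map_key XV m) x) * mon (k m)"
      if "m \<in> keys G" for m x
    proof -
      have "(\<Prod>v\<in>keys m. mp_var v ^ lookup m v) = (\<Prod>v\<in>XV ` {..n} \<union> A. mp_var v ^ lookup m v :: (xavar, 'k) mp)"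
        using keysG[OF that] finA by (intro prod.mono_neutral_left) (auto simp: KA_vars in_keys_iff)
      also have "\<dots> = (\<Prod>v\<in>XV ` {..n}. mp_var v ^ lookup m v) * (\<Prod>v\<in>A. mp_var v ^ lookup m v)"
        using finA disj by (intro prod.union_disjoint) auto
      also have "(\<Prod>v\<in>A. mp_var v ^ lookup m v) = (mon (k m) :: (xavar, 'k) mp)"
        by (auto simp: mon_def k_def intro!: prod.cong)
      also have "(\<Prod>v\<in>XV ` {..n}. mp_var v ^ lookup m v) = (\<Prod>i\<le>n. mp_var (XV i) ^ lookup m (XV i) :: (xavar, 'k) mp)"
        by (subst prod.reindex) (auto simp: inj_on_def)
      also have "\<dots> = monom_val (\<lambda>i. mp_var (XV i)) (Poly_Mapping.map_key XV m)"
        using keysG[OF that]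
        by (subst monom_val_superset[of "{..n}"])
          (auto simp: keys_map_key[OF injXV] map_key.rep_eq[OF injXV] KA_vars A_def)
      finally show ?thesis
        by (simp add: single_eq_prod_vars[of m] embR_def mp_const.mp_eval_single mult.assoc)
    qed
    have filt: "mp_filter (\<lambda>m. k m = c) G = embR (g c) * mon c" for c
      unfolding mp_filter_def g_def embR.hom_sum sum_distrib_right
      by (rule sum.cong) (auto simp: single)
    have g_carrier: "g c \<in> carrier (coord_ring n)" for c
      unfolding g_def
    proof (intro mpoly_carrier_sum mpoly_carrier_single)
      fix m assume "m \<in> {m \<in> keys G. k m = c}"
      with keysG[of m] show "keys (Poly_Mapping.map_key XV m) \<subseteq> {..n}"
        by (auto simp: keys_map_key[OF injXV] KA_vars A_def)
    qed
    have g_zero: "eval_vec v (g c) = 0" if v: "L \<in> Z" "v \<in> L" and c: "c \<in> k ` keys G" for L v c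
    proof -
      \<comment> \<open>With all A-coordinates equal to 1 the factor \<open>mon c\<close> has value
        1, and what remains is the value of \<open>g c\<close> at \<open>v\<close>.\<close>
      let ?\<rho> = "xa_point (($) v) (\<lambda>_ _. 1)"
      have "mp_at ?\<rho> (mp_filter (\<lambda>m. \<forall>x\<in>A. lookup m x = c x) G) = 0"
      proof (rule mp_at_exponents_zero[OF finA, of A ?\<rho>])
        fix \<rho>' assume eq: "\<And>x. x \<notin> A \<Longrightarrow> \<rho>' x = ?\<rho> x"
        obtain v' a where \<rho>': "\<rho>' = xa_point v' a" by (rule xa_point_cases)
        have "v' = ($) v" using eq[of "XV _"] by (auto simp: \<rho>' A_def fun_eq_iff)
        then show "mp_at \<rho>' G = 0" using G v by (simp add: \<rho>')
      qed auto
      moreover have "mp_filter (\<lambda>m. \<forall>x\<in>A. lookup m x = c x) G = mp_filter (\<lambda>m. k m = c) G"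
        using c by (intro mp_filter_cong) (auto simp: k_def fun_eq_iff)
      moreover have "mp_at ?\<rho> (mon c) = 1"
        by (auto simp: mon_def ev.hom_prod ev.hom_power mp_at_var A_def intro!: prod.neutral)
      ultimately show ?thesis
        by (simp add: filt ev.hom_mult mp_at_embR eval_vec_def')
    qed
    have ideal: "ideal ?J (KA n)"
      unfolding ext_ideal_def
      by (rule genideal_ideal) (auto simp: vanishing_ideal_eq[OF Z] embR_carrier)
    have sub: "embR ` vanishing_ideal n Z \<subseteq> ?J"
      unfolding ext_ideal_def
      by (rule genideal_self) (auto simp: vanishing_ideal_eq[OF Z] embR_carrier)
    have "mp_filter (\<lambda>m. k m = c) G \<in> ?J" if "c \<in> k ` keys G" for c
    proof -
      have "embR (g c) \<in> ?J"
        using g_carrier g_zero that sub by (force simp: vanishing_ideal_eq[OF Z])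
      moreover have "mon c \<in> carrier (KA n)"
        unfolding mon_def KA_eq KA_vars by (intro mpoly_carrier_prod mpoly_carrier_power mpoly_carrier_var) auto
      ultimately show ?thesis
        using ideal.I_r_closed[OF ideal] by (simp add: filt KA_eq)
    qed
    then have "(\<Sum>c\<in>k ` keys G. mp_filter (\<lambda>m. k m = c) G) \<in> ?J"
      using ideal by (intro ideal_mpoly_sum[of _ "KA_vars n"]) (auto simp: KA_eq)
    then show "G \<in> ?J" by (simp add: sum_mp_filter_fibres)
  qed
qed

section \<open>The vector of minors\<close>

definition xmat :: "nat \<Rightarrow> (nat \<Rightarrow> 'a) \<Rightarrow> (nat \<Rightarrow> 'a) \<Rightarrow> (nat \<Rightarrow> nat \<Rightarrow> 'a) \<Rightarrow> 'a::comm_ring_1 mat" where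
  "xmat n u v a = Matrix.mat (Suc n) (Suc n) (\<lambda>(r, c).
     if r = 0 then u c else if r = 1 then v c else a (r - 1) c)"

text \<open>The generalised cross product of the rows \<open>v, a_1, ..., a_(n-1)\<close>. With
  variables as entries it is the vector of the \<open>M_i\<close>.\<close>

definition cross :: "nat \<Rightarrow> (nat \<Rightarrow> 'a) \<Rightarrow> (nat \<Rightarrow> nat \<Rightarrow> 'a) \<Rightarrow> nat \<Rightarrow> 'a::comm_ring_1" where
  "cross n v a i = Determinant.det (xmat n (\<lambda>c. if c = i then 1 else 0) v a)"

lemma xmat_carrier [simp]: "xmat n u v a \<in> carrier_mat (Suc n) (Suc n)"
  by (simp add: xmat_def)

text \<open>Cofactors along the first row do not depend on that row, so one expansion covers all
  choices of \<open>u\<close>. Orthogonality of the minors to any other row is then a determinant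
  with two equal rows.\<close>

lemma det_xmat: "Determinant.det (xmat n u v a) = (\<Sum>i\<le>n. u i * cross n v a i)"
proof -
  have cof: "cofactor (xmat n u v a) 0 j = cofactor (xmat n u' v a) 0 j" for u u' j
    unfolding cofactor_def
    by (intro arg_cong2[of _ _ _ _ "(*)"] arg_cong[of _ _ Determinant.det] refl eq_matI)
      (auto simp: mat_delete_def xmat_def)
  have lap: "Determinant.det (xmat n u v a) = (\<Sum>j<Suc n. u j * cofactor (xmat n (\<lambda>_. 0) v a) 0 j)" for u
  proof -
    have "xmat n u v a $$ (0, j) = u j" if "j < Suc n" for j
      using that by (simp add: xmat_def)
    then show ?thesis
      by (subst laplace_expansion_row[of _ "Suc n" 0]) (use cof[of u _ "\<lambda>_. 0"] in auto)
  qed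
  have "cross n v a j = cofactor (xmat n (\<lambda>_. 0) v a) 0 j" if "j \<le> n" for j
    unfolding cross_def lap using that by (subst sum.remove[of _ j]) auto
  then show ?thesis
    unfolding lap[of u] by (auto intro!: sum.cong simp: lessThan_Suc_atMost)
qed

text \<open>The vector \<open>v\<close> occupies exactly one row, which exists since
  \<open>n \<ge> 1\<close>. This linearity is behind both the correction factor in
  \<open>cross_surj\<close> and the scaling law for degrees.\<close>

lemma cross_scale:
  assumes "n \<ge> 1" shows "cross n (\<lambda>c. t * v c) a i = t * cross n v a i"
proof -
  have "xmat n u (\<lambda>c. t * v c) a = multrow 1 t (xmat n u v a)" for u
    by (rule eq_matI) (auto simp: xmat_def)
  then show ?thesis
    using assms by (simp add: cross_def det_multrow[of _ "Suc n"])
qed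

lemma cross_orth:
  assumes "n \<ge> 1" shows "(\<Sum>i\<le>n. v i * cross n v a i) = 0"
  unfolding det_xmat[symmetric] using assms
  by (intro det_identical_rows[of _ "Suc n" 0 1]) (auto simp: xmat_def Matrix.row_def)

lemma cross_orth_row:
  assumes "1 \<le> k" "k \<le> n - 1" shows "(\<Sum>i\<le>n. a k i * cross n v a i) = 0"
  unfolding det_xmat[symmetric] using assms
  by (intro det_identical_rows[of _ "Suc n" 0 "Suc k"]) (auto simp: xmat_def Matrix.row_def)

lemma (in comm_ring_hom) hom_cross:
  "hom (cross n v a i) = cross n (\<lambda>c. hom (v c)) (\<lambda>k c. hom (a k c)) i"
proof -
  have "map_mat hom (xmat n (\<lambda>c. if c = i then 1 else 0) v a) =
    xmat n (\<lambda>c. if c = i then 1 else 0) (\<lambda>c. hom (v c)) (\<lambda>k c. hom (a k c))"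
    by (rule eq_matI) (auto simp: xmat_def)
  then show ?thesis by (simp add: cross_def flip: hom_det)
qed

text \<open>Complete \<open>v\<close> by vectors \<open>a\<^sub>1, \<dots>, a\<^bsub>n-1\<^esub>\<close> to a basis of the orthogonal complement of \<open>w\<close>;
  the minors are then a nonzero multiple of \<open>w\<close>, and \<open>t\<close> corrects the factor.\<close>

lemma cross_surj:
  fixes v w :: "nat \<Rightarrow> 'k::field"
  assumes n: "n \<ge> 1" and orth: "(\<Sum>i\<le>n. v i * w i) = 0"
    and v: "i0 \<le> n" "v i0 \<noteq> 0" and w: "p \<le> n" "w p \<noteq> 0"
  obtains t a where "t \<noteq> 0" "\<And>i. i \<le> n \<Longrightarrow> cross n (\<lambda>c. t * v c) a i = w i"
proof -
  \<comment> \<open>If \<open>v\<close> were supported at \<open>p\<close> alone, orthogonality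
    would read \<open>v p * w p = 0\<close> and force \<open>v = 0\<close>.\<close>
  have "\<exists>q\<le>n. q \<noteq> p \<and> v q \<noteq> 0"
  proof (rule ccontr)
    assume "\<not> ?thesis"
    then have zero: "v i = 0" if "i \<le> n" "i \<noteq> p" for i using that by blast
    have "(\<Sum>i\<le>n. v i * w i) = (\<Sum>i\<in>{p}. v i * w i)"
      using zero w by (intro sum.mono_neutral_right) auto
    with orth w have "v p = 0" by simp
    with zero v show False by metis
  qed
  then obtain q where q: "q \<le> n" "q \<noteq> p" "v q \<noteq> 0" by blast
  \<comment> \<open>Removing two of the \<open>n + 1\<close> indices leaves one index for each row
    \<open>a_k\<close>.\<close>
  have "card {1..n-1} = card ({..n} - {p, q})"
    using q w by (simp add: card_Diff_subset)
  then obtain \<sigma> where \<sigma>: "bij_betw \<sigma> {1..n-1} ({..n} - {p, q})"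
    using finite_same_card_bij[of "{1..n-1}" "{..n} - {p, q}"] by auto
  \<comment> \<open>Row \<open>k\<close> is \<open>e_j - (w_j / w_p) e_p\<close> for
    \<open>j = \<sigma> k\<close>, the simplest vector orthogonal to \<open>w\<close> with leading
    entry at \<open>j\<close>.\<close>
  define a where "a k c = (if c = \<sigma> k then 1 else 0) + (if c = p then - w (\<sigma> k) / w p else 0)" for k c
  have \<sigma>_mem: "\<sigma> k \<le> n" "\<sigma> k \<noteq> p" "\<sigma> k \<noteq> q" if "1 \<le> k" "k \<le> n - 1" for k
    using bij_betwE[OF \<sigma>] that by auto
  have \<sigma>_surj: "\<exists>k. 1 \<le> k \<and> k \<le> n - 1 \<and> \<sigma> k = j" if "j \<le> n" "j \<noteq> p" "j \<noteq> q" for j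
  proof -
    have "j \<in> \<sigma> ` {1..n-1}" using \<sigma> that by (auto simp: bij_betw_def)
    then show ?thesis by auto
  qed
  have a_sum: "(\<Sum>c\<le>n. a k c * x c) = x (\<sigma> k) - w (\<sigma> k) / w p * x p" if "1 \<le> k" "k \<le> n - 1" for k x
  proof -
    have "(\<Sum>c\<le>n. a k c * x c) = (\<Sum>c\<le>n. if c = \<sigma> k then x c else 0) + (\<Sum>c\<le>n. if c = p then - w (\<sigma> k) / w p * x c else 0)"
      unfolding sum.distrib[symmetric] by (intro sum.cong) (auto simp: a_def algebra_simps)
    then show ?thesis using \<sigma>_mem[OF that] w by simp
  qed
  define M where "M = cross n v a"
  have M_other: "M j = w j / w p * M p" if j: "j \<le> n" "j \<noteq> q" for j
  proof (cases "j = p")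
    case False
    then obtain k where "1 \<le> k" "k \<le> n - 1" "\<sigma> k = j" using \<sigma>_surj j by metis
    with a_sum[of k M] cross_orth_row[of k n a v] show ?thesis by (simp add: M_def)
  qed (use w in simp)
  \<comment> \<open>The rows \<open>a_k\<close> say nothing about the coordinate \<open>q\<close>;
    it follows because \<open>M\<close> and \<open>w\<close> are both orthogonal to \<open>v\<close>
    and \<open>v q\<close> is nonzero.\<close>
  have "v q * M q + (\<Sum>j\<in>{..n} - {q}. v j * M j) = 0"
    using cross_orth[OF n, of v a] q by (simp add: M_def sum.remove[of "{..n}" q])
  moreover have "(\<Sum>j\<in>{..n} - {q}. v j * M j) = (\<Sum>j\<in>{..n} - {q}. v j * w j) * (M p / w p)"
    unfolding sum_distrib_right by (intro sum.cong) (auto simp: M_other)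
  moreover have "(\<Sum>j\<in>{..n} - {q}. v j * w j) = - v q * w q"
    using orth q by (simp add: sum.remove[of "{..n}" q] add_eq_0_iff)
  ultimately have "v q * M q = v q * (w q / w p * M p)"
    by (simp add: algebra_simps add_eq_0_iff)
  then have "M q = w q / w p * M p" using q(3) by (simp only: mult_cancel_left) simp
  then have M: "M j = w j / w p * M p" if "j \<le> n" for j
    using M_other that by (cases "j = q") auto
  \<comment> \<open>\<open>M p\<close> is the determinant with first row \<open>e_p\<close>. A
    kernel vector vanishes at \<open>p\<close> by this row, then at every \<open>\<sigma> k\<close>
    by the rows \<open>a_k\<close>, and at last at \<open>q\<close> by the row
    \<open>v\<close>.\<close>
  have "M p \<noteq> 0"
  proof
    let ?A = "xmat n (\<lambda>c. if c = p then 1 else 0) v a"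
    assume "M p = 0"
    then have "Determinant.det ?A = 0" by (simp add: M_def cross_def)
    then obtain u where u: "u \<in> carrier_vec (Suc n)" "u \<noteq> 0\<^sub>v (Suc n)" "?A *\<^sub>v u = 0\<^sub>v (Suc n)"
      using det_0_iff_vec_prod_zero_field[of ?A "Suc n"] by auto
    have row: "(\<Sum>c\<le>n. ?A $$ (r, c) * u $ c) = 0" if "r \<le> n" for r
    proof -
      have "(?A *\<^sub>v u) $ r = (\<Sum>c\<le>n. ?A $$ (r, c) * u $ c)"
        using that u(1) unfolding xmat_def
        by (auto simp: scalar_prod_def lessThan_Suc_atMost[symmetric] atLeast0LessThan)
      then show ?thesis using u(3) that by simp
    qed
    have u_p: "u $ p = 0" using row[of 0] w
      by (simp add: xmat_def sum.delta if_distrib[of "\<lambda>x. x * _"] cong: if_cong)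
    have u_other: "u $ j = 0" if j: "j \<le> n" "j \<noteq> q" for j
    proof (cases "j = p")
      case False
      then obtain k where k: "1 \<le> k" "k \<le> n - 1" "\<sigma> k = j" using \<sigma>_surj j by metis
      have "(\<Sum>c\<le>n. a k c * u $ c) = (\<Sum>c\<le>n. ?A $$ (Suc k, c) * u $ c)"
        using k by (intro sum.cong) (auto simp: xmat_def)
      with row[of "Suc k"] k a_sum[of k "($) u"] u_p show ?thesis by simp
    qed (use u_p in simp)
    have "(\<Sum>c\<le>n. ?A $$ (1, c) * u $ c) = (\<Sum>c\<in>{q}. v c * u $ c)"
      using n u_other q by (intro sum.mono_neutral_cong_right) (auto simp: xmat_def)
    with row[of 1] n q have "u $ q = 0" by simp
    with u_other have "u $ j = 0" if "j \<le> n" for j using that by (cases "j = q") auto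
    with u(1) have "u = 0\<^sub>v (Suc n)" by (intro eq_vecI) auto
    with u show False by simp
  qed
  show thesis
  proof
    \<comment> \<open>So far \<open>M = (M p / w p) w\<close>; the inverse factor can be absorbed
      into \<open>v\<close>.\<close>
    show "w p / M p \<noteq> 0" using \<open>M p \<noteq> 0\<close> w by simp
    show "cross n (\<lambda>c. w p / M p * v c) a i = w i" if "i \<le> n" for i
      using M[OF that] \<open>M p \<noteq> 0\<close> w by (simp only: cross_scale[OF n] flip: M_def) simp
  qed
qed

text \<open>In dimension at least two every vector has a nonzero orthogonal one. It supplies the
  auxiliary direction whenever \<open>w = 0\<close> must be treated.\<close>

lemma exists_orth:
  fixes w :: "nat \<Rightarrow> 'k::field"
  assumes "n \<ge> 1"
  obtains v i where "i \<le> n" "v i \<noteq> 0" "(\<Sum>i\<le>n. v i * w i) = 0"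
proof (cases "w 0 = 0")
  case True
  have "(\<Sum>i\<le>n. (if i = 0 then 1 else 0) * w i) = 0" using True by (intro sum.neutral) auto
  then show ?thesis using that[of 0 "\<lambda>i. if i = 0 then 1 else 0"] by simp
next
  case False
  let ?v = "\<lambda>i. if i = 0 then - w 1 else if i = 1 then w 0 else 0"
  have "(\<Sum>i\<le>n. ?v i * w i) = (\<Sum>i\<in>{0,1}. ?v i * w i)"
    using assms by (intro sum.mono_neutral_right) auto
  then show ?thesis using that[of 1 ?v] False assms by simp
qed

section \<open>The generic minors and their values\<close>

lemma minor_M_eq: "minor_M n = cross n (\<lambda>c. mp_var (XV c)) (\<lambda>k c. mp_var (AV k c))"
  by (auto simp: minor_M_def cross_def xmat_def fun_eq_iff intro!: arg_cong[of _ _ Determinant.det])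

lemma mp_at_minor_M: "mp_at (xa_point v a) (minor_M n i) = cross n v a i"
  by (simp add: minor_M_eq ev.hom_cross mp_at_var)

lemma minor_M_carrier: "n \<ge> 1 \<Longrightarrow> i \<le> n \<Longrightarrow> minor_M n i \<in> carrier (KA n)"
proof -
  assume n: "n \<ge> 1" and "i \<le> n"
  let ?A = "xmat n (\<lambda>c. if c = i then 1 else 0) (\<lambda>c. mp_var (XV c)) (\<lambda>k c. mp_var (AV k c)) :: (xavar, 'a) mp mat"
  have ent: "?A $$ (r, c) \<in> carrier (KA n)" if "r \<le> n" "c \<le> n" for r c
    using that n by (auto simp: xmat_def KA_eq KA_vars_def intro!: mpoly_carrier_var)
  have sgn: "of_int (sign \<pi>) \<in> carrier (KA n :: (xavar, 'a) mp ring)" for \<pi> :: "nat \<Rightarrow> nat"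
    by (auto simp: sign_def KA_eq)
  have perm: "\<pi> r \<le> n" if "\<pi> \<in> {\<pi>. \<pi> permutes {0..<Suc n}}" "r \<in> {0..<Suc n}" for \<pi> r
    by (metis that mem_Collect_eq permutes_in_image atLeastLessThan_iff less_Suc_eq_le)
  show ?thesis
    unfolding minor_M_eq cross_def det_def'[OF xmat_carrier]
    using sgn ent perm unfolding KA_eq
    by (intro mpoly_carrier_sum mpoly_carrier_mult mpoly_carrier_prod) auto
qed

section \<open>The maps \<open>\<tau>\<close> and \<open>F\<close>\<close>

interpretation tau: comm_ring_hom "tau n" for n
  unfolding tau_def by (rule subst.comm_ring_hom_axioms)

lemma mp_at_tau: "mp_at (xa_point v a) (tau n s) = mp_at (cross n v a) s"
  unfolding tau_def by (simp add: mp_eval_mp_eval comm_ring_hom_id mp_at_minor_M)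

lemma mp_at_F_poly:
  "mp_at (xa_point v a) (F_poly n f) = (\<Sum>i\<le>n. v i * mp_at (cross n v a) (f i))"
  by (simp add: F_poly_def ev.hom_sum ev.hom_mult mp_at_var mp_at_tau)

lemma tau_carrier: "n \<ge> 1 \<Longrightarrow> s \<in> carrier (coord_ring n) \<Longrightarrow> tau n s \<in> carrier (KA n)"
  unfolding tau_def KA_eq
  by (rule mp_eval_carrier) (use minor_M_carrier in \<open>auto simp: KA_eq\<close>)

lemma F_poly_carrier:
  assumes "n \<ge> 1" "\<And>i. i \<le> n \<Longrightarrow> f i \<in> carrier (coord_ring n)"
  shows "F_poly n f \<in> carrier (KA n)"
  unfolding F_poly_def KA_eq
  using tau_carrier[OF assms(1) assms(2)]
  by (intro mpoly_carrier_sum mpoly_carrier_mult mpoly_carrier_var) (auto simp: KA_vars_def KA_eq)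

lemma F_poly_add: "F_poly n (\<lambda>i. f i + g i) = F_poly n f + F_poly n g"
  by (simp add: F_poly_def tau.hom_add algebra_simps sum.distrib)

lemma F_poly_mult: "F_poly n (\<lambda>i. s * f i) = tau n s * F_poly n f"
  by (simp add: F_poly_def tau.hom_mult sum_distrib_left mult_ac)

lemma F_poly_cong: "(\<And>i. i \<le> n \<Longrightarrow> f i = g i) \<Longrightarrow> F_poly n f = F_poly n g"
  by (auto simp: F_poly_def intro: sum.cong)

text \<open>Multiplication by another variable leaves the exponent of \<open>i\<close> unchanged, so
  every monomial of \<open>f\<close> must already contain the variable \<open>i\<close>; lowering
  that exponent gives the quotient.\<close>

lemma mp_var_cofactor:
  fixes f h :: "(nat, 'k::comm_ring_1) mp"
  assumes eq: "f * mp_var j = h * mp_var i" and "i \<noteq> j" and f: "f \<in> carrier (mpoly_ring V)"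
  obtains g where "g \<in> carrier (mpoly_ring V)" "f = g * mp_var i"
proof
  let ?e = "\<lambda>i. Poly_Mapping.single i (1 :: nat)"
  have lookup_var: "lookup (p * mp_var k) m = (if lookup m k = 0 then 0 else lookup p (m - ?e k))" for p k m
  proof (induction p rule: mp_induct)
    case (single m' c)
    have "m' + ?e k = m \<longleftrightarrow> lookup m k \<noteq> 0 \<and> m' = m - ?e k"
      by (auto simp: poly_mapping_eq_iff fun_eq_iff lookup_add lookup_minus lookup_single when_def)
    then show ?case by (auto simp: mp_var_def mult_single lookup_single when_def)
  qed (simp_all add: lookup_add algebra_simps)
  let ?g = "\<Sum>m\<in>keys f. Poly_Mapping.single (m - ?e i) (lookup f m)"
  have i: "lookup m i \<noteq> 0" if "m \<in> keys f" for m
  proof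
    assume 0: "lookup m i = 0"
    \<comment> \<open>The coefficient of \<open>f\<close> at \<open>m\<close> reappears on the left
      at \<open>m + ?e j\<close>, whereas the right side has no term free of the variable
      \<open>i\<close>.\<close>
    have "lookup (f * mp_var j) (m + ?e j) = lookup f m"
      by (simp add: lookup_var lookup_add)
    moreover have "lookup (h * mp_var i) (m + ?e j) = 0"
      using 0 \<open>i \<noteq> j\<close> by (simp add: lookup_var lookup_add lookup_single)
    ultimately show False using that eq by (simp add: in_keys_iff)
  qed
  show "?g \<in> carrier (mpoly_ring V)"
  proof (intro mpoly_carrier_sum mpoly_carrier_single)
    fix m assume "m \<in> keys f"
    then have "keys m \<subseteq> V" using f by (auto simp: mpoly_carrier_iff)
    then show "keys (m - ?e i) \<subseteq> V"
      by (auto simp: in_keys_iff lookup_minus)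
  qed
  have "?g * mp_var i = (\<Sum>m\<in>keys f. Poly_Mapping.single m (lookup f m))"
    unfolding sum_distrib_right
  proof (rule sum.cong)
    fix m assume "m \<in> keys f"
    then have "m - ?e i + ?e i = m"
      using i[of m] by (intro poly_mapping_eqI) (auto simp: lookup_add lookup_minus lookup_single when_def)
    then show "Poly_Mapping.single (m - ?e i) (lookup f m) * mp_var i = Poly_Mapping.single m (lookup f m)"
      by (simp add: mp_var_def mult_single)
  qed simp
  then show "f = ?g * mp_var i" by (simp flip: mp_sum_singles)
qed

text \<open>Proportionality to the variables amounts to \<open>f_i Y_j = f_j Y_i\<close>. At a point
  \<open>w\<close> this is the pairing of \<open>(f_k(w))\<close> with
  \<open>w_j e_i - w_i e_j\<close>, which is orthogonal to \<open>w\<close>; by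
  \<open>cross_surj\<close> the pairing is, up to a nonzero factor, a value of
  \<open>F_poly n f\<close>.\<close>

lemma F_poly_eq_0_iff:
  fixes f :: "nat \<Rightarrow> (nat, 'k::{field,infinite}) mp"
  assumes n: "n \<ge> 1" and f: "\<And>i. i \<le> n \<Longrightarrow> f i \<in> carrier (coord_ring n)"
  shows "F_poly n f = 0 \<longleftrightarrow> (\<exists>g\<in>carrier (coord_ring n). \<forall>i\<le>n. f i = g * mp_var i)"
proof
  assume "\<exists>g\<in>carrier (coord_ring n). \<forall>i\<le>n. f i = g * mp_var i"
  then obtain g where "\<And>i. i \<le> n \<Longrightarrow> f i = g * mp_var i" by blast
  then have "F_poly n f = tau n g * F_poly n mp_var"
    by (subst F_poly_mult[symmetric], intro F_poly_cong) auto
  also have "F_poly n mp_var = (0 :: (xavar, 'k) mp)"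
    using cross_orth[OF n, of "\<lambda>c. mp_var (XV c)"]
    by (simp add: F_poly_def tau_def mp_const.mp_eval_var minor_M_eq)
  finally show "F_poly n f = 0" by simp
next
  assume F: "F_poly n f = 0"
  have sym: "f i * mp_var j = f j * mp_var i" if ij: "i \<le> n" "j \<le> n" "i \<noteq> j" for i j
  proof (rule mp_eqI)
    fix w :: "nat \<Rightarrow> 'k"
    show "mp_at w (f i * mp_var j) = mp_at w (f j * mp_var i)"
    \<comment> \<open>When both coordinates vanish the orthogonal vector degenerates to zero, but
      then both sides of the relation are zero.\<close>
    proof (cases "w i = 0 \<and> w j = 0")
      case False
      define v where "v k = (if k = i then w j else if k = j then - w i else 0)" for k
      have v_sum: "(\<Sum>k\<le>n. v k * x k) = w j * x i - w i * x j" for x :: "nat \<Rightarrow> 'k"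
      proof -
        have "(\<Sum>k\<le>n. v k * x k) = (\<Sum>k\<in>{i, j}. v k * x k)"
          using ij by (intro sum.mono_neutral_right) (auto simp: v_def)
        then show ?thesis using ij by (simp add: v_def)
      qed
      obtain p where p: "p \<le> n" "w p \<noteq> 0" using False ij by auto
      obtain q where q: "q \<le> n" "v q \<noteq> 0" using False ij by (auto simp: v_def)
      have orth: "(\<Sum>k\<le>n. v k * w k) = 0" by (simp add: v_sum)
      obtain t a where t: "t \<noteq> 0" and ta: "\<And>i. i \<le> n \<Longrightarrow> cross n (\<lambda>c. t * v c) a i = w i"
        using cross_surj[OF n orth q p] by metis
      have "0 = mp_at (xa_point (\<lambda>c. t * v c) a) (F_poly n f)" by (simp add: F)
      also have "\<dots> = (\<Sum>k\<le>n. t * v k * mp_at w (f k))"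
        unfolding mp_at_F_poly using f ta
        by (intro sum.cong arg_cong2[of _ _ _ _ "(*)"] refl mp_eval_cong[of _ "{..n}"]) auto
      also have "\<dots> = t * (\<Sum>k\<le>n. v k * mp_at w (f k))"
        by (simp add: sum_distrib_left mult_ac)
      finally show ?thesis using t by (simp add: v_sum ev.hom_mult mp_at_var mult_ac)
    qed (simp add: ev.hom_mult mp_at_var)
  qed
  \<comment> \<open>Comparing \<open>f 0\<close> with \<open>f 1\<close>, available since
    \<open>n \<ge> 1\<close>, makes \<open>f 0\<close> divisible by \<open>Y_0\<close>.\<close>
  obtain g where g: "g \<in> carrier (coord_ring n)" "f 0 = g * mp_var 0"
    using mp_var_cofactor[OF sym[of 0 1]] f[of 0] n by auto
  have "f i = g * mp_var i" if "i \<le> n" for i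
  proof (cases "i = 0")
    case False
    \<comment> \<open>From \<open>f_i Y_0 = f_0 Y_i = g Y_0 Y_i\<close> the variable
      \<open>Y_0\<close> can be cancelled.\<close>
    have "(f i - g * mp_var i) * mp_var 0 = 0"
      using sym[of i 0] that False g by (simp add: algebra_simps)
    moreover have "mp_var 0 \<noteq> (0 :: (nat, 'k) mp)"
      by (simp add: mp_var_def flip: keys_eq_empty)
    ultimately show ?thesis by simp
  qed (use g in simp)
  with g show "\<exists>g\<in>carrier (coord_ring n). \<forall>i\<le>n. f i = g * mp_var i" by blast
qed

section \<open>Derivations\<close>

lemma theta_apply: "p \<in> carrier (coord_ring n) \<Longrightarrow> theta n f p = (\<Sum>i\<le>n. f i * mp_pderiv i p)"
  by (simp add: theta_def)

lemma theta_var: "i \<le> n \<Longrightarrow> theta n f (mp_var i) = f i"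
  by (subst theta_apply)
    (auto simp: mp_pderiv_var if_distrib[of "\<lambda>x. _ * x"] cong: if_cong intro!: mpoly_carrier_var)

lemma theta_cong: "(\<And>i. i \<le> n \<Longrightarrow> f i = g i) \<Longrightarrow> theta n f = theta n g"
  by (auto simp: theta_def fun_eq_iff restrict_def intro: sum.cong)

lemma theta_in_derivations:
  assumes "\<And>i. i \<le> n \<Longrightarrow> f i \<in> carrier (coord_ring n)"
  shows "theta n f \<in> derivations n"
proof -
  have "(\<Sum>i\<le>n. f i * mp_pderiv i p) \<in> carrier (coord_ring n)" if "p \<in> carrier (coord_ring n)" for p
    using assms that by (intro mpoly_carrier_sum mpoly_carrier_mult mp_pderiv_carrier) auto
  then show ?thesis
    by (auto simp: derivations_def theta_def mpoly_carrier_add mpoly_carrier_mult mp_pderiv_add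
        mp_pderiv_mult algebra_simps sum.distrib sum_distrib_left)
qed

text \<open>Linearity and the Leibniz rule determine a derivation by its values on variables,
  constants being killed because \<open>1 * 1 = 1\<close>. Off the carrier both maps are undefined
  by extensionality.\<close>

lemma derivations_eq_theta:
  assumes \<theta>: "\<theta> \<in> derivations n"
  shows "\<theta> = theta n (\<lambda>i. \<theta> (mp_var i))"
proof
  fix p
  show "\<theta> p = theta n (\<lambda>i. \<theta> (mp_var i)) p"
  proof (cases "p \<in> carrier (coord_ring n)")
    case True
    have "\<theta> (1 * 1) = \<theta> 1 * 1 + 1 * \<theta> 1"
      using \<theta> unfolding derivations_def by blast
    then have "\<theta> 1 = \<theta> 1 + \<theta> 1" by (simp only: mult_1_left mult_1_right)
    then have one: "\<theta> 1 = 0" by (simp only: add_cancel_right_right)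
    have const: "\<theta> (mp_const c) = 0" for c
    proof -
      have "\<theta> (mp_const c * 1) = mp_const c * \<theta> 1"
        using \<theta> unfolding derivations_def by blast
      then show ?thesis by (simp add: one)
    qed
    from True have "\<theta> p = (\<Sum>i\<le>n. \<theta> (mp_var i) * mp_pderiv i p)"
    proof (induction rule: mpoly_ring_induct)
      case (add p q)
      then show ?case using \<theta> by (simp add: derivations_def mp_pderiv_add algebra_simps sum.distrib)
    next
      case (mult p q)
      then show ?case using \<theta>
        by (simp add: derivations_def mp_pderiv_mult algebra_simps sum.distrib sum_distrib_left)
    qed (simp_all add: const mp_pderiv_var if_distrib[of "\<lambda>x. _ * x"] cong: if_cong)
    with True show ?thesis by (simp add: theta_def)
  next
    case False
    then show ?thesis using \<theta> by (auto simp: derivations_def theta_def PiE_def extensional_def)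
  qed
qed

lemma lin_form_carrier: "lin_form n v \<in> carrier (coord_ring n)"
  unfolding lin_form_def by (intro mpoly_carrier_sum mpoly_carrier_mult mpoly_carrier_var) auto

lemma theta_lin_form: "theta n f (lin_form n v) = (\<Sum>i\<le>n. mp_const (v $ i) * f i)"
proof -
  have pd: "mp_pderiv i (lin_form n v) = mp_const (v $ i)" if "i \<le> n" for i
  proof -
    have sum: "mp_pderiv i (sum g A) = (\<Sum>j\<in>A. mp_pderiv i (g j))" for g :: "nat \<Rightarrow> (nat, 'a) mp" and A
      by (induction A rule: infinite_finite_induct) (auto simp: mp_pderiv_add)
    show ?thesis using that
      by (simp add: lin_form_def sum mp_pderiv_mult mp_pderiv_var if_distrib[of "\<lambda>x. _ * x"] cong: if_cong)
  qed
  show ?thesis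
    unfolding theta_apply[OF lin_form_carrier] by (intro sum.cong) (auto simp: pd mult.commute)
qed

lemma mp_at_lin_form: "mp_at w (lin_form n v) = (\<Sum>i\<le>n. v $ i * w i)"
  by (simp add: lin_form_def ev.hom_sum ev.hom_mult mp_at_const mp_at_var)

subsection \<open>Restriction to a line\<close>

text \<open>The restriction of \<open>p\<close> to the line through \<open>\<rho>\<close> with
  direction \<open>\<sigma>\<close>, kept as a formal polynomial in the parameter so that
  \<open>pderiv\<close> applies to it.\<close>

definition on_line :: "('v \<Rightarrow> 'k) \<Rightarrow> ('v \<Rightarrow> 'k) \<Rightarrow> ('v, 'k::comm_ring_1) mp \<Rightarrow> 'k poly" where
  "on_line \<rho> \<sigma> = mp_eval (\<lambda>c. [:c:]) (\<lambda>v. [:\<rho> v, \<sigma> v:])"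

lemma comm_ring_hom_const_poly: "comm_ring_hom (\<lambda>c::'k::comm_ring_1. [:c:])"
  by unfold_locales (auto simp: one_pCons)

interpretation on_line: comm_ring_hom "on_line \<rho> \<sigma>" for \<rho> \<sigma>
  unfolding on_line_def by (rule comm_ring_hom.mp_eval_comm_ring_hom[OF comm_ring_hom_const_poly])

lemma on_line_const: "on_line \<rho> \<sigma> (mp_const c) = [:c:]"
  unfolding on_line_def by (rule comm_ring_hom.mp_eval_const[OF comm_ring_hom_const_poly])

lemma on_line_var: "on_line \<rho> \<sigma> (mp_var v) = [:\<rho> v, \<sigma> v:]"
  unfolding on_line_def by (rule comm_ring_hom.mp_eval_var[OF comm_ring_hom_const_poly])

lemma poly_on_line: "poly (on_line \<rho> \<sigma> p) t = mp_at (\<lambda>v. \<rho> v + t * \<sigma> v) p"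
proof -
  have "p \<in> carrier (mpoly_ring UNIV)" by (simp add: mpoly_carrier_UNIV)
  then show ?thesis
    by (induction rule: mpoly_ring_induct)
      (simp_all add: on_line_const on_line_var on_line.hom_add on_line.hom_mult mp_at_const mp_at_var
        ev.hom_add ev.hom_mult)
qed

text \<open>The chain rule. At parameter 0, with \<open>\<sigma>\<close> the value of a vector field
  at \<open>\<rho>\<close>, the right side is the value at \<open>\<rho>\<close> of the associated
  derivation.\<close>

lemma pderiv_on_line:
  assumes "p \<in> carrier (mpoly_ring V)" "finite V"
  shows "pderiv (on_line \<rho> \<sigma> p) = (\<Sum>v\<in>V. [:\<sigma> v:] * on_line \<rho> \<sigma> (mp_pderiv v p))"
  using assms(1)
proof (induction rule: mpoly_ring_induct)
  case (var w)
  have "(\<Sum>v\<in>V. [:\<sigma> v:] * on_line \<rho> \<sigma> (mp_pderiv v (mp_var w))) = (\<Sum>v\<in>V. if v = w then [:\<sigma> v:] else 0)"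
    by (intro sum.cong) (auto simp: mp_pderiv_var)
  then show ?case using var assms(2) by (simp add: on_line_var pderiv_pCons)
next
  case (mult p q)
  then show ?case
    by (simp add: on_line.hom_mult on_line.hom_add pderiv_mult mp_pderiv_mult algebra_simps
        sum.distrib sum_distrib_left)
qed (simp_all add: on_line_const on_line.hom_add pderiv_pCons pderiv_add mp_pderiv_add sum.distrib algebra_simps)

section \<open>Logarithmic derivations and the extended ideal\<close>

text \<open>The pointwise form of the tangency of \<open>\<theta>\<^sub>f\<close> to all hyperplanes dual to points of \<open>Z\<close>.\<close>

definition tangent :: "nat \<Rightarrow> 'k::field vec set set \<Rightarrow> (nat \<Rightarrow> (nat, 'k) mp) \<Rightarrow> bool" where
  "tangent n Z f \<longleftrightarrow>
     (\<forall>L\<in>Z. \<forall>v\<in>L. \<forall>w. (\<Sum>i\<le>n. v $ i * w i) = 0 \<longrightarrow> (\<Sum>i\<le>n. v $ i * mp_at w (f i)) = 0)"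

lemma F_poly_in_ext_ideal_iff:
  fixes Z :: "'k::{field,infinite} vec set set"
  assumes n: "n \<ge> 1" and Z: "Z \<subseteq> proj_space n"
    and f: "\<And>i. i \<le> n \<Longrightarrow> f i \<in> carrier (coord_ring n)"
  shows "F_poly n f \<in> ext_ideal n (vanishing_ideal n Z) \<longleftrightarrow> tangent n Z f"
proof
  assume "tangent n Z f"
  then have "mp_at (xa_point (($) v) a) (F_poly n f) = 0" if "L \<in> Z" "v \<in> L" for L v a
    using that cross_orth[OF n, of "($) v" a] by (auto simp: tangent_def mp_at_F_poly)
  then show "F_poly n f \<in> ext_ideal n (vanishing_ideal n Z)"
    using F_poly_carrier[OF n f] by (auto simp: ext_ideal_vanishing_ideal_eq[OF Z])
next
  assume F: "F_poly n f \<in> ext_ideal n (vanishing_ideal n Z)"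
  have nz: "(\<Sum>i\<le>n. v $ i * mp_at w (f i)) = 0"
    if L: "L \<in> Z" "v \<in> L" and orth: "(\<Sum>i\<le>n. v $ i * w i) = 0" and p: "p \<le> n" "w p \<noteq> 0" for L v w p
  proof (cases "\<exists>q\<le>n. v $ q \<noteq> 0")
    case True
    then obtain q where q: "q \<le> n" "v $ q \<noteq> 0" by blast
    obtain t a where t: "t \<noteq> 0" and ta: "\<And>i. i \<le> n \<Longrightarrow> cross n (\<lambda>c. t * v $ c) a i = w i"
      using cross_surj[OF n orth q p] by metis
    have v: "v \<in> carrier_vec (Suc n)" "t \<cdot>\<^sub>v v \<in> L"
      using L Z by (auto intro: proj_space_smult_closed)
    \<comment> \<open>Entries of a vector beyond its dimension are unspecified, so the two points
      agree only on the variables of \<open>KA n\<close>.\<close>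
    have eqx: "xa_point (($) (t \<cdot>\<^sub>v v)) a x = xa_point (\<lambda>c. t * v $ c) a x" if "x \<in> KA_vars n" for x
      using that v(1) by (auto simp: KA_vars_def)
    have "0 = mp_at (xa_point (($) (t \<cdot>\<^sub>v v)) a) (F_poly n f)"
      using F L v(2) by (auto simp: ext_ideal_vanishing_ideal_eq[OF Z])
    also have "\<dots> = mp_at (xa_point (\<lambda>c. t * v $ c) a) (F_poly n f)"
      using F_poly_carrier[OF n f] unfolding KA_eq by (intro mp_eval_cong eqx) auto
    also have "\<dots> = (\<Sum>i\<le>n. t * v $ i * mp_at w (f i))"
      unfolding mp_at_F_poly using f ta
      by (intro sum.cong arg_cong2[of _ _ _ _ "(*)"] refl mp_eval_cong[of _ "{..n}"]) auto
    also have "\<dots> = t * (\<Sum>i\<le>n. v $ i * mp_at w (f i))"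
      by (simp add: sum_distrib_left mult_ac)
    finally show ?thesis using t by simp
  qed (auto intro: sum.neutral)
  show "tangent n Z f"
    unfolding tangent_def
  proof (intro ballI allI impI)
    fix L v w assume L: "L \<in> Z" "v \<in> L" and orth: "(\<Sum>i\<le>n. v $ i * w i) = 0"
    show "(\<Sum>i\<le>n. v $ i * mp_at w (f i)) = 0"
    proof (cases "\<exists>p\<le>n. w p \<noteq> 0")
      case True
      then show ?thesis using nz L orth by blast
    next
      case False
      \<comment> \<open>Here \<open>w\<close> vanishes on all relevant indices. Along the line
        spanned by an orthogonal \<open>u\<close>, the polynomial \<open>h\<close> is zero for
        nonzero parameter; the factor \<open>[:0, 1:]\<close> takes care of parameter 0 and is then
        cancelled, which gives the value at the origin.\<close>
      obtain u p where u: "p \<le> n" "u p \<noteq> 0" "(\<Sum>i\<le>n. u i * v $ i) = 0"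
        using exists_orth[OF n] by blast
      define h where "h = (\<Sum>i\<le>n. mp_const (v $ i) * f i)"
      have h: "mp_at x h = (\<Sum>i\<le>n. v $ i * mp_at x (f i))" for x
        by (simp add: h_def ev.hom_sum ev.hom_mult mp_at_const)
      have h_carrier: "h \<in> carrier (coord_ring n)"
        unfolding h_def using f by (intro mpoly_carrier_sum mpoly_carrier_mult) auto
      have "poly ([:0, 1:] * on_line (\<lambda>_. 0) u h) t = 0" for t
      proof (cases "t = 0")
        case False
        have "(\<Sum>i\<le>n. v $ i * (t * u i)) = t * (\<Sum>i\<le>n. u i * v $ i)"
          by (simp add: sum_distrib_left mult_ac)
        then have "mp_at (\<lambda>i. t * u i) h = 0"
          unfolding h using False u L by (intro nz[of L v _ p]) auto
        then show ?thesis by (simp add: poly_on_line)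
      qed simp
      then have "[:0, 1:] * on_line (\<lambda>_. 0) u h = 0" by (rule poly_all_zero)
      then have "on_line (\<lambda>_. 0) u h = 0" by simp
      then have "poly (on_line (\<lambda>_. 0) u h) 0 = 0" by simp
      then have "mp_at (\<lambda>_. 0) h = 0" by (simp add: poly_on_line)
      moreover have "mp_at (\<lambda>_. 0) h = mp_at w h"
        using False by (intro mp_eval_cong[OF h_carrier]) auto
      ultimately show ?thesis by (simp add: h)
    qed
  qed
qed

text \<open>The points of the hyperplane cover its whole linear cone. The origin is included because
  the hyperplane contains at least one projective point when \<open>n \<ge> 1\<close>.\<close>

lemma vanishing_ideal_hyperplane:
  fixes v :: "'k::{field,infinite} vec"
  assumes n: "n \<ge> 1"
  shows "vanishing_ideal n (hyperplane n v) =
    {p \<in> carrier (coord_ring n). \<forall>w. (\<Sum>i\<le>n. v $ i * w i) = 0 \<longrightarrow> mp_at w p = 0}"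
proof -
  have H: "hyperplane n v \<subseteq> proj_space n" by (auto simp: hyperplane_def)
  have ex: "\<exists>L\<in>hyperplane n v. \<exists>x\<in>L. \<forall>i\<le>n. x $ i = w i" if orth: "(\<Sum>i\<le>n. v $ i * w i) = 0" for w
  proof -
    \<comment> \<open>A nonzero \<open>w\<close> spans its own line, while \<open>w = 0\<close> is
      the multiple by 0 of any nonzero vector of the cone.\<close>
    obtain u t where u: "\<exists>p\<le>n. u p \<noteq> 0" "(\<Sum>i\<le>n. v $ i * u i) = 0" "\<And>i. i \<le> n \<Longrightarrow> w i = t * u i"
    proof (cases "\<exists>p\<le>n. w p \<noteq> 0")
      case True
      then show ?thesis using that[of w 1] orth by simp
    next
      case False
      obtain u p where "p \<le> n" "u p \<noteq> 0" "(\<Sum>i\<le>n. u i * v $ i) = 0"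
        using exists_orth[OF n] by blast
      then show ?thesis using that[of u 0] False by (auto simp: mult.commute)
    qed
    define x where "x = Matrix.vec (Suc n) u"
    have x: "x \<in> carrier_vec (Suc n)" "x \<noteq> 0\<^sub>v (Suc n)"
      using u(1) by (auto simp: x_def vec_eq_iff less_Suc_eq_le)
    have "line_through x \<in> hyperplane n v"
    proof -
      have "(\<Sum>i\<le>n. v $ i * (c \<cdot>\<^sub>v x) $ i) = c * (\<Sum>i\<le>n. v $ i * u i)" for c
        unfolding sum_distrib_left by (intro sum.cong) (auto simp: x_def)
      then show ?thesis using x u(2)
        by (auto simp: hyperplane_def proj_space_def eval_vec_def' mp_at_lin_form line_through_def)
    qed
    moreover have "t \<cdot>\<^sub>v x \<in> line_through x" by (auto simp: line_through_def)
    moreover have "\<forall>i\<le>n. (t \<cdot>\<^sub>v x) $ i = w i" using u(3) by (simp add: x_def)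
    ultimately show ?thesis by blast
  qed
  show ?thesis
    unfolding vanishing_ideal_eq[OF H]
  proof (intro Collect_cong conj_cong refl iffI ballI allI impI)
    fix p w assume p: "p \<in> carrier (coord_ring n)" and van: "\<forall>L\<in>hyperplane n v. \<forall>v\<in>L. eval_vec v p = 0"
      and "(\<Sum>i\<le>n. v $ i * w i) = 0"
    then obtain L x where "L \<in> hyperplane n v" "x \<in> L" "\<forall>i\<le>n. x $ i = w i" using ex by blast
    then show "mp_at w p = 0"
      using van mp_eval_cong[OF p, of "($) x" w "\<lambda>c. c"] by (auto simp: eval_vec_def')
  next
    fix p L x assume "\<forall>w. (\<Sum>i\<le>n. v $ i * w i) = 0 \<longrightarrow> mp_at w p = 0" "L \<in> hyperplane n v" "x \<in> L"
    then show "eval_vec x p = 0" by (auto simp: hyperplane_def eval_vec_def' mp_at_lin_form)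
  qed
qed

text \<open>Tangency puts \<open>u = (f_i(w))\<close> into the hyperplane through \<open>w\<close>,
  so \<open>p\<close> vanishes on the line \<open>w + t u\<close> and its derivative at
  \<open>t = 0\<close>, which is the value of \<open>theta n f p\<close> at \<open>w\<close>, is
  zero. Conversely the derivation is applied to the linear form of the hyperplane.\<close>

lemma theta_log_iff:
  fixes Z :: "'k::{field,infinite} vec set set"
  assumes n: "n \<ge> 1" and Z: "Z \<subseteq> proj_space n"
    and f: "\<And>i. i \<le> n \<Longrightarrow> f i \<in> carrier (coord_ring n)"
  shows "theta n f \<in> carrier (log_derivations n (dual_arrangement n Z)) \<longleftrightarrow> tangent n Z f"
proof
  assume tan: "tangent n Z f"
  have "theta n f p \<in> vanishing_ideal n (hyperplane n v)"
    if v: "line_through v \<in> Z" and p: "p \<in> vanishing_ideal n (hyperplane n v)" for v p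
  proof -
    have pc: "p \<in> carrier (coord_ring n)" using p by (simp add: vanishing_ideal_hyperplane[OF n])
    have "mp_at w (theta n f p) = 0" if w: "(\<Sum>i\<le>n. v $ i * w i) = 0" for w
    proof -
      let ?u = "\<lambda>i. mp_at w (f i)"
      have "1 \<cdot>\<^sub>v v \<in> line_through v" unfolding line_through_def by blast
      then have u: "(\<Sum>i\<le>n. v $ i * ?u i) = 0"
        using tan v w unfolding tangent_def by auto
      have "poly (on_line w ?u p) t = 0" for t
      proof -
        have "(\<Sum>i\<le>n. v $ i * (w i + t * ?u i)) = (\<Sum>i\<le>n. v $ i * w i) + t * (\<Sum>i\<le>n. v $ i * ?u i)"
          by (simp add: algebra_simps sum.distrib sum_distrib_left)
        then show ?thesis using p u w by (simp add: poly_on_line vanishing_ideal_hyperplane[OF n])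
      qed
      then have "on_line w ?u p = 0" by (rule poly_all_zero)
      then have "poly (pderiv (on_line w ?u p)) 0 = 0" by simp
      then have "(\<Sum>i\<le>n. ?u i * mp_at w (mp_pderiv i p)) = 0"
        by (simp add: pderiv_on_line[OF pc] poly_sum poly_on_line)
      then show ?thesis by (simp add: theta_apply pc ev.hom_sum ev.hom_mult)
    qed
    moreover have "theta n f p \<in> carrier (coord_ring n)"
      using theta_in_derivations[of n f] f pc by (auto simp: derivations_def)
    ultimately show ?thesis by (simp add: vanishing_ideal_hyperplane[OF n])
  qed
  then show "theta n f \<in> carrier (log_derivations n (dual_arrangement n Z))"
    using theta_in_derivations[of n f] f by (auto simp: log_derivations_def dual_arrangement_def)
next
  assume log: "theta n f \<in> carrier (log_derivations n (dual_arrangement n Z))"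
  show "tangent n Z f"
    unfolding tangent_def
  proof (intro ballI allI impI)
    fix L v w assume L: "L \<in> Z" "v \<in> L" and orth: "(\<Sum>i\<le>n. v $ i * w i) = 0"
    obtain v0 where v0: "L = line_through v0" "v0 \<in> carrier_vec (Suc n)" "v0 \<noteq> 0\<^sub>v (Suc n)"
      using L Z by (auto simp: proj_space_def)
    \<comment> \<open>The arrangement uses nonzero representatives, whereas \<open>tangent\<close>
      ranges over all vectors of \<open>L\<close>. Both sums scale by \<open>c\<close>, and
      \<open>c = 0\<close> is trivial.\<close>
    obtain c where c: "v = c \<cdot>\<^sub>v v0" using L v0 by (auto simp: line_through_def)
    have scale: "(\<Sum>i\<le>n. v $ i * x i) = c * (\<Sum>i\<le>n. v0 $ i * x i)" for x
      unfolding sum_distrib_left using v0 by (intro sum.cong) (auto simp: c)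
    have "hyperplane n v0 \<in> dual_arrangement n Z"
      using v0 L by (auto simp: dual_arrangement_def)
    then have "theta n f ` vanishing_ideal n (hyperplane n v0) \<subseteq> vanishing_ideal n (hyperplane n v0)"
      using log by (auto simp: log_derivations_def)
    moreover have "lin_form n v0 \<in> vanishing_ideal n (hyperplane n v0)"
      by (simp add: vanishing_ideal_hyperplane[OF n] lin_form_carrier mp_at_lin_form)
    ultimately have "theta n f (lin_form n v0) \<in> vanishing_ideal n (hyperplane n v0)" by blast
    then have "(\<Sum>i\<le>n. v0 $ i * w i) = 0 \<longrightarrow> (\<Sum>i\<le>n. v0 $ i * mp_at w (f i)) = 0"
      by (auto simp: vanishing_ideal_hyperplane[OF n] theta_lin_form ev.hom_sum ev.hom_mult mp_at_const)
    then show "(\<Sum>i\<le>n. v $ i * mp_at w (f i)) = 0"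
      using orth by (auto simp: scale)
  qed
qed

lemma theta_eq_iff:
  assumes "\<And>i. i \<le> n \<Longrightarrow> f i \<in> carrier (coord_ring n)" "g \<in> carrier (coord_ring n)"
  shows "theta n f = (\<lambda>p\<in>carrier (coord_ring n). g * euler n p) \<longleftrightarrow> (\<forall>i\<le>n. f i = g * mp_var i)"
proof -
  have "(\<lambda>p\<in>carrier (coord_ring n). g * euler n p) = theta n (\<lambda>i. g * mp_var i)"
    by (auto simp: euler_def theta_def fun_eq_iff restrict_def sum_distrib_left mult_ac)
  moreover have "theta n f = theta n h \<longleftrightarrow> (\<forall>i\<le>n. f i = h i)" for h
    using theta_var[of _ n f] theta_var[of _ n h] theta_cong[of n f h] by metis
  ultimately show ?thesis by simp
qed

section \<open>Graded modules along isomorphisms\<close>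

lemma finsum_transport:
  assumes M: "abelian_group M" and N: "abelian_group N"
    and add: "\<And>x y. x \<in> carrier M \<Longrightarrow> y \<in> carrier M \<Longrightarrow> h (x \<oplus>\<^bsub>M\<^esub> y) = h x \<oplus>\<^bsub>N\<^esub> h y"
    and zero: "h \<zero>\<^bsub>M\<^esub> = \<zero>\<^bsub>N\<^esub>" and h: "h ` carrier M \<subseteq> carrier N"
    and "finite A" and c: "\<And>d. d \<in> A \<Longrightarrow> c d \<in> carrier M"
  shows "h (finsum M c A) = finsum N (\<lambda>d. h (c d)) A"
proof -
  interpret M: abelian_group M by fact
  interpret N: abelian_group N by fact
  show ?thesis
    using \<open>finite A\<close> c
  proof (induction A rule: finite_induct)
    case (insert d A)
    have "h (finsum M c (insert d A)) = h (c d \<oplus>\<^bsub>M\<^esub> finsum M c A)"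
      using insert by (subst M.finsum_insert) auto
    also have "\<dots> = h (c d) \<oplus>\<^bsub>N\<^esub> h (finsum M c A)"
      using insert by (intro add M.finsum_closed) auto
    also have "\<dots> = finsum N (\<lambda>d. h (c d)) (insert d A)"
      using insert h by (subst N.finsum_insert) (auto simp: image_subset_iff)
    finally show ?case .
  qed (simp add: zero)
qed

text \<open>The axioms of a graded module are equations, closure conditions and one unique
  existence, all of which an additive semilinear bijection reflects. So for the base change only
  closure and compatibility with the bijection have to be checked.\<close>

lemma graded_module_iso_transport:
  assumes N: "graded_module P gP N gN"
    and bij: "bij_betw h (carrier M) (carrier N)"
    and add_closed: "\<And>x y. x \<in> carrier M \<Longrightarrow> y \<in> carrier M \<Longrightarrow> x \<oplus>\<^bsub>M\<^esub> y \<in> carrier M"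
    and zero_closed: "\<zero>\<^bsub>M\<^esub> \<in> carrier M"
    and smult_closed: "\<And>p x. p \<in> carrier P \<Longrightarrow> x \<in> carrier M \<Longrightarrow> p \<odot>\<^bsub>M\<^esub> x \<in> carrier M"
    and add: "\<And>x y. x \<in> carrier M \<Longrightarrow> y \<in> carrier M \<Longrightarrow> h (x \<oplus>\<^bsub>M\<^esub> y) = h x \<oplus>\<^bsub>N\<^esub> h y"
    and zero: "h \<zero>\<^bsub>M\<^esub> = \<zero>\<^bsub>N\<^esub>"
    and smult: "\<And>p x. p \<in> carrier P \<Longrightarrow> x \<in> carrier M \<Longrightarrow> h (p \<odot>\<^bsub>M\<^esub> x) = p \<odot>\<^bsub>N\<^esub> h x"
    and gM: "\<And>d. gM d \<subseteq> carrier M" and gP: "\<And>d. gP d \<subseteq> carrier P"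
    and img: "\<And>d. h ` gM d = gN d"
  shows "graded_module_iso P gP M gM N gN h"
proof -
  interpret N: Module.module P N using N by (simp add: graded_module_def)
  have inj: "x = y" if "h x = h y" "x \<in> carrier M" "y \<in> carrier M" for x y
    using bij that by (auto simp: bij_betw_def inj_on_def)
  have hN: "h x \<in> carrier N" if "x \<in> carrier M" for x
    using bij that by (auto simp: bij_betw_def)
  have surj: "\<exists>x\<in>carrier M. h x = y" if "y \<in> carrier N" for y
    using that bij_betw_imp_surj_on[OF bij] by (metis imageE)
  have gM_iff: "x \<in> gM d \<longleftrightarrow> h x \<in> gN d" if "x \<in> carrier M" for x d
    using gM[of d] img[of d] inj that by blast
  have grp: "abelian_group M"
  proof (rule abelian_groupI)
    fix x assume x: "x \<in> carrier M"
    obtain y where y: "y \<in> carrier M" "h y = \<ominus>\<^bsub>N\<^esub> h x" using surj[of "\<ominus>\<^bsub>N\<^esub> h x"] hN x by auto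
    have "y \<oplus>\<^bsub>M\<^esub> x = \<zero>\<^bsub>M\<^esub>"
      using x y hN by (intro inj) (auto simp: add zero add_closed zero_closed N.l_neg)
    with y show "\<exists>y\<in>carrier M. y \<oplus>\<^bsub>M\<^esub> x = \<zero>\<^bsub>M\<^esub>" by blast
  qed (auto intro!: inj simp: add_closed zero_closed add zero hN N.a_ac)
  then interpret M: abelian_group M .
  have neg: "h (\<ominus>\<^bsub>M\<^esub> x) = \<ominus>\<^bsub>N\<^esub> h x" if "x \<in> carrier M" for x
  proof -
    have "h (\<ominus>\<^bsub>M\<^esub> x) \<oplus>\<^bsub>N\<^esub> h x = \<zero>\<^bsub>N\<^esub>"
      using that by (simp flip: add zero add: M.l_neg)
    then show ?thesis using that hN by (intro N.minus_equality[symmetric]) auto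
  qed
  have mod: "Module.module P M"
    by (rule moduleI[OF N.is_cring grp])
      (auto intro!: inj simp: smult_closed add_closed smult add hN
        N.smult_l_distr N.smult_r_distr N.smult_assoc1)
  have sub: "subgroup (gM d) (add_monoid M)" for d
  proof -
    interpret S: subgroup "gN d" "add_monoid N" using N by (simp add: graded_module_def)
    have neg_closed: "\<ominus>\<^bsub>N\<^esub> y \<in> gN d" if "y \<in> gN d" for y
      using S.m_inv_closed[OF that] by (simp add: a_inv_def)
    show ?thesis
    proof (rule subgroup.intro)
      fix x assume x: "x \<in> gM d"
      then have "\<ominus>\<^bsub>M\<^esub> x \<in> gM d"
        using gM[of d] by (subst gM_iff) (auto simp: neg neg_closed gM_iff)
      then show "inv\<^bsub>add_monoid M\<^esub> x \<in> gM d" by (simp add: a_inv_def)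
    next
      fix x y assume "x \<in> gM d" "y \<in> gM d"
      moreover from this have "x \<in> carrier M" "y \<in> carrier M" using gM by auto
      ultimately show "x \<otimes>\<^bsub>add_monoid M\<^esub> y \<in> gM d"
        using S.m_closed[of "h x" "h y"] by (simp add: gM_iff add)
    next
      show "\<one>\<^bsub>add_monoid M\<^esub> \<in> gM d" using S.one_closed by (simp add: gM_iff zero)
    qed (use gM in auto)
  qed
  have sm: "p \<odot>\<^bsub>M\<^esub> x \<in> gM (a + b)" if "p \<in> gP a" "x \<in> gM b" for a b p x
  proof -
    have "p \<in> carrier P" "x \<in> carrier M" using that gM gP by auto
    moreover have "h x \<in> gN b" using that img by auto
    ultimately show ?thesis using N that by (auto simp: gM_iff smult smult_closed graded_module_def)
  qed
  have "\<exists>!c. (\<forall>d. c d \<in> gM d) \<and> finite {d. c d \<noteq> \<zero>\<^bsub>M\<^esub>} \<and> x = finsum M c {d. c d \<noteq> \<zero>\<^bsub>M\<^esub>}"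
    (is "\<exists>!c. ?Q c") if x: "x \<in> carrier M" for x
  proof -
    let ?QN = "\<lambda>c. (\<forall>d. c d \<in> gN d) \<and> finite {d. c d \<noteq> \<zero>\<^bsub>N\<^esub>} \<and> h x = finsum N c {d. c d \<noteq> \<zero>\<^bsub>N\<^esub>}"
    have ex1: "\<exists>!c. ?QN c"
      using N hN[OF x] by (auto simp: graded_module_def)
    have iff: "?Q c \<longleftrightarrow> ?QN (\<lambda>d. h (c d))" if c: "\<And>d. c d \<in> carrier M" for c
    proof -
      have supp: "{d. h (c d) \<noteq> \<zero>\<^bsub>N\<^esub>} = {d. c d \<noteq> \<zero>\<^bsub>M\<^esub>}"
        using inj[OF _ c zero_closed] zero by auto
      have "h x = finsum N (\<lambda>d. h (c d)) {d. c d \<noteq> \<zero>\<^bsub>M\<^esub>} \<longleftrightarrow> x = finsum M c {d. c d \<noteq> \<zero>\<^bsub>M\<^esub>}"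
        if "finite {d. c d \<noteq> \<zero>\<^bsub>M\<^esub>}"
      proof -
        have "h (finsum M c {d. c d \<noteq> \<zero>\<^bsub>M\<^esub>}) = finsum N (\<lambda>d. h (c d)) {d. c d \<noteq> \<zero>\<^bsub>M\<^esub>}"
          using that c hN by (intro finsum_transport[OF grp N.abelian_group_axioms add zero]) auto
        then show ?thesis using inj[OF _ x, of "finsum M c {d. c d \<noteq> \<zero>\<^bsub>M\<^esub>}"] c
          by (metis M.finsum_closed Pi_I)
      qed
      then show ?thesis by (auto simp: supp gM_iff[OF c])
    qed
    \<comment> \<open>The decomposition of \<open>h x\<close> is pulled back degree by degree, using
      that \<open>h\<close> maps \<open>gM d\<close> onto \<open>gN d\<close>.\<close>
    define cN where "cN = (THE c. ?QN c)"
    have cN: "?QN cN" unfolding cN_def by (rule theI'[OF ex1])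
    have uniq: "c' = cN" if "?QN c'" for c' unfolding cN_def using the1_equality[OF ex1, OF that] by (rule sym)
    have "\<exists>y. y \<in> carrier M \<and> h y = cN d" for d
      using cN img[of d] gM[of d] by (metis imageE subsetD)
    then obtain c where c: "\<And>d. c d \<in> carrier M" "\<And>d. h (c d) = cN d" by metis
    show ?thesis
    proof (rule ex1I)
      show "?Q c" using cN by (subst iff[of c]) (auto simp: c)
      fix c' assume Q': "?Q c'"
      then have c': "c' d \<in> carrier M" for d using gM by blast
      have "?QN (\<lambda>d. h (c' d))" using Q' by (subst iff[of c', symmetric]) (rule c')
      from uniq[OF this] have "(\<lambda>d. h (c' d)) = cN" .
      then show "c' = c" using c c' by (auto intro!: ext inj dest: fun_cong)
    qed
  qed
  then have "graded_module P gP M gM"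
    using mod sub sm by (simp add: graded_module_def)
  then show ?thesis
    using N bij add smult img by (simp add: graded_module_iso_def)
qed

section \<open>Quotients by the kernel of an additive map\<close>

text \<open>Cosets of a kernel are the fibres of the map. Applied twice: to derivations modulo Euler
  multiples, and to formal sums of pairs modulo the tensor relations.\<close>

locale kernel_quotient = group G for G (structure) +
  fixes \<Phi> :: "'a \<Rightarrow> 'c::ab_group_add" and T :: "'a set"
  assumes \<Phi>_mult: "x \<in> carrier G \<Longrightarrow> y \<in> carrier G \<Longrightarrow> \<Phi> (x \<otimes> y) = \<Phi> x + \<Phi> y"
    and T_eq: "T = {x \<in> carrier G. \<Phi> x = 0}"
begin

lemma \<Phi>_one: "\<Phi> \<one> = 0"
  using \<Phi>_mult[of \<one> \<one>] by simp

lemma \<Phi>_inv: "x \<in> carrier G \<Longrightarrow> \<Phi> (inv x) = - \<Phi> x"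
  using \<Phi>_mult[of "inv x" x] by (simp add: \<Phi>_one eq_neg_iff_add_eq_0)

lemma rcos_eq_fibre:
  assumes x: "x \<in> carrier G" shows "T #> x = {y \<in> carrier G. \<Phi> y = \<Phi> x}"
proof
  show "{y \<in> carrier G. \<Phi> y = \<Phi> x} \<subseteq> T #> x"
  proof clarify
    fix y assume y: "y \<in> carrier G" "\<Phi> y = \<Phi> x"
    then have "y \<otimes> inv x \<in> T" using x by (simp add: T_eq \<Phi>_mult \<Phi>_inv)
    moreover have "y = (y \<otimes> inv x) \<otimes> x" using x y by (simp add: m_assoc)
    ultimately show "y \<in> T #> x" unfolding r_coset_def by blast
  qed
qed (use x in \<open>auto simp: r_coset_def T_eq \<Phi>_mult\<close>)

definition ind :: "'a set \<Rightarrow> 'c" where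
  "ind C = the_elem (\<Phi> ` C)"

lemma ind_rcos: "x \<in> carrier G \<Longrightarrow> ind (T #> x) = \<Phi> x"
proof -
  assume x: "x \<in> carrier G"
  then have "\<Phi> ` (T #> x) = {\<Phi> x}" by (auto simp: rcos_eq_fibre)
  then show ?thesis by (simp add: ind_def)
qed

lemma rcos_eq_iff: "x \<in> carrier G \<Longrightarrow> y \<in> carrier G \<Longrightarrow> T #> x = T #> y \<longleftrightarrow> \<Phi> x = \<Phi> y"
  by (metis ind_rcos rcos_eq_fibre)

lemma rcosets_eq: "rcosets T = {T #> x | x. x \<in> carrier G}"
  by (auto simp: RCOSETS_def)

lemma rcos_one: "T = T #> \<one>"
  by (simp add: rcos_eq_fibre) (simp add: T_eq \<Phi>_one)

lemma bij_ind: "bij_betw ind (rcosets T) (\<Phi> ` carrier G)"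
proof (rule bij_betw_imageI)
  show "inj_on ind (rcosets T)"
  proof (rule inj_onI)
    fix C D assume "C \<in> rcosets T" "D \<in> rcosets T" "ind C = ind D"
    then obtain x y where "x \<in> carrier G" "y \<in> carrier G" "C = T #> x" "D = T #> y" "ind C = ind D"
      unfolding rcosets_eq by blast
    then show "C = D" by (metis ind_rcos rcos_eq_iff)
  qed
  show "ind ` (rcosets T) = \<Phi> ` carrier G"
    unfolding rcosets_eq image_Collect by (auto simp: ind_rcos image_iff) (metis ind_rcos)
qed

lemma rcos_mult:
  assumes "x \<in> carrier G" "y \<in> carrier G"
  shows "(T #> x) <#> (T #> y) = T #> (x \<otimes> y)"
proof
  show "(T #> x) <#> (T #> y) \<subseteq> T #> (x \<otimes> y)"
    using assms by (auto simp: set_mult_def rcos_eq_fibre \<Phi>_mult)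
  show "T #> (x \<otimes> y) \<subseteq> (T #> x) <#> (T #> y)"
  proof
    fix z assume "z \<in> T #> (x \<otimes> y)"
    then have z: "z \<in> carrier G" "\<Phi> z = \<Phi> x + \<Phi> y" using assms by (auto simp: rcos_eq_fibre \<Phi>_mult)
    have "z = x \<otimes> (inv x \<otimes> z)" using assms z by (simp add: m_assoc[symmetric])
    moreover have "inv x \<otimes> z \<in> T #> y" "x \<in> T #> x"
      using assms z by (auto simp: rcos_eq_fibre \<Phi>_mult \<Phi>_inv)
    ultimately show "z \<in> (T #> x) <#> (T #> y)" unfolding set_mult_def by blast
  qed
qed

text \<open>Scalar multiplication on quotients is written as a union over representatives. All of
  them have the same value after \<open>\<sigma>\<close>, so the cosets in the union
  coincide.\<close>

lemma rcos_lift: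
  assumes "x \<in> carrier G"
    and "\<And>y. y \<in> carrier G \<Longrightarrow> \<sigma> y \<in> carrier G"
    and "\<And>y. y \<in> carrier G \<Longrightarrow> \<Phi> (\<sigma> y) = \<gamma> (\<Phi> y)"
  shows "(\<Union>y\<in>T #> x. T #> \<sigma> y) = T #> \<sigma> x"
  using assms by (auto simp: rcos_eq_fibre)

lemma ind_mult:
  assumes "C \<in> rcosets T" "D \<in> rcosets T"
  shows "C <#> D \<in> rcosets T" "ind (C <#> D) = ind C + ind D"
  using assms by (auto simp: rcosets_eq rcos_mult ind_rcos \<Phi>_mult)

end

section \<open>Base change along a surjection\<close>

text \<open>Every tensor over a surjective base change is of the form \<open>1 \<otimes> x\<close>. Hence an additive, injective
  and semilinear \<open>\<phi>\<close> on the module identifies the base change with the image of \<open>\<phi>\<close>.\<close>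

locale base_change_embedding =
  fixes S :: "'s ring" and \<tau> :: "'s \<Rightarrow> 'p::comm_ring_1" and P :: "'p ring"
    and N :: "('s, 'b) module" and \<phi> :: "'b \<Rightarrow> 'p"
  assumes P_add: "ring.add P = (+)" and P_mult: "monoid.mult P = (*)"
    and P_one: "1 \<in> carrier P"
    and P_add_closed: "p \<in> carrier P \<Longrightarrow> q \<in> carrier P \<Longrightarrow> p + q \<in> carrier P"
    and P_mult_closed: "p \<in> carrier P \<Longrightarrow> q \<in> carrier P \<Longrightarrow> p * q \<in> carrier P"
    and \<tau>_surj: "\<tau> ` carrier S = carrier P"
    and N_add: "x \<in> carrier N \<Longrightarrow> y \<in> carrier N \<Longrightarrow> x \<oplus>\<^bsub>N\<^esub> y \<in> carrier N"
    and N_zero: "\<zero>\<^bsub>N\<^esub> \<in> carrier N"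
    and N_smult: "s \<in> carrier S \<Longrightarrow> x \<in> carrier N \<Longrightarrow> s \<odot>\<^bsub>N\<^esub> x \<in> carrier N"
    and \<phi>_inj: "inj_on \<phi> (carrier N)"
    and \<phi>_add: "x \<in> carrier N \<Longrightarrow> y \<in> carrier N \<Longrightarrow> \<phi> (x \<oplus>\<^bsub>N\<^esub> y) = \<phi> x + \<phi> y"
    and \<phi>_zero: "\<phi> \<zero>\<^bsub>N\<^esub> = 0"
    and \<phi>_smult: "s \<in> carrier S \<Longrightarrow> x \<in> carrier N \<Longrightarrow> \<phi> (s \<odot>\<^bsub>N\<^esub> x) = \<tau> s * \<phi> x"
    and \<phi>_diff: "x \<in> carrier N \<Longrightarrow> y \<in> carrier N \<Longrightarrow> \<phi> x - \<phi> y \<in> \<phi> ` carrier N"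
begin

text \<open>The additive extension of \<open>(p, x) \<mapsto> p * \<phi> x\<close> to formal sums;
  it will induce the isomorphism.\<close>

definition frag_map :: "('p \<times> 'b \<Rightarrow>\<^sub>0 int) \<Rightarrow> 'p" where
  "frag_map c = (\<Sum>k\<in>keys c. of_int (lookup c k) * (fst k * \<phi> (snd k)))"

lemma frag_map_superset:
  "finite A \<Longrightarrow> keys c \<subseteq> A \<Longrightarrow> frag_map c = (\<Sum>k\<in>A. of_int (lookup c k) * (fst k * \<phi> (snd k)))"
  unfolding frag_map_def by (intro sum.mono_neutral_left) (auto simp: in_keys_iff)

lemma frag_map_add: "frag_map (c + c') = frag_map c + frag_map c'"
proof -
  let ?A = "keys c \<union> keys c'"
  have "keys (c + c') \<subseteq> ?A" by (rule keys_add)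
  then show ?thesis
    by (simp add: frag_map_superset[of ?A] lookup_add distrib_right sum.distrib)
qed

lemma frag_map_0: "frag_map 0 = 0" by (simp add: frag_map_def)

lemma frag_map_uminus: "frag_map (- c) = - frag_map c"
  using frag_map_add[of c "- c"] by (simp add: frag_map_0 eq_neg_iff_add_eq_0 add.commute)

lemma frag_map_diff: "frag_map (c - c') = frag_map c - frag_map c'"
  using frag_map_add[of c "- c'"] by (simp add: frag_map_uminus)

lemma frag_map_of: "frag_map (frag_of (p, x)) = p * \<phi> x"
  by (subst frag_map_superset[of "{(p, x)}"]) (auto simp: keys_frag_of)

abbreviation "F \<equiv> tensor_group P N"
abbreviation "T \<equiv> tensor_null S \<tau> P N"

lemma F_carrier_iff: "c \<in> carrier F \<longleftrightarrow> keys c \<subseteq> carrier P \<times> carrier N"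
  by (simp add: tensor_group_def)

lemma F_simps: "monoid.mult F = (+)" "\<one>\<^bsub>F\<^esub> = 0"
  by (auto simp: tensor_group_def fun_eq_iff)

lemma F_diff_closed: "c \<in> carrier F \<Longrightarrow> c' \<in> carrier F \<Longrightarrow> c - c' \<in> carrier F"
  using keys_diff[of c c'] by (auto simp: F_carrier_iff)

lemma F_frag_of: "frag_of (p, x) \<in> carrier F \<longleftrightarrow> p \<in> carrier P \<and> x \<in> carrier N"
  by (simp add: F_carrier_iff keys_frag_of)

lemma group_F: "group F" and comm_group_F: "comm_group F"
  by (auto simp: tensor_group_def abelian_free_Abelian_group)

lemma rels_sub: "tensor_rels S \<tau> P N \<subseteq> carrier F"
  unfolding tensor_rels_def P_add P_mult using equalityD1[OF \<tau>_surj]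
  by (auto simp: image_subset_iff intro!: F_diff_closed P_add_closed P_mult_closed N_add N_smult simp: F_frag_of)

lemma subgroup_T: "subgroup T F"
  unfolding tensor_null_def using group.generate_is_subgroup[OF group_F rels_sub] .

lemma inv_F: "c \<in> carrier F \<Longrightarrow> inv\<^bsub>F\<^esub> c = - c"
  by (simp add: tensor_group_def)

lemma T_sub: "T \<subseteq> carrier F"
  using subgroup.subset[OF subgroup_T] .

lemma T_add: "a \<in> T \<Longrightarrow> b \<in> T \<Longrightarrow> a + b \<in> T"
  using subgroup.m_closed[OF subgroup_T] by (simp add: F_simps)

lemma T_uminus: "a \<in> T \<Longrightarrow> - a \<in> T"
  using subgroup.m_inv_closed[OF subgroup_T, of a] inv_F[of a] T_sub by auto

lemma T_diff: "a \<in> T \<Longrightarrow> b \<in> T \<Longrightarrow> a - b \<in> T"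
  using T_add[OF _ T_uminus] by fastforce

lemma T_rels: "r \<in> tensor_rels S \<tau> P N \<Longrightarrow> r \<in> T"
  unfolding tensor_null_def by (rule generate.incl)

lemma frag_map_T: "c \<in> T \<Longrightarrow> frag_map c = 0"
proof -
  assume c: "c \<in> T"
  have 0: "frag_map r = 0" if "r \<in> tensor_rels S \<tau> P N" for r
    using that unfolding tensor_rels_def P_add P_mult
    by (auto simp: frag_map_diff frag_map_of \<phi>_add \<phi>_smult ring_distribs mult_ac)
  show ?thesis
    using c unfolding tensor_null_def
  proof (induction rule: generate.induct)
    case (inv h)
    then show ?case using rels_sub 0 by (auto simp: inv_F frag_map_uminus)
  qed (simp_all add: F_simps frag_map_0 frag_map_add 0)
qed

text \<open>The additivity relation for \<open>0 + 0 = 0\<close> is, after cancellation, the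
  negative of this generator.\<close>

lemma T_zero_tensor: "frag_of (1, \<zero>\<^bsub>N\<^esub>) \<in> T"
proof -
  have "\<zero>\<^bsub>N\<^esub> \<oplus>\<^bsub>N\<^esub> \<zero>\<^bsub>N\<^esub> = \<zero>\<^bsub>N\<^esub>"
    by (rule inj_onD[OF \<phi>_inj]) (auto simp: \<phi>_add \<phi>_zero N_add N_zero)
  then have "frag_of (1, \<zero>\<^bsub>N\<^esub>) - frag_of (1, \<zero>\<^bsub>N\<^esub>) - frag_of (1, \<zero>\<^bsub>N\<^esub>) \<in> tensor_rels S \<tau> P N"
    unfolding tensor_rels_def using N_zero P_one by force
  from T_uminus[OF T_rels[OF this]] show ?thesis by simp
qed

text \<open>Writing \<open>p = \<tau> s\<close> moves \<open>p\<close> into the second factor, and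
  differences are collected there. No subtraction is assumed on \<open>N\<close>; the element
  standing for a difference is found through the image of \<open>\<phi>\<close>.\<close>

lemma reduce_tensor:
  assumes "c \<in> carrier F" shows "\<exists>x\<in>carrier N. c - frag_of (1, x) \<in> T"
proof -
  have "keys c \<subseteq> carrier P \<times> carrier N" using assms by (simp add: F_carrier_iff)
  then show ?thesis
  proof (induction rule: frag_induction)
    case zero
    show ?case using N_zero T_uminus[OF T_zero_tensor] by auto
  next
    case (one k)
    then obtain p x where k: "k = (p, x)" "p \<in> carrier P" "x \<in> carrier N" by auto
    then obtain s where s: "s \<in> carrier S" "p = \<tau> s" using \<tau>_surj by auto
    have "frag_of (\<tau> s \<otimes>\<^bsub>P\<^esub> 1, x) - frag_of (1, s \<odot>\<^bsub>N\<^esub> x) \<in> tensor_rels S \<tau> P N"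
      unfolding tensor_rels_def using s k P_one by blast
    then have "frag_of (p, x) - frag_of (1, s \<odot>\<^bsub>N\<^esub> x) \<in> T"
      using T_rels s by (simp add: P_mult)
    then show ?case using N_smult s k by auto
  next
    case (diff a b)
    then obtain x y where x: "x \<in> carrier N" "a - frag_of (1, x) \<in> T"
      and y: "y \<in> carrier N" "b - frag_of (1, y) \<in> T" by blast
    obtain z where z: "z \<in> carrier N" "\<phi> z = \<phi> x - \<phi> y" using \<phi>_diff[OF x(1) y(1)] by auto
    have "z \<oplus>\<^bsub>N\<^esub> y = x"
      by (rule inj_onD[OF \<phi>_inj]) (use x y z in \<open>auto simp: \<phi>_add N_add\<close>)
    then have "frag_of (1, x) - frag_of (1, z) - frag_of (1, y) \<in> tensor_rels S \<tau> P N"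
      unfolding tensor_rels_def using z y P_one by blast
    then have "(a - frag_of (1, x)) - (b - frag_of (1, y)) + (frag_of (1, x) - frag_of (1, z) - frag_of (1, y)) \<in> T"
      by (intro T_add[OF T_diff[OF x(2) y(2)]] T_rels)
    then have "a - b - frag_of (1, z) \<in> T" by (simp add: algebra_simps)
    with z show ?case by blast
  qed
qed

text \<open>A kernel element is congruent to some \<open>1 \<otimes> x\<close> with
  \<open>\<phi> x = 0\<close>, and injectivity gives \<open>x = 0\<close>.\<close>

lemma T_eq_kernel: "T = {c \<in> carrier F. frag_map c = 0}"
proof
  show "{c \<in> carrier F. frag_map c = 0} \<subseteq> T"
  proof clarify
    fix c assume c: "c \<in> carrier F" "frag_map c = 0"
    obtain x where x: "x \<in> carrier N" "c - frag_of (1, x) \<in> T" using reduce_tensor[OF c(1)] by blast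
    have "\<phi> x = \<phi> \<zero>\<^bsub>N\<^esub>"
      using frag_map_T[OF x(2)] c(2) by (simp add: frag_map_diff frag_map_of \<phi>_zero)
    then have "x = \<zero>\<^bsub>N\<^esub>" using \<phi>_inj x N_zero by (auto dest: inj_onD)
    then have "c - frag_of (1, x) + frag_of (1, x) \<in> T"
      by (intro T_add[OF x(2)]) (simp add: T_zero_tensor)
    then show "c \<in> T" by simp
  qed
qed (use T_sub frag_map_T in auto)

sublocale kernel_quotient F frag_map T
  by (intro kernel_quotient.intro kernel_quotient_axioms.intro group_F T_eq_kernel)
    (simp add: F_simps frag_map_add)

lemma frag_map_image: "frag_map ` carrier F = \<phi> ` carrier N"
proof
  show "frag_map ` carrier F \<subseteq> \<phi> ` carrier N"
  proof clarify
    fix c assume "c \<in> carrier F"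
    then obtain x where x: "x \<in> carrier N" "c - frag_of (1, x) \<in> T" using reduce_tensor by blast
    have "frag_map c = \<phi> x" using frag_map_T[OF x(2)] by (simp add: frag_map_diff frag_map_of)
    with x show "frag_map c \<in> \<phi> ` carrier N" by simp
  qed
  show "\<phi> ` carrier N \<subseteq> frag_map ` carrier F"
  proof clarify
    fix x assume "x \<in> carrier N"
    then show "\<phi> x \<in> frag_map ` carrier F"
      using P_one by (intro image_eqI[of _ _ "frag_of (1, x)"]) (auto simp: frag_map_of F_frag_of)
  qed
qed

lemma frag_smult:
  assumes "p \<in> carrier P" "c \<in> carrier F"
  shows "frag_extend (\<lambda>(q, x). frag_of (p \<otimes>\<^bsub>P\<^esub> q, x)) c \<in> carrier F"
    and "frag_map (frag_extend (\<lambda>(q, x). frag_of (p \<otimes>\<^bsub>P\<^esub> q, x)) c) = p * frag_map c"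
proof -
  have "keys c \<subseteq> carrier P \<times> carrier N" using assms by (simp add: F_carrier_iff)
  then have "frag_extend (\<lambda>(q, x). frag_of (p \<otimes>\<^bsub>P\<^esub> q, x)) c \<in> carrier F \<and>
    frag_map (frag_extend (\<lambda>(q, x). frag_of (p \<otimes>\<^bsub>P\<^esub> q, x)) c) = p * frag_map c"
    using assms(1)
    by (induction rule: frag_induction)
      (auto simp: frag_map_0 frag_map_of F_frag_of P_mult P_mult_closed frag_extend_diff
        frag_map_diff algebra_simps F_carrier_iff[of 0] intro: F_diff_closed)
  then show "frag_extend (\<lambda>(q, x). frag_of (p \<otimes>\<^bsub>P\<^esub> q, x)) c \<in> carrier F"
    "frag_map (frag_extend (\<lambda>(q, x). frag_of (p \<otimes>\<^bsub>P\<^esub> q, x)) c) = p * frag_map c" by auto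
qed

abbreviation "B \<equiv> base_change S \<tau> P N"

lemma base_change_simps:
  "carrier B = rcosets\<^bsub>F\<^esub> T" "ring.add B = set_mult F" "\<zero>\<^bsub>B\<^esub> = T"
  by (simp_all add: base_change_def)

lemma ind_pure_tensor:
  assumes "p \<in> carrier P" "x \<in> carrier N"
  shows "pure_tensor S \<tau> P N p x \<in> carrier B" "ind (pure_tensor S \<tau> P N p x) = p * \<phi> x"
  unfolding pure_tensor_def base_change_simps rcosets_eq
  using assms by (auto simp: ind_rcos F_frag_of frag_map_of)

lemma ind_smult:
  assumes p: "p \<in> carrier P" and C: "C \<in> carrier B"
  shows "p \<odot>\<^bsub>B\<^esub> C \<in> carrier B" "ind (p \<odot>\<^bsub>B\<^esub> C) = p * ind C"
proof -
  obtain c where c: "c \<in> carrier F" "C = T #>\<^bsub>F\<^esub> c" using C by (auto simp: base_change_simps rcosets_eq)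
  let ?\<sigma> = "frag_extend (\<lambda>(q, x). frag_of (p \<otimes>\<^bsub>P\<^esub> q, x))"
  have "p \<odot>\<^bsub>B\<^esub> C = T #>\<^bsub>F\<^esub> ?\<sigma> c"
    unfolding base_change_def c(2) using rcos_lift[OF c(1), of ?\<sigma> "\<lambda>y. p * y"] frag_smult[OF p]
    by simp
  then show "p \<odot>\<^bsub>B\<^esub> C \<in> carrier B" "ind (p \<odot>\<^bsub>B\<^esub> C) = p * ind C"
    using frag_smult[OF p c(1)] c by (auto simp: base_change_simps rcosets_eq ind_rcos)
qed

text \<open>The grading of the base change is generated by pure tensors, so its image only has to be
  compared on these.\<close>

lemma base_change_grading_image:
  assumes gG: "\<And>d. 0 \<in> gG d" "\<And>d x y. x \<in> gG d \<Longrightarrow> y \<in> gG d \<Longrightarrow> x + y \<in> gG d"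
      "\<And>d x. x \<in> gG d \<Longrightarrow> - x \<in> gG d"
    and gP: "\<And>d. gP d \<subseteq> carrier P" "1 \<in> gP 0"
    and gN: "\<And>d. gN d \<subseteq> carrier N" "\<And>d. \<phi> ` gN d = gG d"
    and mult: "\<And>a b p x. p \<in> gP a \<Longrightarrow> x \<in> gG b \<Longrightarrow> p * x \<in> gG (a + b)"
  shows "base_change_grading S \<tau> P gP N gN d \<subseteq> carrier B"
    and "ind ` base_change_grading S \<tau> P gP N gN d = gG d"
proof -
  let ?X = "{pure_tensor S \<tau> P N p x | p x. \<exists>a b. a + b = d \<and> p \<in> gP a \<and> x \<in> gN b}"
  \<comment> \<open>The additive structure of \<open>B\<close> is that of the factor group of
    \<open>F\<close> by \<open>T\<close>.\<close>
  have B_group: "group (add_monoid B)"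
    using comm_group.abelian_FactGroup[OF comm_group_F subgroup_T]
    unfolding comm_group_def Group.group_def Group.monoid_def group_axioms_def Units_def
      base_change_def FactGroup_def
    by simp
  interpret Bg: group "add_monoid B" by (rule B_group)
  have ind_T: "ind T = 0"
    using ind_rcos[of 0] by (simp add: frag_map_0 F_carrier_iff flip: rcos_one[unfolded F_simps])
  have ind_inv: "ind (inv\<^bsub>add_monoid B\<^esub> C) = - ind C" if "C \<in> carrier B" for C
  proof -
    have C: "C \<in> rcosets\<^bsub>F\<^esub> T" "inv\<^bsub>add_monoid B\<^esub> C \<in> rcosets\<^bsub>F\<^esub> T"
      using Bg.inv_closed[of C] that by (simp_all add: base_change_simps)
    have "(inv\<^bsub>add_monoid B\<^esub> C) <#>\<^bsub>F\<^esub> C = T"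
      using Bg.l_inv[of C] that by (simp add: base_change_simps)
    then have "ind (inv\<^bsub>add_monoid B\<^esub> C) + ind C = 0"
      using ind_mult(2)[OF C(2,1)] by (simp add: ind_T)
    then show ?thesis by (simp add: eq_neg_iff_add_eq_0)
  qed
  have X: "?X \<subseteq> {C \<in> carrier B. ind C \<in> gG d}"
  proof clarify
    fix p x a b assume "d = a + b" "p \<in> gP a" "x \<in> gN b"
    moreover from this have "p \<in> carrier P" "x \<in> carrier N" "\<phi> x \<in> gG b"
      using gP(1)[of a] gN(1)[of b] gN(2)[of b] by auto
    ultimately show "pure_tensor S \<tau> P N p x \<in> carrier B \<and> ind (pure_tensor S \<tau> P N p x) \<in> gG (a + b)"
      by (simp add: ind_pure_tensor mult)
  qed
  have "subgroup {C \<in> carrier B. ind C \<in> gG d} (add_monoid B)"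
  proof (rule Bg.subgroupI)
    show "{C \<in> carrier B. ind C \<in> gG d} \<noteq> {}" using ind_T Bg.one_closed gG by (auto simp: base_change_simps)
  next
    fix C assume "C \<in> {C \<in> carrier B. ind C \<in> gG d}"
    then show "inv\<^bsub>add_monoid B\<^esub> C \<in> {C \<in> carrier B. ind C \<in> gG d}"
      using ind_inv[of C] Bg.inv_closed[of C] gG by simp
  next
    fix C D assume "C \<in> {C \<in> carrier B. ind C \<in> gG d}" "D \<in> {C \<in> carrier B. ind C \<in> gG d}"
    then show "C \<otimes>\<^bsub>add_monoid B\<^esub> D \<in> {C \<in> carrier B. ind C \<in> gG d}"
      using ind_mult[of C D] Bg.m_closed[of C D] gG by (simp add: base_change_simps)
  qed auto
  then have sub: "base_change_grading S \<tau> P gP N gN d \<subseteq> {C \<in> carrier B. ind C \<in> gG d}"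
    unfolding base_change_grading_def by (intro Bg.generate_subgroup_incl X)
  then show "base_change_grading S \<tau> P gP N gN d \<subseteq> carrier B" by blast
  show "ind ` base_change_grading S \<tau> P gP N gN d = gG d"
  proof
    show "gG d \<subseteq> ind ` base_change_grading S \<tau> P gP N gN d"
    proof
      fix y assume "y \<in> gG d"
      then obtain x where x: "x \<in> gN d" "y = \<phi> x" using gN by blast
      \<comment> \<open>Since 1 has degree 0, the tensors \<open>1 \<otimes> x\<close> alone already
        exhaust \<open>gG d\<close>.\<close>
      have "pure_tensor S \<tau> P N 1 x \<in> ?X" using x gP by force
      then have "pure_tensor S \<tau> P N 1 x \<in> base_change_grading S \<tau> P gP N gN d"
        unfolding base_change_grading_def by (rule generate.incl)
      moreover have "ind (pure_tensor S \<tau> P N 1 x) = y"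
        using x gN P_one by (subst ind_pure_tensor) auto
      ultimately show "y \<in> ind ` base_change_grading S \<tau> P gP N gN d" by (metis imageI)
    qed
  qed (use sub in auto)
qed

end

section \<open>Gradings\<close>

lemma wdeg_UNIV_add: "wdeg UNIV (m + m') = wdeg UNIV m + wdeg UNIV m'"
proof -
  have *: "wdeg UNIV k = (\<Sum>v\<in>keys m \<union> keys m'. lookup k v)" if "keys k \<subseteq> keys m \<union> keys m'" for k
    unfolding wdeg_def using that by (intro sum.mono_neutral_left) (auto simp: in_keys_iff)
  show ?thesis
    using keys_add[of m m'] by (simp add: * lookup_add sum.distrib)
qed

lemma homogeneous_0 [simp]: "homogeneous d 0"
  by (simp add: homogeneous_def)

lemma homogeneous_neg: "homogeneous d p \<Longrightarrow> d < 0 \<Longrightarrow> p = 0"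
  by (auto simp: homogeneous_iff simp flip: keys_eq_empty)

lemma homogeneous_add: "homogeneous d p \<Longrightarrow> homogeneous d q \<Longrightarrow> homogeneous d (p + q)"
  using keys_add[of p q] by (auto simp: homogeneous_iff)

lemma homogeneous_uminus: "homogeneous d (p :: ('v, 'k::comm_ring_1) mp) \<Longrightarrow> homogeneous d (- p)"
  by (auto simp: homogeneous_iff in_keys_iff)

lemma homogeneous_mult:
  assumes "homogeneous d p" "homogeneous e q" shows "homogeneous (d + e) (p * q)"
  unfolding homogeneous_iff
proof
  fix m assume "m \<in> keys (p * q)"
  then obtain a b where "m = a + b" "a \<in> keys p" "b \<in> keys q"
    using keys_mult[of p q] by blast
  with assms show "int (wdeg UNIV m) = d + e"
    by (simp add: homogeneous_iff wdeg_UNIV_add)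
qed

lemma homogeneous_const: "homogeneous 0 (mp_const c)"
  by (simp add: homogeneous_iff mp_const_def wdeg_def)

lemma homogeneous_const_mult: "homogeneous d p \<Longrightarrow> homogeneous d (mp_const c * p)"
  using homogeneous_mult[OF homogeneous_const, of d p] by simp

lemma homogeneous_1: "homogeneous 0 (1 :: ('v, 'k::comm_ring_1) mp)"
  using homogeneous_const[of 1] by simp

lemma homogeneous_sum: "(\<And>i. i \<in> A \<Longrightarrow> homogeneous d (f i)) \<Longrightarrow> homogeneous d (sum f A)"
  by (induction A rule: infinite_finite_induct) (auto intro: homogeneous_add)

lemma homogeneous_var_power: "homogeneous (int k) (mp_var v ^ k)"
proof (induction k)
  case (Suc k)
  have "homogeneous 1 (mp_var v :: ('a, 'b) mp)"
    by (auto simp: homogeneous_iff mp_var_def wdeg_def)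
  from homogeneous_mult[OF this Suc] show ?case by simp
qed (simp add: homogeneous_1)

lemma homogeneous_monomial:
  "finite A \<Longrightarrow> homogeneous (int (\<Sum>j\<in>A. e j)) (\<Prod>j\<in>A. mp_var j ^ e j)"
  by (induction A rule: finite_induct)
    (auto intro: homogeneous_1 homogeneous_mult homogeneous_var_power)

lemma homogeneous_scale:
  assumes "homogeneous (int k) p"
  shows "mp_at (\<lambda>v. t * \<rho> v) p = t ^ k * mp_at \<rho> p"
proof -
  have "(\<lambda>v. t * \<rho> v) = scale_on UNIV t \<rho>" by (simp add: scale_on_def)
  then show ?thesis
    using assms by (auto simp: mp_eval_eq monom_val_scale_on homogeneous_iff sum_distrib_left mult_ac intro!: sum.cong)
qed

section \<open>Linear spans over \<open>K\<close>\<close>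

lemma k_span_incl: "b \<in> B \<Longrightarrow> b \<in> k_span B"
  unfolding k_span_def by (auto intro!: exI[of _ "{b}"] exI[of _ "\<lambda>_. 1"])

lemma k_span_0: "0 \<in> k_span B"
  unfolding k_span_def by (auto intro!: exI[of _ "{}"])

lemma k_span_const_mult: "x \<in> k_span B \<Longrightarrow> mp_const c * x \<in> k_span B"
proof -
  assume "x \<in> k_span B"
  then obtain F d where F: "finite F" "F \<subseteq> B" "x = (\<Sum>b\<in>F. mp_const (d b) * b)"
    unfolding k_span_def by blast
  then have "mp_const c * x = (\<Sum>b\<in>F. mp_const (c * d b) * b)"
    by (simp add: sum_distrib_left mp_const_mult mult.assoc)
  then show ?thesis using F(1,2) unfolding k_span_def
    by (intro CollectI exI[of _ F] exI[of _ "\<lambda>b. c * d b"]) auto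
qed

lemma k_span_add: "x \<in> k_span B \<Longrightarrow> y \<in> k_span B \<Longrightarrow> x + y \<in> k_span B"
proof -
  assume "x \<in> k_span B" "y \<in> k_span B"
  then obtain F c G d where F: "finite F" "F \<subseteq> B" "x = (\<Sum>b\<in>F. mp_const (c b) * b)"
    and G: "finite G" "G \<subseteq> B" "y = (\<Sum>b\<in>G. mp_const (d b) * b)"
    unfolding k_span_def by blast
  let ?c = "\<lambda>b. if b \<in> F then c b else 0" and ?d = "\<lambda>b. if b \<in> G then d b else 0"
  have "x = (\<Sum>b\<in>F \<union> G. mp_const (?c b) * b)"
    unfolding F(3) using F(1) G(1) by (intro sum.mono_neutral_cong_left) auto
  moreover have "y = (\<Sum>b\<in>F \<union> G. mp_const (?d b) * b)"
    unfolding G(3) using F(1) G(1) by (intro sum.mono_neutral_cong_left) auto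
  ultimately have "x + y = (\<Sum>b\<in>F \<union> G. mp_const (?c b + ?d b) * b)"
    by (simp only: mp_const_add distrib_right sum.distrib)
  then show ?thesis using F(1,2) G(1,2) unfolding k_span_def
    by (intro CollectI exI[of _ "F \<union> G"] exI[of _ "\<lambda>b. ?c b + ?d b"]) auto
qed

lemma k_span_sum: "(\<And>i. i \<in> A \<Longrightarrow> f i \<in> k_span B) \<Longrightarrow> sum f A \<in> k_span B"
  by (induction A rule: infinite_finite_induct) (auto intro: k_span_0 k_span_add)

lemma k_span_subset:
  assumes "B \<subseteq> W" "0 \<in> W" "\<And>x y. x \<in> W \<Longrightarrow> y \<in> W \<Longrightarrow> x + y \<in> W" "\<And>c x. x \<in> W \<Longrightarrow> mp_const c * x \<in> W"
  shows "k_span B \<subseteq> W"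
proof
  fix x assume "x \<in> k_span B"
  then obtain F c where F: "finite F" "F \<subseteq> B" "x = (\<Sum>b\<in>F. mp_const (c b) * b)"
    unfolding k_span_def by blast
  have "(\<Sum>b\<in>F. mp_const (c b) * b) \<in> W"
    using F(1,2) by (induction F rule: finite_induct) (use assms in auto)
  then show "x \<in> W" using F by simp
qed

section \<open>\<open>PL(n)\<close> and \<open>m^gg\<close> as images of polynomials in the
  \<open>Y_i\<close>\<close>

lemma tau_const [simp]: "tau n (mp_const c) = mp_const c"
  by (simp add: tau_def mp_const.mp_eval_const)

lemma tau_var: "tau n (mp_var i) = minor_M n i"
  by (simp add: tau_def mp_const.mp_eval_var)

lemma tau_monomial: "tau n (\<Prod>j\<le>n. mp_var j ^ e j) = (\<Prod>j\<le>n. minor_M n j ^ e j)"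
  by (simp add: tau.hom_prod tau.hom_power tau_var)

lemma tau_sum_monomials:
  assumes "s \<in> carrier (coord_ring n)"
  shows "tau n s = (\<Sum>m\<in>keys s. mp_const (lookup s m) * (\<Prod>j\<le>n. minor_M n j ^ lookup m j))"
  unfolding tau_def mp_eval_eq using assms
  by (intro sum.cong refl arg_cong2[of _ _ _ _ "(*)"] monom_val_superset) (auto simp: mpoly_carrier_iff)

lemma sum_exponents:
  assumes "s \<in> carrier (coord_ring n)" "m \<in> keys s"
  shows "(\<Sum>j\<le>n. lookup m j) = wdeg UNIV m"
proof -
  have "keys m \<subseteq> {..n}" using assms by (auto simp: mpoly_carrier_iff)
  then show ?thesis
    unfolding wdeg_def by (intro sum.mono_neutral_right) (auto simp: in_keys_iff)
qed

lemma PL_simps [simp]: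
  "ring.zero (PL n) = 0" "ring.add (PL n) = (+)" "monoid.mult (PL n) = (*)" "monoid.one (PL n) = 1"
  by (simp_all add: PL_def KA_eq mpoly_ring_def)

text \<open>The homomorphism \<open>tau n\<close> sends generators to generators. This is the
  surjectivity on which the base change rests.\<close>

lemma PL_carrier:
  fixes n :: nat
  assumes n: "n \<ge> 1"
  shows "carrier (PL n) = tau n ` carrier (coord_ring n :: (nat, 'k::field) mp ring)"
proof
  interpret K: cring "KA n :: (xavar, 'k) mp ring" unfolding KA_eq by (rule cring_mpoly_ring)
  let ?H = "range mp_const \<union> minor_M n ` {..n} :: (xavar, 'k) mp set"
  have H: "?H \<subseteq> carrier (KA n)"
    using minor_M_carrier[OF n] by (auto simp: KA_eq)
  have PL: "carrier (PL n) = generate_ring (KA n) ?H" by (simp add: PL_def)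
  show "carrier (PL n) \<subseteq> tau n ` carrier (coord_ring n :: (nat, 'k) mp ring)"
  proof
    fix x :: "(xavar, 'k) mp" assume "x \<in> carrier (PL n)"
    then have "x \<in> generate_ring (KA n) ?H" by (simp add: PL)
    then show "x \<in> tau n ` carrier (coord_ring n)"
    proof (induction rule: generate_ring.induct)
      case one
      show ?case by (intro image_eqI[of _ _ 1]) (auto simp: KA_eq)
    next
      case (incl h)
      then show ?case
      proof
        assume "h \<in> range mp_const"
        then obtain c where "h = tau n (mp_const c)" by auto
        then show ?thesis by blast
      next
        assume "h \<in> minor_M n ` {..n}"
        then obtain i where "i \<le> n" "h = tau n (mp_var i)" by (auto simp: tau_var)
        then show ?thesis by auto
      qed
    next
      case (a_inv h)
      then obtain s where s: "s \<in> carrier (coord_ring n)" "h = tau n s" by blast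
      then have "\<ominus>\<^bsub>KA n\<^esub> h = tau n (- s)"
        using tau_carrier[OF n s(1)] by (simp add: KA_eq a_inv_mpoly_ring tau.hom_uminus)
      then show ?case using s by auto
    next
      case (eng_add h1 h2)
      then obtain s1 s2 where "s1 \<in> carrier (coord_ring n)" "h1 = tau n s1"
        "s2 \<in> carrier (coord_ring n)" "h2 = tau n s2" by blast
      then show ?case by (auto simp: KA_eq tau.hom_add[symmetric])
    next
      case (eng_mult h1 h2)
      then obtain s1 s2 where "s1 \<in> carrier (coord_ring n)" "h1 = tau n s1"
        "s2 \<in> carrier (coord_ring n)" "h2 = tau n s2" by blast
      then show ?case by (auto simp: KA_eq tau.hom_mult[symmetric])
    qed
  qed
  show "tau n ` carrier (coord_ring n) \<subseteq> carrier (PL n :: (xavar, 'k) mp ring)"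
  proof clarify
    fix s :: "(nat, 'k) mp" assume "s \<in> carrier (coord_ring n)"
    then show "tau n s \<in> carrier (PL n)"
      unfolding PL
    proof (induction rule: mpoly_ring_induct)
      case (add p q)
      then show ?case using generate_ring.eng_add[of "tau n p" "KA n" ?H "tau n q"]
        by (simp add: tau.hom_add KA_eq)
    next
      case (mult p q)
      then show ?case using generate_ring.eng_mult[of "tau n p" "KA n" ?H "tau n q"]
        by (simp add: tau.hom_mult KA_eq)
    qed (auto simp: tau_var intro: generate_ring.incl)
  qed
qed

lemma PL_closed:
  fixes p q :: "(xavar, 'k::field) mp"
  assumes "n \<ge> 1" "p \<in> carrier (PL n)" "q \<in> carrier (PL n)"
  shows "p + q \<in> carrier (PL n)" "p * q \<in> carrier (PL n)" "- p \<in> carrier (PL n)"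
proof -
  obtain s t where st: "s \<in> carrier (coord_ring n)" "t \<in> carrier (coord_ring n)"
    "p = tau n s" "q = tau n t" using assms by (auto simp: PL_carrier)
  then show "p + q \<in> carrier (PL n)" "p * q \<in> carrier (PL n)" "- p \<in> carrier (PL n)"
    using assms(1) by (auto simp: PL_carrier tau.hom_add[symmetric] tau.hom_mult[symmetric] tau.hom_uminus[symmetric])
qed

lemma PL_const: "n \<ge> 1 \<Longrightarrow> mp_const c \<in> carrier (PL n)"
  unfolding PL_carrier by (intro image_eqI[of _ _ "mp_const c"]) auto

lemma PL_0_1: "n \<ge> 1 \<Longrightarrow> 0 \<in> carrier (PL n)" "n \<ge> 1 \<Longrightarrow> 1 \<in> carrier (PL n)"
  using PL_const[of n 0] PL_const[of n 1] by auto

lemma cring_PL: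
  assumes "n \<ge> 1" shows "cring (PL n :: (xavar, 'k::field) mp ring)"
proof (rule cringI)
  let ?R = "PL n :: (xavar, 'k) mp ring"
  show "abelian_group ?R"
  proof (rule abelian_groupI)
    fix x assume "x \<in> carrier ?R"
    then show "\<exists>y\<in>carrier ?R. y \<oplus>\<^bsub>?R\<^esub> x = \<zero>\<^bsub>?R\<^esub>"
      using assms PL_closed by (intro bexI[of _ "-x"]) auto
  qed (use assms PL_closed PL_0_1 in \<open>auto simp: algebra_simps\<close>)
  show "Group.comm_monoid ?R"
    by (rule comm_monoidI) (use assms PL_closed PL_0_1 in \<open>auto simp: algebra_simps\<close>)
qed (auto simp: algebra_simps)

text \<open>Degrees in \<open>PL(n)\<close> are read on preimages, so that products and sums can be
  handled with homogeneous polynomials in \<open>S\<close>.\<close>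

lemma PL_grading_eq: "PL_grading n d = tau n ` {s \<in> carrier (coord_ring n). homogeneous d s}"
  (is "_ = ?W")
proof
  have WI: "tau n s \<in> ?W" if "s \<in> carrier (coord_ring n)" "homogeneous d s" for s :: "(nat, 'a) mp"
    using that by blast
  show "PL_grading n d \<subseteq> ?W"
    unfolding PL_grading_def
  proof (rule k_span_subset)
    show "{\<Prod>j\<le>n. minor_M n j ^ e j | e. int (\<Sum>j\<le>n. e j) = d} \<subseteq> ?W"
    proof clarify
      fix e :: "nat \<Rightarrow> nat"
      have "tau n (\<Prod>j\<le>n. mp_var j ^ e j) \<in> tau n ` {s \<in> carrier (coord_ring n). homogeneous (int (\<Sum>j\<le>n. e j)) (s :: (nat, 'a) mp)}"
        by (intro imageI CollectI conjI homogeneous_monomial mpoly_carrier_prod mpoly_carrier_power mpoly_carrier_var) auto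
      then show "(\<Prod>j\<le>n. minor_M n j ^ e j) \<in> tau n ` {s \<in> carrier (coord_ring n). homogeneous (int (\<Sum>j\<le>n. e j)) (s :: (nat, 'a) mp)}"
        by (simp only: tau_monomial)
    qed
    show "0 \<in> ?W" using WI[of 0] by simp
    show "x + y \<in> ?W" if xy: "x \<in> ?W" "y \<in> ?W" for x y
    proof -
      obtain s t where "s \<in> carrier (coord_ring n)" "homogeneous d s" "t \<in> carrier (coord_ring n)"
        "homogeneous d t" "x = tau n s" "y = tau n t" using xy by blast
      then show ?thesis using WI[of "s + t"] by (auto simp: tau.hom_add homogeneous_add)
    qed
    show "mp_const c * x \<in> ?W" if x: "x \<in> ?W" for c x
    proof -
      obtain s where "s \<in> carrier (coord_ring n)" "homogeneous d s" "x = tau n s" using x by blast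
      then show ?thesis using WI[of "mp_const c * s"]
        by (auto simp: tau.hom_mult intro: homogeneous_const_mult)
    qed
  qed
  show "?W \<subseteq> PL_grading n d"
  proof clarify
    fix s :: "(nat, 'a) mp" assume s: "s \<in> carrier (coord_ring n)" "homogeneous d s"
    show "tau n s \<in> PL_grading n d"
      unfolding PL_grading_def tau_sum_monomials[OF s(1)]
    proof (intro k_span_sum k_span_const_mult k_span_incl CollectI)
      fix m assume "m \<in> keys s"
      then show "\<exists>e. (\<Prod>j\<le>n. minor_M n j ^ lookup m j) = (\<Prod>j\<le>n. minor_M n j ^ e j) \<and> int (\<Sum>j\<le>n. e j) = d"
        using s sum_exponents[OF s(1)] by (intro exI[of _ "lookup m"]) (auto simp: homogeneous_iff)
    qed
  qed
qed

lemma m_gg_eq: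
  assumes "n \<ge> 1"
  shows "m_gg n = F_poly n ` {f. \<forall>i\<le>n. f i \<in> carrier (coord_ring n)}" (is "?M = F_poly n ` ?C")
proof
  show "?M \<subseteq> F_poly n ` ?C"
  proof
    fix x :: "(xavar, 'a) mp" assume "x \<in> m_gg n"
    then obtain p where p: "\<forall>i\<le>n. p i \<in> carrier (PL n)" "x = (\<Sum>i\<le>n. p i * mp_var (XV i))"
      by (auto simp: m_gg_def)
    then have "\<forall>i. \<exists>s. i \<le> n \<longrightarrow> s \<in> carrier (coord_ring n) \<and> p i = tau n s"
      using assms by (auto simp: PL_carrier)
    then obtain f where f: "\<And>i. i \<le> n \<Longrightarrow> f i \<in> carrier (coord_ring n) \<and> p i = tau n (f i)" by metis
    then have "x = F_poly n f" by (auto simp: p F_poly_def mult.commute intro!: sum.cong)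
    with f show "x \<in> F_poly n ` ?C" by blast
  qed
  show "F_poly n ` ?C \<subseteq> ?M"
  proof clarify
    fix f :: "nat \<Rightarrow> (nat, 'a) mp" assume f: "\<forall>i\<le>n. f i \<in> carrier (coord_ring n)"
    then show "F_poly n f \<in> m_gg n"
      unfolding m_gg_def F_poly_def using assms
      by (intro CollectI exI[of _ "\<lambda>i. tau n (f i)"]) (auto simp: PL_carrier mult.commute)
  qed
qed

lemma F_poly_uminus: "F_poly n (\<lambda>i. - f i) = - F_poly n f"
  by (simp add: F_poly_def tau.hom_uminus sum_negf)

lemma F_poly_0: "F_poly n (\<lambda>_. 0) = 0"
  by (simp add: F_poly_def)

lemma F_poly_sum: "F_poly n (\<lambda>i. \<Sum>k\<in>A. g k i) = (\<Sum>k\<in>A. F_poly n (g k))"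
  unfolding F_poly_def by (simp add: tau.hom_sum sum_distrib_left) (rule sum.swap)

text \<open>The factor \<open>X_i\<close> contributes one degree, whence \<open>d - 1\<close> for
  the coefficients; this is the source of the twist.\<close>

lemma m_gg_grading_eq:
  "m_gg_grading n d = F_poly n ` {f. \<forall>i\<le>n. f i \<in> carrier (coord_ring n) \<and> homogeneous (d - 1) (f i)}"
  (is "_ = F_poly n ` ?C")
proof
  show "m_gg_grading n d \<subseteq> F_poly n ` ?C"
    unfolding m_gg_grading_def
  proof (rule k_span_subset)
    show "{mp_var (XV i) * (\<Prod>j\<le>n. minor_M n j ^ e j) | i e. i \<le> n \<and> int (\<Sum>j\<le>n. e j) = d - 1} \<subseteq> F_poly n ` ?C"
    proof clarify
      fix i and e :: "nat \<Rightarrow> nat" assume ie: "i \<le> n" "int (\<Sum>j\<le>n. e j) = d - 1"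
      let ?f = "\<lambda>k. if k = i then (\<Prod>j\<le>n. mp_var j ^ e j) else (0 :: (nat, 'a) mp)"
      have "F_poly n ?f = (\<Sum>k\<in>{i}. mp_var (XV k) * (\<Prod>j\<le>n. minor_M n j ^ e j))"
        unfolding F_poly_def using ie(1)
        by (intro sum.mono_neutral_cong_right) (auto simp: tau_monomial)
      moreover have "homogeneous (d - 1) (\<Prod>j\<le>n. mp_var j ^ e j :: (nat, 'a) mp)"
        using homogeneous_monomial[of "{..n}" e] ie(2) by simp
      then have "?f \<in> ?C"
        by (auto intro!: mpoly_carrier_prod mpoly_carrier_power mpoly_carrier_var)
      ultimately show "mp_var (XV i) * (\<Prod>j\<le>n. minor_M n j ^ e j) \<in> F_poly n ` ?C"
        by (intro image_eqI[of _ _ ?f]) auto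
    qed
    show "0 \<in> F_poly n ` ?C" by (intro image_eqI[of _ _ "\<lambda>_. 0"]) (auto simp: F_poly_0)
    show "x + y \<in> F_poly n ` ?C" if xy: "x \<in> F_poly n ` ?C" "y \<in> F_poly n ` ?C" for x y
    proof -
      obtain f g where "f \<in> ?C" "g \<in> ?C" "x = F_poly n f" "y = F_poly n g" using xy by blast
      then show ?thesis
        by (intro image_eqI[of _ _ "\<lambda>i. f i + g i"]) (auto simp: F_poly_add intro: homogeneous_add)
    qed
    show "mp_const c * x \<in> F_poly n ` ?C" if x: "x \<in> F_poly n ` ?C" for c x
    proof -
      obtain f where "f \<in> ?C" "x = F_poly n f" using x by blast
      then show ?thesis
        by (intro image_eqI[of _ _ "\<lambda>i. mp_const c * f i"]) (auto simp: F_poly_mult intro: homogeneous_const_mult)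
    qed
  qed
  show "F_poly n ` ?C \<subseteq> m_gg_grading n d"
  proof clarify
    fix f :: "nat \<Rightarrow> (nat, 'a) mp"
    assume f: "\<forall>i\<le>n. f i \<in> carrier (coord_ring n) \<and> homogeneous (d - 1) (f i)"
    have "mp_var (XV i) * tau n (f i) \<in> m_gg_grading n d" if i: "i \<le> n" for i
    proof -
      have fi: "f i \<in> carrier (coord_ring n)" "homogeneous (d - 1) (f i)" using f i by auto
      have "mp_var (XV i) * tau n (f i) = (\<Sum>m\<in>keys (f i). mp_const (lookup (f i) m) *
          (mp_var (XV i) * (\<Prod>j\<le>n. minor_M n j ^ lookup m j)))"
        by (simp add: tau_sum_monomials[OF fi(1)] sum_distrib_left mult_ac)
      also have "\<dots> \<in> m_gg_grading n d"
        unfolding m_gg_grading_def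
      proof (intro k_span_sum k_span_const_mult k_span_incl CollectI)
        fix m assume "m \<in> keys (f i)"
        then show "\<exists>i' e. mp_var (XV i) * (\<Prod>j\<le>n. minor_M n j ^ lookup m j) =
            mp_var (XV i') * (\<Prod>j\<le>n. minor_M n j ^ e j) \<and> i' \<le> n \<and> int (\<Sum>j\<le>n. e j) = d - 1"
          using fi i sum_exponents[OF fi(1)]
          by (intro exI[of _ i] exI[of _ "lookup m"]) (auto simp: homogeneous_iff)
      qed
      finally show ?thesis .
    qed
    then show "F_poly n f \<in> m_gg_grading n d"
      unfolding F_poly_def m_gg_grading_def by (intro k_span_sum) auto
  qed
qed

section \<open>The graded module of tangent fields\<close>

text \<open>A common parameter set: \<open>D(A_Z)\<close> is its image under \<open>theta n\<close>
  and \<open>I^gg(Z)\<close> its image under \<open>F_poly n\<close>. Values beyond index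
  \<open>n\<close> are left free, since neither map sees them.\<close>

definition tangent_fields :: "nat \<Rightarrow> 'k::field vec set set \<Rightarrow> (nat \<Rightarrow> (nat, 'k) mp) set" where
  "tangent_fields n Z = {f. (\<forall>i\<le>n. f i \<in> carrier (coord_ring n)) \<and> tangent n Z f}"

definition tangent_fields_deg ::
  "nat \<Rightarrow> 'k::field vec set set \<Rightarrow> int \<Rightarrow> (nat \<Rightarrow> (nat, 'k) mp) set" where
  "tangent_fields_deg n Z d = {f \<in> tangent_fields n Z. \<forall>i\<le>n. homogeneous d (f i)}"

lemma tangent_fields_add:
  "f \<in> tangent_fields n Z \<Longrightarrow> g \<in> tangent_fields n Z \<Longrightarrow> (\<lambda>i. f i + g i) \<in> tangent_fields n Z"
  by (auto simp: tangent_fields_def tangent_def ev.hom_add algebra_simps sum.distrib)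

lemma tangent_fields_0: "(\<lambda>_. 0) \<in> tangent_fields n Z"
  by (auto simp: tangent_fields_def tangent_def)

lemma tangent_fields_mult:
  assumes "s \<in> carrier (coord_ring n)" "f \<in> tangent_fields n Z"
  shows "(\<lambda>i. s * f i) \<in> tangent_fields n Z"
proof -
  have "(\<Sum>i\<le>n. v $ i * mp_at w (s * f i)) = mp_at w s * (\<Sum>i\<le>n. v $ i * mp_at w (f i))" for v w
    by (simp add: ev.hom_mult sum_distrib_left mult_ac)
  then show ?thesis using assms by (auto simp: tangent_fields_def tangent_def)
qed

lemma tangent_fields_uminus: "f \<in> tangent_fields n Z \<Longrightarrow> (\<lambda>i. - f i) \<in> tangent_fields n Z"
  using tangent_fields_mult[of "- 1" n f Z] mpoly_carrier_uminus[OF mpoly_carrier_1, of "{..n}"] by simp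

text \<open>The Euler field at \<open>w\<close> is \<open>w\<close> itself, which lies in every
  hyperplane through \<open>w\<close>.\<close>

lemma tangent_fields_euler_multiple:
  assumes "g \<in> carrier (coord_ring n)"
  shows "(\<lambda>i. g * mp_var i) \<in> tangent_fields n Z"
  using assms
  by (intro tangent_fields_mult)
    (auto simp: tangent_fields_def tangent_def mp_at_var intro!: mpoly_carrier_var)

text \<open>A linear hyperplane is closed under scaling, so the sum of the \<open>v_i f_i\<close>
  vanishes at all \<open>t w\<close>, and hence each of its homogeneous components vanishes at
  \<open>w\<close>.\<close>

lemma hcomp_tangent_fields:
  fixes f :: "nat \<Rightarrow> (nat, 'k::{field,infinite}) mp"
  assumes "f \<in> tangent_fields n Z"
  shows "(\<lambda>i. hcomp k (f i)) \<in> tangent_fields n Z"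
proof -
  have "(\<Sum>i\<le>n. v $ i * mp_at w (hcomp k (f i))) = 0"
    if L: "L \<in> Z" "v \<in> L" and orth: "(\<Sum>i\<le>n. v $ i * w i) = 0" for L v w
  proof -
    let ?h = "\<Sum>i\<le>n. mp_const (v $ i) * f i"
    have lookup_const: "lookup (mp_const c * p) m = c * lookup p m" for c p and m :: "nat \<Rightarrow>\<^sub>0 nat"
      by (induction p rule: mp_induct)
        (auto simp: mp_const_def mult_single lookup_single lookup_add when_def algebra_simps)
    have "(\<Sum>i\<le>n. v $ i * (t * w i)) = t * (\<Sum>i\<le>n. v $ i * w i)" for t
      by (simp add: sum_distrib_left mult_ac)
    then have "mp_at (scale_on UNIV t w) ?h = 0" for t
      using assms L orth
      by (simp add: ev.hom_sum ev.hom_mult mp_at_const tangent_fields_def tangent_def scale_on_def)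
    then have "mp_at w (hcomp k ?h) = 0"
      unfolding hcomp_def by (rule mp_at_wdeg_component_zero)
    also have "hcomp k ?h = (\<Sum>i\<le>n. mp_const (v $ i) * hcomp k (f i))"
      by (rule poly_mapping_eqI) (simp add: hcomp_def lookup_mp_filter lookup_sum lookup_const)
    finally show ?thesis by (simp add: ev.hom_sum ev.hom_mult mp_at_const)
  qed
  then show ?thesis
    using assms by (auto simp: tangent_fields_def tangent_def hcomp_carrier)
qed

section \<open>\<open>I^gg(Z)\<close> as a graded module over \<open>PL(n)\<close>\<close>

lemma gg_simps:
  "ring.zero (gg n J) = 0" "ring.add (gg n J) = (+)" "module.smult (gg n J) = (*)"
  by (simp_all add: gg_def)

lemma gg_carrier:
  fixes Z :: "'k::{field,infinite} vec set set"
  assumes "n \<ge> 1" "Z \<subseteq> proj_space n"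
  shows "carrier (gg n (vanishing_ideal n Z)) = F_poly n ` tangent_fields n Z"
  unfolding gg_def m_gg_eq[OF assms(1)] tangent_fields_def
  using F_poly_in_ext_ideal_iff[OF assms] by auto

lemma gg_grading_eq:
  fixes Z :: "'k::{field,infinite} vec set set"
  assumes "n \<ge> 1" "Z \<subseteq> proj_space n"
  shows "gg_grading n (vanishing_ideal n Z) d = F_poly n ` tangent_fields_deg n Z (d - 1)"
  unfolding gg_grading_def m_gg_grading_eq tangent_fields_deg_def tangent_fields_def
  using F_poly_in_ext_ideal_iff[OF assms] by auto

text \<open>The factor \<open>X_i\<close> scales by \<open>t\<close> and a form of degree
  \<open>d - 1\<close> in the minors by \<open>t^(d-1)\<close>. For nonpositive \<open>d\<close> the
  coefficients have negative degree and vanish, so truncation by \<open>nat\<close> does no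
  harm.\<close>

lemma gg_grading_scale:
  assumes n: "n \<ge> 1" and x: "x \<in> m_gg_grading n d"
  shows "mp_at (xa_point (\<lambda>i. t * v i) a) x = t ^ nat d * mp_at (xa_point v a) x"
    and "d \<le> 0 \<Longrightarrow> x = 0"
proof -
  obtain f where f: "\<And>i. i \<le> n \<Longrightarrow> homogeneous (d - 1) (f i)" "x = F_poly n f"
    using x by (auto simp: m_gg_grading_eq)
  show zero: "x = 0" if "d \<le> 0"
    using that homogeneous_neg[OF f(1)] by (simp add: f(2) F_poly_def)
  show "mp_at (xa_point (\<lambda>i. t * v i) a) x = t ^ nat d * mp_at (xa_point v a) x"
  proof (cases "d \<le> 0")
    case False
    have "mp_at (cross n (\<lambda>i. t * v i) a) (f i) = t ^ nat (d - 1) * mp_at (cross n v a) (f i)"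
      if "i \<le> n" for i
    proof -
      have "cross n (\<lambda>i. t * v i) a = (\<lambda>i. t * cross n v a i)"
        using cross_scale[OF n, of t v a] by (rule ext)
      then show ?thesis
        using homogeneous_scale[of "nat (d - 1)" "f i" t "cross n v a"] f(1)[OF that] False by simp
    qed
    moreover have "t ^ nat d = t * t ^ nat (d - 1)"
      using False by (simp add: nat_diff_distrib flip: power_Suc)
    ultimately show ?thesis
      by (simp add: f(2) mp_at_F_poly sum_distrib_left mult_ac)
  qed (use zero in simp)
qed

text \<open>By the scaling law a sum of elements of distinct degrees is, along \<open>(tv, a)\<close>, a polynomial in
  \<open>t\<close> whose coefficients are the values of the summands.\<close>

lemma m_gg_grading_independent:
  fixes c :: "int \<Rightarrow> (xavar, 'k::{field,infinite}) mp"
  assumes n: "n \<ge> 1" and "finite A" and c: "\<And>d. c d \<in> m_gg_grading n d"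
    and sum: "(\<Sum>d\<in>A. c d) = 0" and d: "d \<in> A"
  shows "c d = 0"
proof (cases "d \<le> 0")
  case True
  then show ?thesis using gg_grading_scale(2)[OF n c] by blast
next
  case False
  show ?thesis
  proof (rule mp_eq_zeroI)
    fix \<rho> :: "xavar \<Rightarrow> 'k"
    obtain v a where \<rho>: "\<rho> = xa_point v a" by (rule xa_point_cases)
    let ?q = "\<Sum>e\<in>A. Polynomial.monom (mp_at \<rho> (c e)) (nat e)"
    have "poly ?q t = mp_at (xa_point (\<lambda>i. t * v i) a) (\<Sum>e\<in>A. c e)" for t
      unfolding ev.hom_sum gg_grading_scale(1)[OF n c]
      by (simp add: poly_sum poly_monom \<rho> mult.commute)
    then have "poly ?q t = 0" for t by (simp add: sum)
    then have "?q = 0" by (rule poly_all_zero)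
    then have "0 = Polynomial.coeff ?q (nat d)" by simp
    also have "\<dots> = (\<Sum>e\<in>A. if nat e = nat d then mp_at \<rho> (c e) else 0)"
      by (simp add: coeff_sum)
    also have "\<dots> = (\<Sum>e\<in>A. if e = d then mp_at \<rho> (c e) else 0)"
    proof (rule sum.cong)
      fix e
      \<comment> \<open>\<open>nat\<close> sends all nonpositive degrees to 0, so exponents separate
        degrees only because \<open>d\<close> is positive here.\<close>
      have "nat e = nat d \<longleftrightarrow> e = d" using False by linarith
      then show "(if nat e = nat d then mp_at \<rho> (c e) else 0) = (if e = d then mp_at \<rho> (c e) else 0)"
        by (simp only:)
    qed simp
    also have "\<dots> = mp_at \<rho> (c d)" using d \<open>finite A\<close> by simp
    finally show "mp_at \<rho> (c d) = 0" by (rule sym)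
  qed
qed

lemma finsum_gg:
  assumes "abelian_monoid (gg n J)" "\<And>d. d \<in> A \<Longrightarrow> c d \<in> carrier (gg n J)" "finite A"
  shows "finsum (gg n J) c A = sum c A"
proof -
  interpret abelian_monoid "gg n J" by fact
  show ?thesis using assms(3,2)
  proof (induction A rule: finite_induct)
    case (insert d A)
    then have "finsum (gg n J) c (insert d A) = c d \<oplus>\<^bsub>gg n J\<^esub> finsum (gg n J) c A"
      by (intro finsum_insert) auto
    with insert show ?case by (simp add: gg_simps)
  qed (simp add: gg_simps)
qed

context
  fixes n :: nat and Z :: "'k::{field,infinite} vec set set"
  assumes n: "n \<ge> 1" and Z: "Z \<subseteq> proj_space n"
begin

abbreviation "G \<equiv> gg n (vanishing_ideal n Z)"
abbreviation "gG \<equiv> gg_grading n (vanishing_ideal n Z)"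

lemmas G_carrier = gg_carrier[OF n Z]
lemmas gG_eq = gg_grading_eq[OF n Z]

lemma G_closed:
  "0 \<in> carrier G" "x \<in> carrier G \<Longrightarrow> y \<in> carrier G \<Longrightarrow> x + y \<in> carrier G"
  "x \<in> carrier G \<Longrightarrow> - x \<in> carrier G" "p \<in> carrier (PL n) \<Longrightarrow> x \<in> carrier G \<Longrightarrow> p * x \<in> carrier G"
proof -
  have "0 \<in> F_poly n ` tangent_fields n Z"
    using imageI[OF tangent_fields_0, of "F_poly n"] by (simp add: F_poly_0)
  then show "0 \<in> carrier G" "x \<in> carrier G \<Longrightarrow> y \<in> carrier G \<Longrightarrow> x + y \<in> carrier G"
    "x \<in> carrier G \<Longrightarrow> - x \<in> carrier G" "p \<in> carrier (PL n) \<Longrightarrow> x \<in> carrier G \<Longrightarrow> p * x \<in> carrier G"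
    unfolding G_carrier PL_carrier[OF n]
    by (auto simp: F_poly_add[symmetric] F_poly_uminus[symmetric] F_poly_mult[symmetric]
        intro!: imageI tangent_fields_add tangent_fields_uminus tangent_fields_mult)
qed

lemma gG_closed:
  "0 \<in> gG d" "x \<in> gG d \<Longrightarrow> y \<in> gG d \<Longrightarrow> x + y \<in> gG d" "x \<in> gG d \<Longrightarrow> - x \<in> gG d"
  "p \<in> PL_grading n a \<Longrightarrow> x \<in> gG b \<Longrightarrow> p * x \<in> gG (a + b)"
proof -
  have deg: "homogeneous (a + b - 1) (s * f)" if "homogeneous a s" "homogeneous (b - 1) f"
    for s f :: "(nat, 'k) mp"
    using homogeneous_mult[OF that] by (simp add: algebra_simps)
  have "(\<lambda>_. 0) \<in> tangent_fields_deg n Z (d - 1)"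
    by (simp add: tangent_fields_deg_def tangent_fields_0)
  then have "0 \<in> F_poly n ` tangent_fields_deg n Z (d - 1)"
    using imageI[of _ _ "F_poly n"] by (fastforce simp: F_poly_0)
  then show "0 \<in> gG d" "x \<in> gG d \<Longrightarrow> y \<in> gG d \<Longrightarrow> x + y \<in> gG d" "x \<in> gG d \<Longrightarrow> - x \<in> gG d"
    "p \<in> PL_grading n a \<Longrightarrow> x \<in> gG b \<Longrightarrow> p * x \<in> gG (a + b)"
    unfolding gG_eq PL_grading_eq
    by (auto simp: F_poly_add[symmetric] F_poly_uminus[symmetric] F_poly_mult[symmetric]
          tangent_fields_deg_def deg
        intro!: imageI tangent_fields_add tangent_fields_uminus tangent_fields_mult
          homogeneous_add homogeneous_uminus)
qed

lemma gG_carrier: "gG d \<subseteq> carrier G"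
  unfolding gG_eq G_carrier by (auto simp: tangent_fields_deg_def)

lemma abelian_group_G: "abelian_group G"
proof (rule abelian_groupI)
  fix x assume "x \<in> carrier G"
  then show "\<exists>y\<in>carrier G. y \<oplus>\<^bsub>G\<^esub> x = \<zero>\<^bsub>G\<^esub>"
    using G_closed(3) by (intro bexI[of _ "- x"]) (auto simp: gg_simps)
qed (auto simp: gg_simps G_closed algebra_simps)

lemma G_decomposition:
  assumes x: "x \<in> carrier G"
  shows "\<exists>c. (\<forall>d. c d \<in> gG d) \<and> finite {d. c d \<noteq> 0} \<and> x = sum c {d. c d \<noteq> 0}"
proof -
  obtain f where f: "f \<in> tangent_fields n Z" "x = F_poly n f" using x by (auto simp: G_carrier)
  define D where "D = (\<Union>i\<le>n. wdeg UNIV ` keys (f i))"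
  \<comment> \<open>Degree \<open>d\<close> takes the components of degree \<open>d - 1\<close>.
    Below 1 the truncated \<open>nat (d - 1)\<close> would repeat the component of degree 0, hence
    the explicit zero.\<close>
  define c where "c d = (if d \<ge> 1 then F_poly n (\<lambda>i. hcomp (nat (d - 1)) (f i)) else 0)" for d
  have finD: "finite D" by (simp add: D_def)
  have hcomp_0: "hcomp k (f i) = 0" if "k \<notin> D" "i \<le> n" for k i
    using that by (auto simp: hcomp_def D_def keys_mp_filter simp flip: keys_eq_empty)
  have cG: "c d \<in> gG d" for d
  proof (cases "d \<ge> 1")
    case True
    then have "(\<lambda>i. hcomp (nat (d - 1)) (f i)) \<in> tangent_fields_deg n Z (d - 1)"
      using hcomp_tangent_fields[OF f(1), of "nat (d - 1)"] homogeneous_hcomp[of "nat (d - 1)" "f _"]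
      by (auto simp: tangent_fields_deg_def)
    then show ?thesis using True by (auto simp: c_def gG_eq)
  qed (simp add: c_def gG_closed)
  have supp: "{d. c d \<noteq> 0} \<subseteq> (\<lambda>k. int k + 1) ` D"
  proof clarify
    fix d assume d: "c d \<noteq> 0"
    then have "d \<ge> 1" by (auto simp: c_def split: if_splits)
    moreover have "nat (d - 1) \<in> D"
    proof (rule ccontr)
      assume "nat (d - 1) \<notin> D"
      then have "F_poly n (\<lambda>i. hcomp (nat (d - 1)) (f i)) = F_poly n (\<lambda>_. 0)"
        by (intro F_poly_cong) (simp add: hcomp_0)
      with d show False by (simp add: c_def F_poly_0 split: if_splits)
    qed
    ultimately show "d \<in> (\<lambda>k. int k + 1) ` D"
      by (intro image_eqI[of _ _ "nat (d - 1)"]) auto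
  qed
  have "x = F_poly n (\<lambda>i. \<Sum>k\<in>D. hcomp k (f i))"
    unfolding f(2) by (intro F_poly_cong sum_hcomp[symmetric] finD) (auto simp: D_def)
  also have "\<dots> = (\<Sum>k\<in>D. c (int k + 1))"
    by (simp add: F_poly_sum c_def)
  also have "\<dots> = sum c ((\<lambda>k. int k + 1) ` D)"
    by (subst sum.reindex) (auto simp: inj_on_def)
  also have "\<dots> = sum c {d. c d \<noteq> 0}"
    using finD supp by (intro sum.mono_neutral_right) auto
  finally show ?thesis
    using cG finite_subset[OF supp] finD by blast
qed

lemma graded_module_G: "graded_module (PL n) (PL_grading n) G gG"
proof -
  interpret G: abelian_group G by (rule abelian_group_G)
  have mod: "Module.module (PL n) G"
    by (rule moduleI[OF cring_PL[OF n] abelian_group_G]) (auto simp: gg_simps G_closed algebra_simps)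
  have sub: "subgroup (gG d) (add_monoid G)" for d
  proof (rule subgroup.intro)
    fix x assume x: "x \<in> gG d"
    then have xG: "x \<in> carrier G" using gG_carrier by blast
    have "\<ominus>\<^bsub>G\<^esub> x = - x"
      using xG G_closed(3)[OF xG] by (intro G.minus_equality) (auto simp: gg_simps)
    then have "inv\<^bsub>add_monoid G\<^esub> x = - x" by (simp add: a_inv_def)
    then show "inv\<^bsub>add_monoid G\<^esub> x \<in> gG d" using x by (simp add: gG_closed)
  qed (use gG_carrier in \<open>auto simp: gg_simps gG_closed\<close>)
  have dec: "\<exists>!c. (\<forall>d. c d \<in> gG d) \<and> finite {d. c d \<noteq> \<zero>\<^bsub>G\<^esub>} \<and> x = finsum G c {d. c d \<noteq> \<zero>\<^bsub>G\<^esub>}"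
    (is "\<exists>!c. ?Q c") if x: "x \<in> carrier G" for x
  proof -
    have Q_iff: "?Q c \<longleftrightarrow> (\<forall>d. c d \<in> gG d) \<and> finite {d. c d \<noteq> 0} \<and> x = sum c {d. c d \<noteq> 0}" for c
    proof -
      have "finsum G c {d. c d \<noteq> 0} = sum c {d. c d \<noteq> 0}" if "\<forall>d. c d \<in> gG d" "finite {d. c d \<noteq> 0}"
        using that gG_carrier by (intro finsum_gg G.abelian_monoid_axioms) auto
      then show ?thesis by (auto simp: gg_simps)
    qed
    obtain c where c: "?Q c" using G_decomposition[OF x] Q_iff by blast
    show ?thesis
    proof (rule ex1I)
      show "?Q c" by (rule c)
      fix c' assume c': "?Q c'"
      \<comment> \<open>On the union of both supports the difference of the two decompositions sums
        to zero, and independence of degrees applies.\<close>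
      let ?A = "{d. c d \<noteq> 0} \<union> {d. c' d \<noteq> 0}"
      have fin: "finite ?A" using c c' by (simp add: gg_simps)
      have "sum c ?A = sum c {d. c d \<noteq> 0}" "sum c' ?A = sum c' {d. c' d \<noteq> 0}"
        using fin by (auto intro!: sum.mono_neutral_right)
      then have sum: "(\<Sum>d\<in>?A. c' d - c d) = 0"
        using c c' unfolding Q_iff sum_subtractf by simp
      have mem: "c' d - c d \<in> m_gg_grading n d" for d
      proof -
        have "c' d + - c d \<in> gG d" using c c' by (intro gG_closed) auto
        then show ?thesis by (simp add: gg_grading_def)
      qed
      have "c' d - c d = 0" if "d \<in> ?A" for d
        using m_gg_grading_independent[OF n fin mem sum that] .
      then show "c' = c" by (intro ext) (metis (mono_tags, lifting) UnI1 UnI2 eq_iff_diff_eq_0 mem_Collect_eq)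
    qed
  qed
  show ?thesis
    unfolding graded_module_def using mod sub dec gG_closed(4) by (simp add: gg_simps)
qed

section \<open>The isomorphism\<close>

abbreviation "A \<equiv> dual_arrangement n Z"
abbreviation "D \<equiv> log_derivations n A"

lemma D_carrier: "carrier D = theta n ` tangent_fields n Z"
proof
  show "carrier D \<subseteq> theta n ` tangent_fields n Z"
  proof
    fix \<theta> assume \<theta>: "\<theta> \<in> carrier D"
    then have der: "\<theta> \<in> derivations n" by (simp add: log_derivations_def)
    let ?f = "\<lambda>i. \<theta> (mp_var i)"
    have eq: "\<theta> = theta n ?f" using der by (rule derivations_eq_theta)
    have "?f i \<in> carrier (coord_ring n)" if "i \<le> n" for i
      using der mpoly_carrier_var[of i "{..n}"] that by (auto simp: derivations_def)
    with theta_log_iff[OF n Z, of ?f] \<theta> eq have "?f \<in> tangent_fields n Z"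
      by (simp add: tangent_fields_def)
    with eq show "\<theta> \<in> theta n ` tangent_fields n Z" by blast
  qed
  show "theta n ` tangent_fields n Z \<subseteq> carrier D"
    using theta_log_iff[OF n Z] by (auto simp: tangent_fields_def)
qed

lemma D_simps:
  "theta n f \<oplus>\<^bsub>D\<^esub> theta n g = theta n (\<lambda>i. f i + g i)" "\<zero>\<^bsub>D\<^esub> = theta n (\<lambda>_. 0)"
  "s \<odot>\<^bsub>D\<^esub> theta n f = theta n (\<lambda>i. s * f i)"
  by (auto simp: log_derivations_def theta_def fun_eq_iff restrict_def algebra_simps sum.distrib sum_distrib_left)

lemma abelian_group_D: "abelian_group D"
proof (rule abelian_groupI)
  fix x assume "x \<in> carrier D"
  then obtain f where f: "f \<in> tangent_fields n Z" "x = theta n f" by (auto simp: D_carrier)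
  show "\<exists>y\<in>carrier D. y \<oplus>\<^bsub>D\<^esub> x = \<zero>\<^bsub>D\<^esub>"
    using tangent_fields_uminus[OF f(1)] f
    by (intro bexI[of _ "theta n (\<lambda>i. - f i)"]) (auto simp: D_carrier D_simps)
qed (auto simp: D_carrier D_simps algebra_simps intro!: imageI tangent_fields_0 tangent_fields_add)

text \<open>Unit vectors recover each \<open>f i\<close> from the values on linear forms; conversely
  those values are linear combinations of the \<open>f i\<close>.\<close>

lemma D_grading: "log_derivations_grading n A d = theta n ` tangent_fields_deg n Z d"
proof -
  have "(\<forall>v\<in>carrier_vec (Suc n). homogeneous d (theta n f (lin_form n v))) \<longleftrightarrow> (\<forall>i\<le>n. homogeneous d (f i))"
    for f :: "nat \<Rightarrow> (nat, 'k) mp"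
  proof (intro iffI allI impI ballI)
    fix i assume hom: "\<forall>v\<in>carrier_vec (Suc n). homogeneous d (theta n f (lin_form n v))" and i: "i \<le> n"
    have "theta n f (lin_form n (unit_vec (Suc n) i)) = (\<Sum>j\<in>{i}. f j)"
      unfolding theta_lin_form using i
      by (intro sum.mono_neutral_cong_right) (auto simp: unit_vec_def)
    then have "theta n f (lin_form n (unit_vec (Suc n) i)) = f i" by simp
    with hom show "homogeneous d (f i)" by (metis unit_vec_carrier)
  next
    fix v :: "'k vec" assume "\<forall>i\<le>n. homogeneous d (f i)"
    then show "homogeneous d (theta n f (lin_form n v))"
      unfolding theta_lin_form by (intro homogeneous_sum homogeneous_const_mult) auto
  qed
  then show ?thesis
    unfolding log_derivations_grading_def D_carrier by (auto simp: tangent_fields_deg_def)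
qed

definition field_F :: "((nat, 'k) mp \<Rightarrow> (nat, 'k) mp) \<Rightarrow> (xavar, 'k) mp" where
  "field_F \<theta> = F_poly n (\<lambda>i. \<theta> (mp_var i))"

lemma field_F_theta: "field_F (theta n f) = F_poly n f"
  unfolding field_F_def by (intro F_poly_cong) (simp add: theta_var)

text \<open>Exactness at \<open>D(A_Z)\<close>: Euler multiples are tangent to every hyperplane and
  are all that \<open>F\<close> kills. Hence the classes in \<open>D0\<close> are the fibres of
  \<open>field_F\<close>.\<close>

lemma euler_submodule_eq: "euler_submodule n A = {\<theta> \<in> carrier D. field_F \<theta> = 0}"
proof -
  let ?E = "{theta n (\<lambda>i. g * mp_var i) | g. g \<in> carrier (coord_ring n :: (nat, 'k) mp ring)}"
  have "euler_submodule n A = ?E"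
    by (simp add: euler_submodule_def euler_def D_simps)
  also have "\<dots> = {\<theta> \<in> carrier D. field_F \<theta> = 0}"
  proof (intro equalityI subsetI)
    fix \<theta> assume "\<theta> \<in> ?E"
    then obtain g where g: "g \<in> carrier (coord_ring n)" "\<theta> = theta n (\<lambda>i. g * mp_var i)" by blast
    then have "(\<lambda>i. g * mp_var i) \<in> tangent_fields n Z" by (intro tangent_fields_euler_multiple)
    moreover from this have "F_poly n (\<lambda>i. g * mp_var i) = 0"
      using F_poly_eq_0_iff[OF n, of "\<lambda>i. g * mp_var i"] g(1) by (auto simp: tangent_fields_def)
    ultimately show "\<theta> \<in> {\<theta> \<in> carrier D. field_F \<theta> = 0}"
      by (auto simp: g(2) field_F_theta D_carrier)
  next
    fix \<theta> assume "\<theta> \<in> {\<theta> \<in> carrier D. field_F \<theta> = 0}"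
    then obtain f where f: "f \<in> tangent_fields n Z" "\<theta> = theta n f" "F_poly n f = 0"
      by (auto simp: D_carrier field_F_theta)
    then obtain g where "g \<in> carrier (coord_ring n)" "\<forall>i\<le>n. f i = g * mp_var i"
      using F_poly_eq_0_iff[OF n, of f] by (auto simp: tangent_fields_def)
    then show "\<theta> \<in> ?E"
      using f(2) theta_cong[of n f "\<lambda>i. g * mp_var i"] by blast
  qed
  finally show ?thesis .
qed

section \<open>The quotient by the Euler derivation\<close>

interpretation D0: kernel_quotient "add_monoid D" field_F "euler_submodule n A"
proof (intro kernel_quotient.intro kernel_quotient_axioms.intro)
  show "group (add_monoid D)" using abelian_group_D by (rule abelian_group.a_group)
  show "field_F (x \<otimes>\<^bsub>add_monoid D\<^esub> y) = field_F x + field_F y"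
    if "x \<in> carrier (add_monoid D)" "y \<in> carrier (add_monoid D)" for x y
    using that by (auto simp: D_carrier D_simps field_F_theta F_poly_add)
  show "euler_submodule n A = {x \<in> carrier (add_monoid D). field_F x = 0}"
    by (simp add: euler_submodule_eq)
qed

lemma D0_simps:
  "carrier (D0 n A) = rcosets\<^bsub>add_monoid D\<^esub> (euler_submodule n A)"
  "x \<oplus>\<^bsub>D0 n A\<^esub> y = x <#>\<^bsub>add_monoid D\<^esub> y" "\<zero>\<^bsub>D0 n A\<^esub> = euler_submodule n A"
  "D0_class n A \<theta> = euler_submodule n A #>\<^bsub>add_monoid D\<^esub> \<theta>"
  by (simp_all add: D0_def quot_module_def A_RCOSETS_def set_add_def D0_class_def a_r_coset_def)

lemma D_smult:
  assumes "s \<in> carrier (coord_ring n)" "\<theta> \<in> carrier D"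
  shows "s \<odot>\<^bsub>D\<^esub> \<theta> \<in> carrier D" "field_F (s \<odot>\<^bsub>D\<^esub> \<theta>) = tau n s * field_F \<theta>"
  using assms by (auto simp: D_carrier D_simps field_F_theta F_poly_mult intro!: imageI tangent_fields_mult)

lemma D0_smult:
  assumes s: "s \<in> carrier (coord_ring n)" and C: "C \<in> carrier (D0 n A)"
  shows "s \<odot>\<^bsub>D0 n A\<^esub> C \<in> carrier (D0 n A)" "D0.ind (s \<odot>\<^bsub>D0 n A\<^esub> C) = tau n s * D0.ind C"
proof -
  obtain \<theta> where \<theta>: "\<theta> \<in> carrier D" "C = euler_submodule n A #>\<^bsub>add_monoid D\<^esub> \<theta>"
    using C by (auto simp: D0_simps D0.rcosets_eq)
  have "s \<odot>\<^bsub>D0 n A\<^esub> C = euler_submodule n A #>\<^bsub>add_monoid D\<^esub> (s \<odot>\<^bsub>D\<^esub> \<theta>)"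
    unfolding D0_def quot_module_def a_r_coset_def \<theta>(2)
    using D0.rcos_lift[of \<theta> "\<lambda>\<theta>. s \<odot>\<^bsub>D\<^esub> \<theta>" "\<lambda>y. tau n s * y"] D_smult[OF s] \<theta>(1) by simp
  then show "s \<odot>\<^bsub>D0 n A\<^esub> C \<in> carrier (D0 n A)" "D0.ind (s \<odot>\<^bsub>D0 n A\<^esub> C) = tau n s * D0.ind C"
    using D_smult[OF s \<theta>(1)] \<theta> by (auto simp: D0_simps D0.rcosets_eq D0.ind_rcos)
qed

lemma D0_ind_bij: "bij_betw D0.ind (carrier (D0 n A)) (carrier G)"
proof -
  have "field_F ` carrier D = carrier G"
    by (auto simp: D_carrier G_carrier image_image field_F_theta)
  then show ?thesis using D0.bij_ind by (simp add: D0_simps)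
qed

lemma D0_grading_image: "D0_grading n A d \<subseteq> carrier (D0 n A)" "D0.ind ` D0_grading n A d = gG (d + 1)"
proof -
  have eq: "D0_grading n A d = {euler_submodule n A #>\<^bsub>add_monoid D\<^esub> \<theta> | \<theta>. \<theta> \<in> theta n ` tangent_fields_deg n Z d}"
    by (simp add: D0_grading_def quot_grading_def a_r_coset_def D_grading)
  have sub: "theta n f \<in> carrier (add_monoid D)" if "f \<in> tangent_fields_deg n Z d" for f
    using that by (auto simp: D_carrier tangent_fields_deg_def)
  show "D0_grading n A d \<subseteq> carrier (D0 n A)"
    unfolding eq D0_simps D0.rcosets_eq using sub by blast
  have "D0.ind (euler_submodule n A #>\<^bsub>add_monoid D\<^esub> theta n f) = F_poly n f"
    if "f \<in> tangent_fields_deg n Z d" for f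
    using D0.ind_rcos[OF sub[OF that]] by (simp add: field_F_theta)
  then show "D0.ind ` D0_grading n A d = gG (d + 1)"
    unfolding eq gG_eq by (auto simp: image_iff) force
qed

section \<open>Base change to \<open>PL(n)\<close>\<close>

interpretation BC: base_change_embedding "coord_ring n :: (nat, 'k) mp ring" "tau n" "PL n" "D0 n A" D0.ind
proof
  show "tau n ` carrier (coord_ring n) = carrier (PL n :: (xavar, 'k) mp ring)"
    by (simp add: PL_carrier[OF n])
  show "x \<oplus>\<^bsub>D0 n A\<^esub> y \<in> carrier (D0 n A)" "D0.ind (x \<oplus>\<^bsub>D0 n A\<^esub> y) = D0.ind x + D0.ind y"
    if "x \<in> carrier (D0 n A)" "y \<in> carrier (D0 n A)" for x y
    using that D0.ind_mult by (simp_all add: D0_simps)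
  have one: "\<one>\<^bsub>add_monoid D\<^esub> \<in> carrier (add_monoid D)" by (rule D0.one_closed)
  show "\<zero>\<^bsub>D0 n A\<^esub> \<in> carrier (D0 n A)"
    unfolding D0_simps D0.rcosets_eq using one D0.rcos_one by blast
  show "D0.ind \<zero>\<^bsub>D0 n A\<^esub> = 0"
    using D0.ind_rcos[OF one] D0.\<Phi>_one D0.rcos_one by (simp add: D0_simps)
  show "inj_on D0.ind (carrier (D0 n A))" using D0_ind_bij by (simp add: bij_betw_def)
  show "D0.ind x - D0.ind y \<in> D0.ind ` carrier (D0 n A)"
    if "x \<in> carrier (D0 n A)" "y \<in> carrier (D0 n A)" for x y
  proof -
    have "D0.ind x \<in> carrier G" "D0.ind y \<in> carrier G"
      using that bij_betwE[OF D0_ind_bij] by auto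
    then have "D0.ind x + - D0.ind y \<in> carrier G" by (intro G_closed)
    then show ?thesis using D0_ind_bij by (simp add: bij_betw_def)
  qed
qed (use n PL_closed PL_0_1 D0_smult in auto)

text \<open>The witness is \<open>BC.ind\<close>, which sends \<open>p \<otimes> [\<theta>]\<close>
  to \<open>p * field_F \<theta>\<close>. The grading of \<open>I^gg(Z)\<close> is pulled back along
  it.\<close>

lemma base_change_iso:
  "\<exists>\<eta>. graded_module_iso (PL n) (PL_grading n)
      (base_change (coord_ring n) (tau n) (PL n) (D0 n A))
      (base_change_grading (coord_ring n) (tau n) (PL n) (PL_grading n) (D0 n A)
        (twist (D0_grading n A) (-1))) G gG \<eta> \<and>
    (\<forall>f\<in>tangent_fields n Z. \<eta> (pure_tensor (coord_ring n) (tau n) (PL n) (D0 n A)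
        \<one>\<^bsub>PL n\<^esub> (D0_class n A (theta n f))) = F_poly n f)"
proof (intro exI conjI ballI)
  have PL_grading_carrier: "PL_grading n d \<subseteq> carrier (PL n :: (xavar, 'k) mp ring)" for d
    by (auto simp: PL_grading_eq PL_carrier[OF n])
  have one: "1 \<in> PL_grading n 0"
    unfolding PL_grading_eq by (intro image_eqI[of _ _ 1]) (auto intro: homogeneous_1)
  have tw: "twist (D0_grading n A) (-1) d \<subseteq> carrier (D0 n A)"
    "D0.ind ` twist (D0_grading n A) (-1) d = gG d" for d
    \<comment> \<open>Degree \<open>d\<close> of the twist is degree \<open>d - 1\<close> of
      \<open>D0\<close>, which \<open>D0.ind\<close> raises by one.\<close>
    using D0_grading_image[of "- 1 + d"] by (simp_all add: twist_def)
  note grading = BC.base_change_grading_image[of gG "PL_grading n" "twist (D0_grading n A) (-1)",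
      OF gG_closed(1-3) PL_grading_carrier one tw gG_closed(4)]
  have img: "BC.frag_map ` carrier BC.F = carrier G"
    using D0_ind_bij by (simp add: BC.frag_map_image bij_betw_def)
  show "graded_module_iso (PL n) (PL_grading n) BC.B
      (base_change_grading (coord_ring n) (tau n) (PL n) (PL_grading n) (D0 n A)
        (twist (D0_grading n A) (-1))) G gG BC.ind"
  proof (rule graded_module_iso_transport[OF graded_module_G])
    show "bij_betw BC.ind (carrier BC.B) (carrier G)"
      using BC.bij_ind by (simp add: BC.base_change_simps img)
    show "\<zero>\<^bsub>BC.B\<^esub> \<in> carrier BC.B"
      unfolding BC.base_change_simps BC.rcosets_eq using BC.rcos_one BC.one_closed by blast
    show "BC.ind \<zero>\<^bsub>BC.B\<^esub> = \<zero>\<^bsub>G\<^esub>"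
      using BC.ind_rcos[OF BC.one_closed] BC.\<Phi>_one BC.rcos_one
      by (simp add: BC.base_change_simps gg_simps)
  qed (use BC.ind_mult BC.ind_smult grading PL_grading_carrier in
      \<open>auto simp: BC.base_change_simps gg_simps\<close>)
  fix f assume f: "f \<in> tangent_fields n Z"
  then have \<theta>: "theta n f \<in> carrier (add_monoid D)" by (auto simp: D_carrier)
  then have C: "D0_class n A (theta n f) \<in> carrier (D0 n A)"
    unfolding D0_simps D0.rcosets_eq by blast
  then show "BC.ind (pure_tensor (coord_ring n) (tau n) (PL n) (D0 n A)
        \<one>\<^bsub>PL n\<^esub> (D0_class n A (theta n f))) = F_poly n f"
    using BC.ind_pure_tensor(2)[OF PL_0_1(2)[OF n] C] D0.ind_rcos[OF \<theta>]
    by (simp add: D0_simps(4) field_F_theta)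
qed

end

theorem theorem4p8:
  fixes n :: nat and Z :: "'k::alg_closed_field vec set set"
  assumes "n \<ge> 1" and "Z \<subseteq> proj_space n" and "finite Z"
  shows
    "(\<forall>f \<in> {..n} \<rightarrow>\<^sub>E carrier (coord_ring n).
        theta n f \<in> carrier (log_derivations n (dual_arrangement n Z)) \<longleftrightarrow>
        F_poly n f \<in> ext_ideal n (vanishing_ideal n Z)) \<and>
     (\<forall>f \<in> {..n} \<rightarrow>\<^sub>E carrier (coord_ring n).
        F_poly n f = (0 :: (xavar, 'k) mp) \<longleftrightarrow>
        (\<exists>g\<in>carrier (coord_ring n). theta n f = (\<lambda>p\<in>carrier (coord_ring n). g * euler n p))) \<and>
     (\<exists>\<eta>. graded_module_iso (PL n) (PL_grading n)
            (base_change (coord_ring n) (tau n) (PL n) (D0 n (dual_arrangement n Z)))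
            (base_change_grading (coord_ring n) (tau n) (PL n) (PL_grading n)
               (D0 n (dual_arrangement n Z)) (twist (D0_grading n (dual_arrangement n Z)) (-1)))
            (gg n (vanishing_ideal n Z)) (gg_grading n (vanishing_ideal n Z)) \<eta> \<and>
          (\<forall>f \<in> {..n} \<rightarrow>\<^sub>E carrier (coord_ring n).
             theta n f \<in> carrier (log_derivations n (dual_arrangement n Z)) \<longrightarrow>
             \<eta> (pure_tensor (coord_ring n) (tau n) (PL n) (D0 n (dual_arrangement n Z))
                  \<one>\<^bsub>PL n\<^esub> (D0_class n (dual_arrangement n Z) (theta n f))) =
             (\<Sum>i\<le>n. tau n (f i) * mp_var (XV i))))"
proof (intro conjI ballI)
  fix f :: "nat \<Rightarrow> (nat, 'k) mp" assume f: "f \<in> {..n} \<rightarrow>\<^sub>E carrier (coord_ring n)"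
  then have fi: "f i \<in> carrier (coord_ring n)" if "i \<le> n" for i using that by auto
  show "theta n f \<in> carrier (log_derivations n (dual_arrangement n Z)) \<longleftrightarrow>
    F_poly n f \<in> ext_ideal n (vanishing_ideal n Z)"
    using theta_log_iff[OF assms(1,2) fi] F_poly_in_ext_ideal_iff[OF assms(1,2) fi] by simp
  show "F_poly n f = 0 \<longleftrightarrow>
    (\<exists>g\<in>carrier (coord_ring n). theta n f = (\<lambda>p\<in>carrier (coord_ring n). g * euler n p))"
    using F_poly_eq_0_iff[OF assms(1) fi] theta_eq_iff[OF fi] by auto
next
  obtain \<eta> where \<eta>: "graded_module_iso (PL n) (PL_grading n)
      (base_change (coord_ring n) (tau n) (PL n) (D0 n (dual_arrangement n Z)))
      (base_change_grading (coord_ring n) (tau n) (PL n) (PL_grading n)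
         (D0 n (dual_arrangement n Z)) (twist (D0_grading n (dual_arrangement n Z)) (-1)))
      (gg n (vanishing_ideal n Z)) (gg_grading n (vanishing_ideal n Z)) \<eta>"
    and pure: "\<And>f. f \<in> tangent_fields n Z \<Longrightarrow>
      \<eta> (pure_tensor (coord_ring n) (tau n) (PL n) (D0 n (dual_arrangement n Z))
        \<one>\<^bsub>PL n\<^esub> (D0_class n (dual_arrangement n Z) (theta n f))) = F_poly n f"
    using base_change_iso[OF assms(1,2)] by blast
  have "F_poly n f = (\<Sum>i\<le>n. tau n (f i) * mp_var (XV i))" for f :: "nat \<Rightarrow> (nat, 'k) mp"
    by (simp add: F_poly_def mult.commute)
  moreover have "f \<in> tangent_fields n Z"
    if "f \<in> {..n} \<rightarrow>\<^sub>E carrier (coord_ring n)" "theta n f \<in> carrier (log_derivations n (dual_arrangement n Z))" for f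
  proof -
    have fi: "f i \<in> carrier (coord_ring n)" if "i \<le> n" for i using that \<open>f \<in> _\<close> by auto
    show ?thesis using theta_log_iff[OF assms(1,2) fi] fi that(2) by (simp add: tangent_fields_def)
  qed
  ultimately show "\<exists>\<eta>. graded_module_iso (PL n) (PL_grading n)
            (base_change (coord_ring n) (tau n) (PL n) (D0 n (dual_arrangement n Z)))
            (base_change_grading (coord_ring n) (tau n) (PL n) (PL_grading n)
               (D0 n (dual_arrangement n Z)) (twist (D0_grading n (dual_arrangement n Z)) (-1)))
            (gg n (vanishing_ideal n Z)) (gg_grading n (vanishing_ideal n Z)) \<eta> \<and>
          (\<forall>f \<in> {..n} \<rightarrow>\<^sub>E carrier (coord_ring n).
             theta n f \<in> carrier (log_derivations n (dual_arrangement n Z)) \<longrightarrow>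
             \<eta> (pure_tensor (coord_ring n) (tau n) (PL n) (D0 n (dual_arrangement n Z))
                  \<one>\<^bsub>PL n\<^esub> (D0_class n (dual_arrangement n Z) (theta n f))) =
             (\<Sum>i\<le>n. tau n (f i) * mp_var (XV i)))"
    using \<eta> pure by (intro exI[of _ \<eta>]) auto
qed

end
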